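(* Let $r=s=1$ and let $(X,Y)$ have a continuous bivariate distribution with $X$ and $Y$ independent. Let $Z^1,Z^2,\dots$ be i.i.d. copies of $(X,Y)$, and let $$\mathcal{Z}=\sum_{i=1}^\infty\sum_{j=1}^\infty\frac1{i^2j^2}\bigl(\chi^2_{1,ij}-1\bigr),$$ where $\{\chi^2_{1,ij}:i,j\ge1\}$ are i.i.d. chi-square random variables with one degree of freedom. Then, as $n\to\infty$, in distribution, $$n\,U_{\tau^*}(Z^{[n]})\to\frac{36}{\pi^4}\mathcal{Z},\qquad n\,U_D(Z^{[n]})\to\frac1{\pi^4}\mathcal{Z},\qquad n\,U_R(Z^{[n]})\to\frac1{\pi^4}\mathcal{Z}.$$
   Context: "Continuous" means that the cumulative distribution function is continuous. For $w^{[m]}=(w^1,\dots,w^m)\in\mathbb{R}^m$ and $\sigma\in S_m$, $w^{\sigma[m]}=(w^{\sigma^{-1}(1)},\dots,w^{\sigma^{-1}(m)})$. Let $H_{\tau^*}=\langle(1\ 4),(2\ 3)\rangle\le S_m$. Given $I_X,I_Y:\mathbb{R}^m\to\{0,1\}$ and $c>0$, for $z^i=(x^i,y^i)\in\mathbb{R}^2$ let $$k(z^{[m]})=c\Big(\sum_{\sigma\in H_{\tau^*}}\mathrm{sign}(\sigma)I_X(x^{\sigma[m]})\Big)\Big(\sum_{\sigma\in H_{\tau^*}}\mathrm{sign}(\sigma)I_Y(y^{\sigma[m]})\Big),\quad\kappa(z^{[m]})=\frac1{m!}\sum_{\sigma\in S_m}k(z^{\sigma[m]}),$$ and $U(z^{[n]})=\binom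 nm^{-1}\sum_{1\le i_1<\dots<i_m\le n}\kappa(z^{i_1},\dots,z^{i_m})$ for $n\ge m$. Then: $U_{\tau^*}$ is the case $m=4$, $c=1$, $I_X(w)=I_Y(w)=1_{[\max(w^1,w^2)<\min(w^3,w^4)]}$. $U_D$ is the case $m=5$, $c=\frac14$, $I_X(w)=I_Y(w)=1_{[\max(w^1,w^2)\le w^5<\min(w^3,w^4)]}$. $U_R$ is the case $m=6$, $c=\frac14$, $I_X(w)=1_{[\max(w^1,w^2)\le w^5<\min(w^3,w^4)]}$, $I_Y(w)=1_{[\max(w^1,w^2)\le w^6<\min(w^3,w^4)]}$. (These are unbiased estimators of the Bergsma--Dassios $\tau^*$, of $D=\int(F_{XY}-F_XF_Y)^2\mathrm{d}F_{XY}$, and of $R=\int(F_{XY}-F_XF_Y)^2\mathrm{d}F_X\mathrm{d}F_Y$, respectively.) *)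

theory Defs
  imports
    "HOL-Probability.Probability"
    "HOL-Algebra.Sym_Groups"
    "HOL-Combinatorics.Permutations"
begin

text \<open>
  A tuple \<open>w\<^sup>1, \<dots>, w\<^sup>m\<close> is a function \<open>w :: nat \<Rightarrow> 'a\<close> of which only the values on
  \<open>{1..m}\<close> matter. The inverse is written with \<open>inv_into\<close>, since \<open>inv\<close> denotes the group
  inverse of HOL-Algebra here.
\<close>

definition perm_tuple :: "(nat \<Rightarrow> nat) \<Rightarrow> (nat \<Rightarrow> 'a) \<Rightarrow> nat \<Rightarrow> 'a" where
  "perm_tuple \<sigma> w = (\<lambda>i. w (inv_into UNIV \<sigma> i))"

definition H_tau :: "nat \<Rightarrow> (nat \<Rightarrow> nat) set" where
  "H_tau m = generate (sym_group m) {Transposition.transpose 1 4, Transposition.transpose 2 3}"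

definition signed_sum :: "nat \<Rightarrow> ((nat \<Rightarrow> real) \<Rightarrow> bool) \<Rightarrow> (nat \<Rightarrow> real) \<Rightarrow> real" where
  "signed_sum m I w = (\<Sum>\<sigma>\<in>H_tau m. of_int (sign \<sigma>) * of_bool (I (perm_tuple \<sigma> w)))"

definition kernel ::
  "nat \<Rightarrow> real \<Rightarrow> ((nat \<Rightarrow> real) \<Rightarrow> bool) \<Rightarrow> ((nat \<Rightarrow> real) \<Rightarrow> bool) \<Rightarrow> (nat \<Rightarrow> real \<times> real) \<Rightarrow> real" where
  "kernel m c IX IY z =
     c * signed_sum m IX (\<lambda>i. fst (z i)) * signed_sum m IY (\<lambda>i. snd (z i))"

definition sym_kernel ::
  "nat \<Rightarrow> real \<Rightarrow> ((nat \<Rightarrow> real) \<Rightarrow> bool) \<Rightarrow> ((nat \<Rightarrow> real) \<Rightarrow> bool) \<Rightarrow> (nat \<Rightarrow> real \<times> real) \<Rightarrow> real" where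
  "sym_kernel m c IX IY z =
     1 / fact m * (\<Sum>\<sigma> | \<sigma> permutes {1..m}. kernel m c IX IY (perm_tuple \<sigma> z))"

text \<open>
  The index set below consists of the tuples \<open>1 \<le> i\<^sub>1 < \<dots> < i\<^sub>m \<le> n\<close>. For \<open>n < m\<close>
  the value is \<open>0\<close>, which is irrelevant for limits as \<open>n\<close> tends to infinity.
\<close>

definition U_stat ::
  "nat \<Rightarrow> real \<Rightarrow> ((nat \<Rightarrow> real) \<Rightarrow> bool) \<Rightarrow> ((nat \<Rightarrow> real) \<Rightarrow> bool) \<Rightarrow> nat \<Rightarrow>
    (nat \<Rightarrow> real \<times> real) \<Rightarrow> real" where
  "U_stat m c IX IY n z =
     1 / real (n choose m) *
     (\<Sum>i | i \<in> {1..m} \<rightarrow>\<^sub>E {1..n} \<and> strict_mono_on {1..m} i. sym_kernel m c IX IY (\<lambda>j. z (i j)))"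

definition I_tau :: "(nat \<Rightarrow> real) \<Rightarrow> bool" where
  "I_tau w \<longleftrightarrow> max (w 1) (w 2) < min (w 3) (w 4)"

definition I_split :: "nat \<Rightarrow> (nat \<Rightarrow> real) \<Rightarrow> bool" where
  "I_split l w \<longleftrightarrow> max (w 1) (w 2) \<le> w l \<and> w l < min (w 3) (w 4)"

definition U_tau :: "nat \<Rightarrow> (nat \<Rightarrow> real \<times> real) \<Rightarrow> real" where
  "U_tau = U_stat 4 1 I_tau I_tau"

definition U_D :: "nat \<Rightarrow> (nat \<Rightarrow> real \<times> real) \<Rightarrow> real" where
  "U_D = U_stat 5 (1/4) (I_split 5) (I_split 5)"

definition U_R :: "nat \<Rightarrow> (nat \<Rightarrow> real \<times> real) \<Rightarrow> real" where
  "U_R = U_stat 6 (1/4) (I_split 5) (I_split 6)"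

definition joint_cdf :: "'a measure \<Rightarrow> ('a \<Rightarrow> real) \<Rightarrow> ('a \<Rightarrow> real) \<Rightarrow> real \<times> real \<Rightarrow> real" where
  "joint_cdf M X Y = (\<lambda>(x, y). measure M {\<omega> \<in> space M. X \<omega> \<le> x \<and> Y \<omega> \<le> y})"

text \<open>The chi-square law with one degree of freedom: the law of the square of an N(0,1) variable.\<close>

definition chi_square_1 :: "real measure" where
  "chi_square_1 = distr (density lborel (\<lambda>x. ennreal (std_normal_density x))) borel (\<lambda>x. x\<^sup>2)"

text \<open>
  The double series converges absolutely almost surely when the \<open>chi i j\<close> are chi-square
  distributed; on the remaining null set the value of \<open>suminf\<close> is arbitrary.
  The indices \<open>Suc i\<close> and \<open>Suc j\<close> make the summation range over \<open>i, j \<ge> 1\<close>.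
\<close>

definition chi_series :: "(nat \<Rightarrow> nat \<Rightarrow> 'a \<Rightarrow> real) \<Rightarrow> 'a \<Rightarrow> real" where
  "chi_series chi \<omega> =
     (\<Sum>i. \<Sum>j. 1 / ((real (Suc i))\<^sup>2 * (real (Suc j))\<^sup>2) * (chi (Suc i) (Suc j) \<omega> - 1))"

definition converges_in_distribution ::
  "'a measure \<Rightarrow> (nat \<Rightarrow> 'a \<Rightarrow> real) \<Rightarrow> 'b measure \<Rightarrow> ('b \<Rightarrow> real) \<Rightarrow> bool" where
  "converges_in_distribution M V N W \<longleftrightarrow>
     weak_conv_m (\<lambda>n. distr M borel (V n)) (distr N borel W)"

end

theory Submission
  imports Defs "HOL-Real_Asymp.Real_Asymp"
begin

text \<open>
  The probability integral transform reduces everything to independent uniform coordinates.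
  There all three kernels have, up to constants, the second order projection
  \<open>h(x,x') h(y,y')\<close> with \<open>h(u,v) = 1/3 - max u v + (u\<^sup>2 + v\<^sup>2)/2\<close>, and what
  remains after subtracting the pair projections is negligible in \<open>L\<^sup>2\<close>. By the expansion
  \<open>h(u,v) = \<Sum>\<^sub>k 2 cos(k\<pi>u) cos(k\<pi>v)/(k\<pi>)\<^sup>2\<close> the associated V-statistic is
  \<open>\<Sum> S\<^sub>k\<^sub>l\<^sup>2/(\<pi>\<^sup>4k\<^sup>2l\<^sup>2)\<close> with normalised sums \<open>S\<^sub>k\<^sub>l\<close> of orthonormal functions.
  Writing \<open>exp(-t S\<^sup>2)\<close> as a Gaussian mixture of \<open>exp(i s S)\<close> turns the one-dimensional
  central limit theorem into convergence of the Laplace transform of this nonnegative variable,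
  hence of its characteristic function; the diagonal only contributes its mean \<open>1/36\<close>.
\<close>

subsection \<open>Integrating out coordinates\<close>

text \<open>The limit is centred, whereas Laplace transforms ask for a nonnegative variable. Adding
  the diagonal \<open>p = q\<close> to the sum over distinct pairs repairs this: the result is a sum
  of squares with nonnegative weights. The added diagonal is an average of bounded i.i.d. terms. Its
  mean 1/36 = (1/6)^2 is the sum of all eigenvalues, so removing it again is exactly the centring of
  the chi-square variables. The constants arise as follows. Each factor of the kernel is odd under
  (1 4) and under (2 3), so only the argument pairs {1,2}, {1,3}, {2,4}, {3,4} have a nonzero
  projection. The signs from the X and the Y factor cancel, hence all four contribute equally. If
  one factor projects to d h, the coefficient of the limit is 4 c d^2. Here d = 3, c = 1 for the
  first statistic and d = 1, c = 1/4 for the other two, which gives 36, 1 and 1. Cutting the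
  eigenvalue series at K changes the mean of the V-statistic by a tail that does not depend on n;
  this allows the exchange of the two limits. Laplace transforms at integers suffice, being the
  moments of exp(-V), which lies in [0,1].\<close>

primrec iter_int :: "'a measure \<Rightarrow> nat list \<Rightarrow> ((nat \<Rightarrow> 'a) \<Rightarrow> real) \<Rightarrow> (nat \<Rightarrow> 'a) \<Rightarrow> real" where
  "iter_int \<mu> [] f = f"
| "iter_int \<mu> (s # ss) f = (\<lambda>z. \<integral>w. iter_int \<mu> ss f (z(s := w)) \<partial>\<mu>)"

text \<open>Kernels are functions of tuples indexed by all of \<open>nat\<close>, and
  \<open>dep_on\<close> carries the arity. A kernel, its projections and its reindexed copies then
  have one type, and integrating out coordinates acts as a family of operators on one function
  space.\<close>

definition dep_on :: "nat set \<Rightarrow> ((nat \<Rightarrow> 'a) \<Rightarrow> 'b) \<Rightarrow> bool" where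
  "dep_on A f \<longleftrightarrow> (\<forall>z z'. (\<forall>i\<in>A. z i = z' i) \<longrightarrow> f z = f z')"

definition bounded_measurable :: "'a measure \<Rightarrow> ((nat \<Rightarrow> 'a) \<Rightarrow> real) \<Rightarrow> bool" where
  "bounded_measurable \<mu> f \<longleftrightarrow> f \<in> borel_measurable (PiM UNIV (\<lambda>_. \<mu>)) \<and> (\<exists>B. \<forall>z. \<bar>f z\<bar> \<le> B)"

lemma dep_onD: "dep_on A f \<Longrightarrow> (\<And>i. i \<in> A \<Longrightarrow> z i = z' i) \<Longrightarrow> f z = f z'"
  by (auto simp: dep_on_def)

lemma dep_on_mono: "dep_on A f \<Longrightarrow> A \<subseteq> B \<Longrightarrow> dep_on B f"
  by (auto simp: dep_on_def subset_iff)

lemma bounded_measurableI: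
  "f \<in> borel_measurable (PiM UNIV (\<lambda>_. \<mu>)) \<Longrightarrow> (\<And>z. \<bar>f z\<bar> \<le> B) \<Longrightarrow> bounded_measurable \<mu> f"
  by (auto simp: bounded_measurable_def)

lemma bounded_measurable_const [simp]: "bounded_measurable \<mu> (\<lambda>z. c)"
  by (auto simp: bounded_measurable_def)

lemma bounded_measurable_mult:
  assumes "bounded_measurable \<mu> f" "bounded_measurable \<mu> g"
  shows "bounded_measurable \<mu> (\<lambda>z. f z * g z)"
proof -
  obtain B C where B: "\<And>z. \<bar>f z\<bar> \<le> B" and C: "\<And>z. \<bar>g z\<bar> \<le> C"
    using assms by (auto simp: bounded_measurable_def)
  have "\<bar>f z * g z\<bar> \<le> B * C" for z
    unfolding abs_mult by (rule mult_mono) (use B C in \<open>auto intro: order_trans[OF abs_ge_zero]\<close>)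
  then show ?thesis using assms
    by (intro bounded_measurableI) (auto simp: bounded_measurable_def)
qed

lemma bounded_measurable_diff:
  assumes "bounded_measurable \<mu> f" "bounded_measurable \<mu> g"
  shows "bounded_measurable \<mu> (\<lambda>z. f z - g z)"
proof -
  obtain B C where B: "\<And>z. \<bar>f z\<bar> \<le> B" and C: "\<And>z. \<bar>g z\<bar> \<le> C"
    using assms by (auto simp: bounded_measurable_def)
  have "\<bar>f z - g z\<bar> \<le> B + C" for z
    using B[of z] C[of z] by linarith
  then show ?thesis using assms
    by (intro bounded_measurableI) (auto simp: bounded_measurable_def)
qed

text \<open>With a full space, every coordinate update stays inside the product space, and so does
  the value \<open>undefined\<close> that tuples over a finite index set take elsewhere. Kernels on
  infinite tuples can thus be integrated over any \<open>PiM I\<close>.\<close>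

locale prob_UNIV = prob_space \<mu> for \<mu> :: "'a measure" +
  assumes space_UNIV: "space \<mu> = UNIV"
begin

lemma measurable_fun_upd_UNIV [measurable]:
  "(\<lambda>x. (fst x)(s := snd x)) \<in> PiM UNIV (\<lambda>_::nat. \<mu>) \<Otimes>\<^sub>M \<mu> \<rightarrow>\<^sub>M PiM UNIV (\<lambda>_. \<mu>)"
  by (rule measurable_fun_upd[where J=UNIV]) auto

lemma measurable_PiM_UNIV:
  "(\<lambda>z. z) \<in> PiM I (\<lambda>_::nat. \<mu>) \<rightarrow>\<^sub>M PiM UNIV (\<lambda>_. \<mu>)"
proof (rule measurable_PiM_single')
  fix i :: nat
  show "(\<lambda>z. z i) \<in> PiM I (\<lambda>_. \<mu>) \<rightarrow>\<^sub>M \<mu>"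
  proof (cases "i \<in> I")
    \<comment> \<open>Points of the product are extensional, so outside \<open>I\<close> the
      coordinate is the constant \<open>undefined\<close>.\<close>
    case False
    then have "(\<lambda>z. z i) \<in> PiM I (\<lambda>_. \<mu>) \<rightarrow>\<^sub>M \<mu> \<longleftrightarrow> (\<lambda>z. undefined) \<in> PiM I (\<lambda>_. \<mu>) \<rightarrow>\<^sub>M \<mu>"
      by (intro measurable_cong) (auto simp: space_PiM PiE_def extensional_def)
    then show ?thesis by (simp add: space_UNIV)
  qed simp
qed (auto simp: space_PiM PiE_def space_UNIV)

lemma bounded_measurable_PiM:
  "bounded_measurable \<mu> f \<Longrightarrow> f \<in> borel_measurable (PiM I (\<lambda>_. \<mu>))"
  unfolding bounded_measurable_def by (blast intro: measurable_compose[OF measurable_PiM_UNIV])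

lemma bounded_measurable_section:
  assumes "bounded_measurable \<mu> f"
  shows "integrable \<mu> (\<lambda>w. f (z(s := w)))"
proof -
  obtain B where B: "\<And>z. \<bar>f z\<bar> \<le> B" using assms by (auto simp: bounded_measurable_def)
  have [measurable]: "f \<in> borel_measurable (PiM UNIV (\<lambda>_. \<mu>))"
    using assms by (auto simp: bounded_measurable_def)
  have "(\<lambda>w. z(s := w)) \<in> \<mu> \<rightarrow>\<^sub>M PiM UNIV (\<lambda>_. \<mu>)"
    by (rule measurable_fun_upd[where J=UNIV]) (auto simp: space_PiM space_UNIV)
  from measurable_compose[OF this, of f borel] show ?thesis
    by (intro integrable_const_bound[where B=B]) (auto simp: B)
qed

text \<open>Integrability need not be assumed: a non-integrable function has integral 0, and
  \<open>B\<close> is nonnegative because it bounds an absolute value.\<close>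

lemma abs_int_le:
  fixes f :: "'a \<Rightarrow> real"
  assumes "\<And>w. \<bar>f w\<bar> \<le> B" shows "\<bar>\<integral>w. f w \<partial>\<mu>\<bar> \<le> B"
proof (cases "integrable \<mu> f")
  case True
  have "\<bar>\<integral>w. f w \<partial>\<mu>\<bar> \<le> (\<integral>w. \<bar>f w\<bar> \<partial>\<mu>)" using integral_norm_bound[of \<mu> f] by simp
  also have "\<dots> \<le> (\<integral>w. B \<partial>\<mu>)" using True assms by (intro integral_mono) auto
  finally show ?thesis by (simp add: prob_space)
next
  case False
  then show ?thesis using order_trans[OF abs_ge_zero assms[of undefined]]
    by (simp add: not_integrable_integral_eq)
qed

lemma bounded_measurable_int:
  assumes "bounded_measurable \<mu> f"
  shows "bounded_measurable \<mu> (\<lambda>z. \<integral>w. f (z(s := w)) \<partial>\<mu>)"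
proof -
  obtain B where B: "\<And>z. \<bar>f z\<bar> \<le> B" using assms by (auto simp: bounded_measurable_def)
  have [measurable]: "f \<in> borel_measurable (PiM UNIV (\<lambda>_. \<mu>))"
    using assms by (auto simp: bounded_measurable_def)
  have "(\<lambda>x. f ((fst x)(s := snd x))) \<in> borel_measurable (PiM UNIV (\<lambda>_. \<mu>) \<Otimes>\<^sub>M \<mu>)"
    by measurable
  then have "(\<lambda>z. \<integral>w. f (z(s := w)) \<partial>\<mu>) \<in> borel_measurable (PiM UNIV (\<lambda>_. \<mu>))"
    by (intro borel_measurable_lebesgue_integral) (simp add: split_def)
  then show ?thesis
    by (rule bounded_measurableI[where B=B]) (rule abs_int_le, rule B)
qed

lemma bounded_measurable_iter:
  "bounded_measurable \<mu> f \<Longrightarrow> bounded_measurable \<mu> (iter_int \<mu> ss f)"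
  by (induction ss) (auto intro: bounded_measurable_int)

lemma iter_int_append: "iter_int \<mu> (ss @ ts) f = iter_int \<mu> ss (iter_int \<mu> ts f)"
  by (induction ss) auto

lemma iter_int_zero: "iter_int \<mu> ss (\<lambda>z. 0) = (\<lambda>z. 0)"
  by (induction ss) auto

lemma iter_int_cmult: "iter_int \<mu> ss (\<lambda>z. c * f z) = (\<lambda>z. c * iter_int \<mu> ss f z)"
  by (induction ss) auto

lemma iter_int_diff:
  assumes "bounded_measurable \<mu> f" "bounded_measurable \<mu> g"
  shows "iter_int \<mu> ss (\<lambda>z. f z - g z) = (\<lambda>z. iter_int \<mu> ss f z - iter_int \<mu> ss g z)"
  using assms
  by (induction ss) (auto intro!: Bochner_Integration.integral_diff bounded_measurable_section bounded_measurable_iter)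

lemma iter_int_swap:
  assumes f: "bounded_measurable \<mu> f"
  shows "iter_int \<mu> [s, t] f = iter_int \<mu> [t, s] f"
proof (cases "s = t")
  case False
  obtain B where B: "\<And>z. \<bar>f z\<bar> \<le> B" using f by (auto simp: bounded_measurable_def)
  have fm: "f \<in> borel_measurable (PiM UNIV (\<lambda>_. \<mu>))"
    using f by (auto simp: bounded_measurable_def)
  interpret pair_prob_space \<mu> \<mu> ..
  show ?thesis
  proof
    fix z
    have "(\<lambda>x. z(s := fst x, t := snd x)) \<in> \<mu> \<Otimes>\<^sub>M \<mu> \<rightarrow>\<^sub>M PiM UNIV (\<lambda>_. \<mu>)"
      by (rule measurable_fun_upd[where J=UNIV], simp, rule measurable_fun_upd[where J=UNIV])
        (auto simp: space_PiM space_UNIV)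
    from measurable_compose[OF this fm]
    have "integrable (\<mu> \<Otimes>\<^sub>M \<mu>) (\<lambda>x. f (z(s := fst x, t := snd x)))"
      by (intro P.integrable_const_bound[where B=B]) (auto simp: B)
    then have "integrable (\<mu> \<Otimes>\<^sub>M \<mu>) (\<lambda>(x, y). f (z(s := x, t := y)))"
      by (simp add: split_def)
    from Fubini_integral[OF this] show "iter_int \<mu> [s, t] f z = iter_int \<mu> [t, s] f z"
      using False by (simp add: fun_upd_twist)
  qed
qed simp

lemma iter_int_Cons_commute:
  assumes f: "bounded_measurable \<mu> f"
  shows "iter_int \<mu> [s] (iter_int \<mu> ts f) = iter_int \<mu> ts (iter_int \<mu> [s] f)"
proof (induction ts)
  case (Cons t ts)
  have "iter_int \<mu> [s] (iter_int \<mu> (t # ts) f) = iter_int \<mu> [s, t] (iter_int \<mu> ts f)" by simp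
  also have "\<dots> = iter_int \<mu> [t] (iter_int \<mu> [s] (iter_int \<mu> ts f))"
    by (subst iter_int_swap) (auto intro: bounded_measurable_iter f)
  also have "\<dots> = iter_int \<mu> (t # ts) (iter_int \<mu> [s] f)" by (subst Cons) simp
  finally show ?case .
qed simp

lemma iter_int_commute:
  assumes f: "bounded_measurable \<mu> f"
  shows "iter_int \<mu> ss (iter_int \<mu> ts f) = iter_int \<mu> ts (iter_int \<mu> ss f)"
proof (induction ss)
  case (Cons s ss)
  have "iter_int \<mu> (s # ss) (iter_int \<mu> ts f) = iter_int \<mu> [s] (iter_int \<mu> ts (iter_int \<mu> ss f))"
    by (simp add: Cons)
  also have "\<dots> = iter_int \<mu> ts (iter_int \<mu> (s # ss) f)"
    by (subst iter_int_Cons_commute) (auto intro: bounded_measurable_iter f)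
  finally show ?case .
qed simp

text \<open>The integration over \<open>t\<close> is commuted inwards until it meets the earlier
  integration over \<open>t\<close>, after which the function is constant in that coordinate and the
  total mass is 1.\<close>

lemma iter_int_absorb1:
  assumes f: "bounded_measurable \<mu> f" and "t \<in> set ss"
  shows "iter_int \<mu> [t] (iter_int \<mu> ss f) = iter_int \<mu> ss f"
  using assms(2)
proof (induction ss)
  case (Cons s ss)
  show ?case
  proof (cases "s = t")
    case True
    then show ?thesis by (simp add: prob_space)
  next
    case False
    then have "iter_int \<mu> [t] (iter_int \<mu> ss f) = iter_int \<mu> ss f" using Cons by auto
    moreover have "iter_int \<mu> [t] (iter_int \<mu> [s] (iter_int \<mu> ss f)) = iter_int \<mu> [s] (iter_int \<mu> [t] (iter_int \<mu> ss f))"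
      by (intro iter_int_commute bounded_measurable_iter f)
    ultimately show ?thesis by simp
  qed
qed simp

lemma iter_int_absorb:
  assumes f: "bounded_measurable \<mu> f" and "set ts \<subseteq> set ss"
  shows "iter_int \<mu> ts (iter_int \<mu> ss f) = iter_int \<mu> ss f"
  using assms(2)
proof (induction ts)
  case (Cons t ts)
  then show ?case using iter_int_absorb1[OF f, of t ss] by simp
qed simp

text \<open>Integrations commute and absorb each other, so a function killed by integrating out some
  coordinates is killed by integrating out more, in any order. This turns degeneracy in one pair of
  coordinates into degeneracy for all larger sets.\<close>

lemma iter_int_eq_zero:
  assumes f: "bounded_measurable \<mu> f" and "set ts \<subseteq> set ss" "iter_int \<mu> ts f = (\<lambda>z. 0)"
  shows "iter_int \<mu> ss f = (\<lambda>z. 0)"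
proof -
  have "iter_int \<mu> ss f = iter_int \<mu> ts (iter_int \<mu> ss f)" using iter_int_absorb[OF f assms(2)] by simp
  also have "\<dots> = iter_int \<mu> ss (iter_int \<mu> ts f)" by (rule iter_int_commute[OF f])
  finally show ?thesis using assms(3) by (simp add: iter_int_zero)
qed

lemma iter_int_mult:
  assumes "dep_on (- set ss) g"
  shows "iter_int \<mu> ss (\<lambda>z. f z * g z) = (\<lambda>z. iter_int \<mu> ss f z * g z)"
  using assms
proof (induction ss)
  case (Cons s ss)
  have "dep_on (- set ss) g" using Cons.prems by (rule dep_on_mono) auto
  moreover have "g (z(s := w)) = g z" for z w by (rule dep_onD[OF Cons.prems]) auto
  ultimately show ?case using Cons.IH by auto
qed simp

lemma dep_on_iter:
  "dep_on A f \<Longrightarrow> dep_on (A - set ss) (iter_int \<mu> ss f)"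
proof (induction ss)
  case (Cons s ss)
  have "iter_int \<mu> ss f (z(s := w)) = iter_int \<mu> ss f (z'(s := w))"
    if "\<forall>i\<in>A - set (s # ss). z i = z' i" for z z' w
    by (rule dep_onD[OF Cons.IH[OF Cons.prems]]) (use that in auto)
  then show ?case unfolding dep_on_def by (auto intro!: Bochner_Integration.integral_cong)
qed simp

text \<open>Injectivity of \<open>j\<close> on \<open>A\<close> ensures that updating coordinate
  \<open>j s\<close> changes only argument \<open>s\<close> among those on which the kernel
  depends.\<close>

lemma iter_int_reindex:
  assumes f: "dep_on A f" and j: "inj_on j A" "set ss \<subseteq> A"
  shows "iter_int \<mu> (map j ss) (\<lambda>z. f (\<lambda>i. z (j i))) = (\<lambda>z. iter_int \<mu> ss f (\<lambda>i. z (j i)))"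
  using j(2)
proof (induction ss)
  case (Cons s ss)
  have "iter_int \<mu> ss f (\<lambda>i. (z(j s := w)) (j i)) = iter_int \<mu> ss f ((\<lambda>i. z (j i))(s := w))" for z w
    by (rule dep_onD[OF dep_on_iter[OF f]]) (use Cons.prems j(1) in \<open>auto simp: inj_on_def\<close>)
  then show ?case using Cons by simp
qed simp

lemma integral_PiM_int:
  assumes f: "bounded_measurable \<mu> f" and I: "finite I" "s \<in> I"
  shows "(\<integral>z. f z \<partial>PiM I (\<lambda>_. \<mu>)) = (\<integral>z. (\<integral>w. f (z(s := w)) \<partial>\<mu>) \<partial>PiM I (\<lambda>_. \<mu>))"
proof -
  note ps = prob_space
  interpret product_prob_space "\<lambda>_::nat. \<mu>" I by unfold_locales
  define J where "J = I - {s}"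
  have J: "finite J" "s \<notin> J" "I = insert s J" using I by (auto simp: J_def)
  interpret finite_product_prob_space "\<lambda>_::nat. \<mu>" I by unfold_locales (rule I)
  have *: "integrable (PiM I (\<lambda>_. \<mu>)) g" if g: "bounded_measurable \<mu> g" for g
  proof -
    obtain B where B: "\<And>z. \<bar>g z\<bar> \<le> B" using g by (auto simp: bounded_measurable_def)
    then show ?thesis using bounded_measurable_PiM[OF g, of I]
      by (intro integrable_const_bound[where B=B]) (auto simp: B)
  qed
  have "(\<integral>z. f z \<partial>PiM I (\<lambda>_. \<mu>)) = (\<integral>x. (\<integral>y. f (x(s := y)) \<partial>\<mu>) \<partial>PiM J (\<lambda>_. \<mu>))"
    using *[OF f] unfolding J(3) by (intro product_integral_insert J)
  \<comment> \<open>The splitting of coordinate \<open>s\<close> is used backwards: the inner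
    integral no longer depends on that coordinate, so integrating it once more changes
    nothing.\<close>
  also have "\<dots> = (\<integral>z. (\<integral>w. f (z(s := w)) \<partial>\<mu>) \<partial>PiM I (\<lambda>_. \<mu>))"
    using *[OF bounded_measurable_int[OF f, of s]] unfolding J(3)
    by (subst product_integral_insert[OF J(1,2)]) (simp_all add: ps)
  finally show ?thesis .
qed

lemma integral_PiM_iter:
  assumes f: "bounded_measurable \<mu> f" and I: "finite I" "set ss \<subseteq> I"
  shows "(\<integral>z. iter_int \<mu> ss f z \<partial>PiM I (\<lambda>_. \<mu>)) = (\<integral>z. f z \<partial>PiM I (\<lambda>_. \<mu>))"
  using I(2)
proof (induction ss)
  case (Cons s ss)
  have "(\<integral>z. iter_int \<mu> (s # ss) f z \<partial>PiM I (\<lambda>_. \<mu>)) = (\<integral>z. iter_int \<mu> ss f z \<partial>PiM I (\<lambda>_. \<mu>))"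
    using Cons.prems integral_PiM_int[OF bounded_measurable_iter[OF f, of ss] I(1), of s] by simp
  then show ?case using Cons by simp
qed simp

text \<open>The factor \<open>g\<close> does not see the coordinates \<open>ss\<close> and can be
  pulled out while they are integrated, which annihilates \<open>f\<close>. This is the
  orthogonality behind the variance bound.\<close>

lemma integral_PiM_mult_eq_zero:
  assumes f: "bounded_measurable \<mu> f" and g: "bounded_measurable \<mu> g" "dep_on (- set ss) g"
    and I: "finite I" "set ss \<subseteq> I" and "iter_int \<mu> ss f = (\<lambda>z. 0)"
  shows "(\<integral>z. f z * g z \<partial>PiM I (\<lambda>_. \<mu>)) = 0"
proof -
  have "(\<integral>z. f z * g z \<partial>PiM I (\<lambda>_. \<mu>)) = (\<integral>z. iter_int \<mu> ss (\<lambda>z. f z * g z) z \<partial>PiM I (\<lambda>_. \<mu>))"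
    by (rule integral_PiM_iter[OF bounded_measurable_mult[OF f g(1)] I, symmetric])
  then show ?thesis by (simp add: iter_int_mult[OF g(2)] assms(6))
qed

end

subsection \<open>Injective tuples\<close>

definition inj_tuples :: "nat \<Rightarrow> nat \<Rightarrow> (nat \<Rightarrow> nat) set" where
  "inj_tuples m n = {j \<in> {1..m} \<rightarrow>\<^sub>E {1..n}. inj_on j {1..m}}"

definition mono_tuples :: "nat \<Rightarrow> nat \<Rightarrow> (nat \<Rightarrow> nat) set" where
  "mono_tuples m n = {i. i \<in> {1..m} \<rightarrow>\<^sub>E {1..n} \<and> strict_mono_on {1..m} i}"

lemma finite_tuples: "finite (inj_tuples m n)" "finite (mono_tuples m n)"
proof -
  have "finite ({1..m} \<rightarrow>\<^sub>E {1..n})" by (intro finite_PiE) auto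
  then show "finite (inj_tuples m n)" "finite (mono_tuples m n)"
    by (auto simp: inj_tuples_def mono_tuples_def elim: rev_finite_subset)
qed

lemma inj_tuples_mem: "j \<in> inj_tuples m n \<Longrightarrow> k \<in> {1..m} \<Longrightarrow> j k \<in> {1..n}"
  unfolding inj_tuples_def by (blast dest: PiE_mem)

lemma inj_tuples_inj: "j \<in> inj_tuples m n \<Longrightarrow> inj_on j {1..m}"
  by (simp add: inj_tuples_def)

text \<open>A finite set has only one increasing enumeration; as lists, both tuples are strictly
  sorted with the same elements.\<close>

lemma mono_tuples_eqI:
  assumes "i \<in> mono_tuples m n" "i' \<in> mono_tuples m n" "i ` {1..m} = i' ` {1..m}"
  shows "i = i'"
proof -
  have s: "sorted_wrt (<) (map i [1..<Suc m])" if "i \<in> mono_tuples m n" for i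
    unfolding sorted_wrt_map using that
    by (intro sorted_wrt_mono_rel[OF _ sorted_wrt_upt])
      (auto simp: mono_tuples_def strict_mono_on_def simp del: upt_Suc)
  have "map i [1..<Suc m] = map i' [1..<Suc m]"
  proof (rule strict_sorted_equal[OF s[OF assms(2)] s[OF assms(1)]])
    have e: "set [1..<Suc m] = {1..m}" by auto
    show "set (map i [1..<Suc m]) = set (map i' [1..<Suc m])"
      unfolding set_map e using assms(3) by simp
  qed
  then have "i k = i' k" if "k \<in> {1..m}" for k
    using that by (simp add: map_eq_conv del: upt_Suc)
  then show ?thesis using assms(1,2)
    by (intro PiE_ext[where k="{1..m}" and s="\<lambda>_. {1..n}"]) (auto simp: mono_tuples_def)
qed

lemma mono_tuples_surj:
  assumes "A \<subseteq> {1..n}" "card A = m"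
  shows "\<exists>i\<in>mono_tuples m n. i ` {1..m} = A"
proof -
  have fin: "finite A" using assms(1) finite_subset by blast
  define xs where "xs = sorted_list_of_set A"
  have xs: "length xs = m" "set xs = A" "sorted_wrt (<) xs"
    using fin assms(2) by (auto simp: xs_def)
  \<comment> \<open>Tuples count from 1 and lists from 0.\<close>
  define i where "i = (\<lambda>k\<in>{1..m}. xs ! (k - 1))"
  have im: "i ` {1..m} = A"
  proof -
    have "{1..m} = Suc ` {..<m}" by (simp add: image_Suc_lessThan)
    then have "i ` {1..m} = (\<lambda>k. i (Suc k)) ` {..<m}" by (simp add: image_image)
    also have "\<dots> = (\<lambda>k. xs ! k) ` {..<m}" by (intro image_cong) (auto simp: i_def)
    also have "(\<lambda>k. xs ! k) ` {..<m} = A" using xs by (auto simp: set_conv_nth)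
    finally show ?thesis .
  qed
  moreover have "strict_mono_on {1..m} i"
    using xs(1,3) by (auto simp: strict_mono_on_def i_def sorted_wrt_iff_nth_less)
  moreover have "i \<in> {1..m} \<rightarrow>\<^sub>E {1..n}" using im assms(1) by (auto simp: i_def)
  ultimately show ?thesis by (auto simp: mono_tuples_def)
qed

lemma card_image_mono_tuples: "i \<in> mono_tuples m n \<Longrightarrow> card (i ` {1..m}) = m"
  by (subst card_image) (auto simp: mono_tuples_def dest: strict_mono_on_imp_inj_on)

lemma card_mono_tuples: "card (mono_tuples m n) = n choose m"
proof -
  have "bij_betw (\<lambda>i. i ` {1..m}) (mono_tuples m n) {A. A \<subseteq> {1..n} \<and> card A = m}"
    unfolding bij_betw_def
  proof (intro conjI inj_onI equalityI subsetI)
    fix A assume "A \<in> {A. A \<subseteq> {1..n} \<and> card A = m}"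
    then show "A \<in> (\<lambda>i. i ` {1..m}) ` mono_tuples m n" using mono_tuples_surj[of A n m] by auto
  next
    fix A assume "A \<in> (\<lambda>i. i ` {1..m}) ` mono_tuples m n"
    then show "A \<in> {A. A \<subseteq> {1..n} \<and> card A = m}"
      using card_image_mono_tuples by (auto simp: mono_tuples_def)
  qed (rule mono_tuples_eqI)
  from bij_betw_same_card[OF this] show ?thesis by (simp add: n_subsets)
qed

text \<open>Sorting the image of an injective tuple recovers the increasing tuple \<open>i\<close>,
  and comparing positions recovers \<sigma>.\<close>

lemma bij_betw_mono_permutes:
  "bij_betw (\<lambda>(i, \<sigma>). restrict (i \<circ> \<sigma>) {1..m})
     (mono_tuples m n \<times> {\<sigma>. \<sigma> permutes {1..m}}) (inj_tuples m n)"
  unfolding bij_betw_def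
proof (intro conjI inj_onI equalityI subsetI; clarsimp)
  fix i \<sigma> i' \<sigma>'
  assume i: "i \<in> mono_tuples m n" "i' \<in> mono_tuples m n"
    and \<sigma>: "\<sigma> permutes {Suc 0..m}" "\<sigma>' permutes {Suc 0..m}"
    and eq: "restrict (i \<circ> \<sigma>) {Suc 0..m} = restrict (i' \<circ> \<sigma>') {Suc 0..m}"
  have eq': "i (\<sigma> k) = i' (\<sigma>' k)" if "k \<in> {1..m}" for k
    using fun_cong[OF eq, of k] that by auto
  have "i ` {1..m} = (\<lambda>k. i (\<sigma> k)) ` {1..m}"
    using permutes_image[OF \<sigma>(1)] by (metis One_nat_def image_image)
  also have "\<dots> = (\<lambda>k. i' (\<sigma>' k)) ` {1..m}" using eq' by auto
  also have "\<dots> = i' ` {1..m}"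
    using permutes_image[OF \<sigma>(2)] by (metis One_nat_def image_image)
  finally have ii: "i = i'" using i by (intro mono_tuples_eqI)
  have "\<sigma> k = \<sigma>' k" for k
  proof (cases "k \<in> {1..m}")
    case True
    have "inj_on i' {1..m}" using i(2) by (auto simp: mono_tuples_def dest: strict_mono_on_imp_inj_on)
    moreover have "\<sigma> k \<in> {1..m}" "\<sigma>' k \<in> {1..m}"
      using True permutes_in_image[OF \<sigma>(1)] permutes_in_image[OF \<sigma>(2)] by auto
    ultimately show ?thesis using eq'[OF True] unfolding ii by (metis inj_onD)
  next
    case False
    then show ?thesis using \<sigma> by (simp add: permutes_def)
  qed
  then show "i = i' \<and> \<sigma> = \<sigma>'" using ii by auto
next
  fix i \<sigma> assume i: "i \<in> mono_tuples m n" and \<sigma>: "\<sigma> permutes {Suc 0..m}"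
  have "inj_on i {1..m}" using i by (auto simp: mono_tuples_def dest: strict_mono_on_imp_inj_on)
  then have "inj_on (i \<circ> \<sigma>) {1..m}"
    using permutes_image[OF \<sigma>] permutes_inj_on[OF \<sigma>] by (intro comp_inj_on) auto
  moreover have "i (\<sigma> k) \<in> {1..n}" if "k \<in> {1..m}" for k
    proof -
    have "\<sigma> k \<in> {1..m}" using that permutes_in_image[OF \<sigma>, of k] by simp
    then show ?thesis using i unfolding mono_tuples_def by (blast dest: PiE_mem)
  qed
  moreover have "inj_on (restrict (i \<circ> \<sigma>) {1..m}) {1..m} \<longleftrightarrow> inj_on (i \<circ> \<sigma>) {1..m}"
    by (intro inj_on_cong) simp
  ultimately show "restrict (i \<circ> \<sigma>) {Suc 0..m} \<in> inj_tuples m n"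
    by (simp add: inj_tuples_def restrict_PiE_iff del: restrict_PiE)
next
  fix j assume j: "j \<in> inj_tuples m n"
  have inj: "inj_on j {1..m}" using j by (auto simp: inj_tuples_def)
  have "j ` {1..m} \<subseteq> {1..n}" "card (j ` {1..m}) = m"
    using j card_image[OF inj] by (auto simp: inj_tuples_def PiE_def Pi_def)
  then obtain i where i: "i \<in> mono_tuples m n" "i ` {1..m} = j ` {1..m}"
    using mono_tuples_surj by blast
  have inji: "inj_on i {1..m}" using i(1) by (auto simp: mono_tuples_def dest: strict_mono_on_imp_inj_on)
  \<comment> \<open>The permutation that sorts \<open>j\<close>, extended by the identity outside
    \<open>{1..m}\<close> as \<open>permutes\<close> demands.\<close>
  define \<sigma> where "\<sigma> k = (if k \<in> {1..m} then inv_into {1..m} i (j k) else k)" for k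
  have s1: "\<sigma> k \<in> {1..m}" "i (\<sigma> k) = j k" if "k \<in> {1..m}" for k
  proof -
    have "j k \<in> i ` {1..m}" using that i(2) by auto
    then show "\<sigma> k \<in> {1..m}" "i (\<sigma> k) = j k"
      using inv_into_into[of "j k" i "{1..m}"] f_inv_into_f[of "j k" i "{1..m}"] that
      by (auto simp: \<sigma>_def)
  qed
  have "inj_on \<sigma> {1..m}" by (intro inj_onI) (metis s1(2) inj inj_onD)
  then have "bij_betw \<sigma> {1..m} {1..m}"
    using s1(1) by (intro bij_betw_imageI endo_inj_surj) auto
  then have "\<sigma> permutes {1..m}" by (rule bij_imp_permutes) (auto simp: \<sigma>_def)
  moreover have "j = restrict (i \<circ> \<sigma>) {1..m}"
  proof
    fix k show "j k = restrict (i \<circ> \<sigma>) {1..m} k"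
      using s1(2)[of k] j by (cases "k \<in> {1..m}") (auto simp: inj_tuples_def PiE_def extensional_def)
  qed
  ultimately show "j \<in> (\<lambda>(i, \<sigma>). restrict (i \<circ> \<sigma>) {Suc 0..m}) ` (mono_tuples m n \<times> {\<sigma>. \<sigma> permutes {Suc 0..m}})"
    using i(1) by (auto simp: image_iff)
qed

lemma sum_mono_permutes:
  "(\<Sum>i\<in>mono_tuples m n. \<Sum>\<sigma> | \<sigma> permutes {1..m}. f (restrict (i \<circ> \<sigma>) {1..m})) = (\<Sum>j\<in>inj_tuples m n. f j)"
  using sum.reindex_bij_betw[OF bij_betw_mono_permutes, of f m n]
  by (simp add: sum.cartesian_product split_def)

lemma card_inj_tuples: "card (inj_tuples m n) = (n choose m) * fact m"
  using bij_betw_same_card[OF bij_betw_mono_permutes[of m n]]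
  by (simp add: card_cartesian_product card_mono_tuples card_permutations)

text \<open>
  A tuple \<open>i \<circ> \<sigma>\<inverse>\<close> with increasing \<open>i\<close> is an arbitrary injective tuple, so a U-statistic is the
  average of the unsymmetrised kernel over all injective tuples.
\<close>

lemma U_stat_eq_inj_sum:
  assumes "dep_on {1..m} (kernel m c IX IY)"
  shows "U_stat m c IX IY n z =
    (\<Sum>j\<in>inj_tuples m n. kernel m c IX IY (\<lambda>i. z (j i))) / (real (n choose m) * fact m)"
proof -
  let ?k = "kernel m c IX IY"
  have "(\<Sum>\<sigma> | \<sigma> permutes {1..m}. ?k (perm_tuple \<sigma> (\<lambda>j. z (i j)))) =
    (\<Sum>\<sigma> | \<sigma> permutes {1..m}. ?k (\<lambda>k. z (restrict (i \<circ> \<sigma>) {1..m} k)))" for i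
  proof -
    have "(\<Sum>\<sigma> | \<sigma> permutes {1..m}. ?k (perm_tuple \<sigma> (\<lambda>j. z (i j)))) =
      (\<Sum>\<sigma> | \<sigma> permutes {1..m}. ?k (perm_tuple (inv_into UNIV \<sigma>) (\<lambda>j. z (i j))))"
      by (rule sum_permutations_inverse)
    also have "\<dots> = (\<Sum>\<sigma> | \<sigma> permutes {1..m}. ?k (\<lambda>k. z (restrict (i \<circ> \<sigma>) {1..m} k)))"
    proof (rule sum.cong[OF refl])
      fix \<sigma> assume "\<sigma> \<in> {\<sigma>. \<sigma> permutes {1..m}}"
      then have "inv_into UNIV (inv_into UNIV \<sigma>) = \<sigma>" by (simp add: permutes_inv_inv)
      then show "?k (perm_tuple (inv_into UNIV \<sigma>) (\<lambda>j. z (i j))) = ?k (\<lambda>k. z (restrict (i \<circ> \<sigma>) {1..m} k))"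
        by (intro dep_onD[OF assms]) (auto simp: perm_tuple_def)
    qed
    finally show ?thesis .
  qed
  then have "U_stat m c IX IY n z = 1 / real (n choose m) *
     (\<Sum>i\<in>mono_tuples m n. 1 / fact m * (\<Sum>\<sigma> | \<sigma> permutes {1..m}. ?k (\<lambda>k. z (restrict (i \<circ> \<sigma>) {1..m} k))))"
    by (simp add: U_stat_def sym_kernel_def mono_tuples_def)
  also have "\<dots> = 1 / real (n choose m) * (1 / fact m * (\<Sum>j\<in>inj_tuples m n. ?k (\<lambda>i. z (j i))))"
    by (simp only: sum_distrib_left[symmetric] sum_mono_permutes[of "\<lambda>j. ?k (\<lambda>i. z (j i))"])
  finally show ?thesis by simp
qed

text \<open>Composing with a permutation of \<open>{1..n}\<close> that sends p to p' and q to q'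
  embeds one set of tuples in the other. Two transpositions suffice: the first moves p to p', the
  second moves the image of q to q' and leaves p' alone. Exchanging the roles of the pairs gives
  equality.\<close>

lemma card_inj_tuples_fixed:
  assumes pq: "p \<in> {1..n}" "q \<in> {1..n}" "p \<noteq> q" and pq': "p' \<in> {1..n}" "q' \<in> {1..n}" "p' \<noteq> q'"
    and ab: "a \<in> {1..m}" "b \<in> {1..m}"
  shows "card {j \<in> inj_tuples m n. j a = p \<and> j b = q} \<le> card {j \<in> inj_tuples m n. j a = p' \<and> j b = q'}"
proof -
  define \<rho>1 where "\<rho>1 = Transposition.transpose p p'"
  define \<rho>2 where "\<rho>2 = Transposition.transpose (\<rho>1 q) q'"
  define \<rho> where "\<rho> = \<rho>2 \<circ> \<rho>1"
  have r1: "\<rho>1 permutes {1..n}" unfolding \<rho>1_def using pq pq' by (intro permutes_swap_id)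
  have "\<rho>1 q \<in> {1..n}" using permutes_in_image[OF r1] pq by simp
  then have "\<rho>2 permutes {1..n}" unfolding \<rho>2_def using pq' by (intro permutes_swap_id)
  with r1 have r: "\<rho> permutes {1..n}" unfolding \<rho>_def by (rule permutes_compose)
  have "\<rho>1 q \<noteq> p'" using pq(3) by (auto simp: \<rho>1_def Transposition.transpose_def)
  then have val: "\<rho> p = p'" "\<rho> q = q'"
    using pq'(3) by (auto simp: \<rho>_def \<rho>2_def \<rho>1_def Transposition.transpose_def)
  define \<phi> where "\<phi> j = restrict (\<rho> \<circ> j) {1..m}" for j :: "nat \<Rightarrow> nat"
  show ?thesis
  proof (rule card_inj_on_le[of \<phi>])
    show "inj_on \<phi> {j \<in> inj_tuples m n. j a = p \<and> j b = q}"
    proof (rule inj_onI)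
      fix j j' assume j: "j \<in> {j \<in> inj_tuples m n. j a = p \<and> j b = q}" "j' \<in> {j \<in> inj_tuples m n. j a = p \<and> j b = q}"
        and eq: "\<phi> j = \<phi> j'"
      have "j k = j' k" if "k \<in> {1..m}" for k
        using fun_cong[OF eq, of k] that permutes_inj[OF r] by (auto simp: \<phi>_def inj_def)
      then show "j = j'" using j
        by (intro PiE_ext[where k="{1..m}" and s="\<lambda>_. {1..n}"]) (auto simp: inj_tuples_def)
    qed
    have "\<phi> j \<in> inj_tuples m n" if "j \<in> inj_tuples m n" for j
    proof -
      have "inj_on (\<rho> \<circ> j) {1..m}"
        using that by (intro comp_inj_on permutes_inj_on[OF r]) (auto simp: inj_tuples_def)
      moreover have "\<rho> (j k) \<in> {1..n}" if "k \<in> {1..m}" for k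
        using inj_tuples_mem[OF \<open>j \<in> inj_tuples m n\<close> that] by (simp only: permutes_in_image[OF r])
      then have "\<phi> j \<in> {1..m} \<rightarrow>\<^sub>E {1..n}" unfolding \<phi>_def by (intro restrict_PiE_iff[THEN iffD2]) simp
      moreover have "inj_on (\<phi> j) {1..m} \<longleftrightarrow> inj_on (\<rho> \<circ> j) {1..m}"
        unfolding \<phi>_def by (intro inj_on_cong) simp
      ultimately show ?thesis by (simp add: inj_tuples_def)
    qed
    then show "\<phi> ` {j \<in> inj_tuples m n. j a = p \<and> j b = q} \<subseteq> {j \<in> inj_tuples m n. j a = p' \<and> j b = q'}"
      using ab val by (auto simp: \<phi>_def)
    show "finite {j \<in> inj_tuples m n. j a = p' \<and> j b = q'}" using finite_tuples by auto
  qed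
qed

text \<open>By symmetry every ordered pair of distinct values is taken at positions
  \<open>a\<close>, \<open>b\<close> by the same number of tuples. Applying the counting identity to
  the constant function 1 yields that number, so no binomial coefficients have to be
  evaluated.\<close>

lemma inj_tuples_pair_sum:
  fixes f :: "nat \<Rightarrow> nat \<Rightarrow> real"
  assumes ab: "a \<in> {1..m}" "b \<in> {1..m}" "a \<noteq> b" and n: "n \<ge> 2"
  shows "(\<Sum>j\<in>inj_tuples m n. f (j a) (j b)) =
    real (card (inj_tuples m n)) / (real n * (real n - 1)) * (\<Sum>p\<in>{1..n}. \<Sum>q\<in>{1..n} - {p}. f p q)"
proof -
  define D where "D = Sigma {1..n} (\<lambda>p. {1..n} - {p})"
  have fin: "finite D" by (auto simp: D_def)
  \<comment> \<open>The pair (1, 2) is only a reference pair; it lies in range because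
    \<open>n\<close> is at least 2.\<close>
  define c where "c = card {j \<in> inj_tuples m n. j a = 1 \<and> j b = 2}"
  have c: "card {j \<in> inj_tuples m n. (j a, j b) = d} = c" if "d \<in> D" for d
  proof -
    obtain p q where d: "d = (p, q)" by force
    have "p \<in> {1..n}" "q \<in> {1..n}" "p \<noteq> q" "(1::nat) \<in> {1..n}" "2 \<in> {1..n}" "(1::nat) \<noteq> 2"
      using that n by (auto simp: D_def d)
    from card_inj_tuples_fixed[OF this ab(1,2)]
      card_inj_tuples_fixed[OF this(4-6) this(1-3) ab(1,2)]
    show ?thesis by (simp add: d c_def)
  qed
  have im: "(\<lambda>j. (j a, j b)) ` inj_tuples m n \<subseteq> D"
  proof clarify
    fix j assume j: "j \<in> inj_tuples m n"
    have "j a \<noteq> j b" using inj_onD[OF inj_tuples_inj[OF j] _ ab(1,2)] ab(3) by blast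
    then show "(j a, j b) \<in> D" using inj_tuples_mem[OF j ab(1)] inj_tuples_mem[OF j ab(2)] by (simp add: D_def)
  qed
  have S: "(\<Sum>j\<in>inj_tuples m n. g (j a, j b)) = real c * (\<Sum>d\<in>D. g d)" for g :: "nat \<times> nat \<Rightarrow> real"
  proof -
    have "(\<Sum>j\<in>inj_tuples m n. g (j a, j b)) = (\<Sum>d\<in>D. \<Sum>j | j \<in> inj_tuples m n \<and> (j a, j b) = d. g (j a, j b))"
      by (rule sum.group[symmetric]) (use finite_tuples fin im in auto)
    also have "\<dots> = (\<Sum>d\<in>D. real c * g d)"
    proof (rule sum.cong[OF refl])
      fix d assume d: "d \<in> D"
      have "(\<Sum>j | j \<in> inj_tuples m n \<and> (j a, j b) = d. g (j a, j b)) = (\<Sum>j | j \<in> inj_tuples m n \<and> (j a, j b) = d. g d)"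
        by (rule sum.cong) auto
      then show "(\<Sum>j | j \<in> inj_tuples m n \<and> (j a, j b) = d. g (j a, j b)) = real c * g d"
        using c[OF d] by simp
    qed
    finally show ?thesis by (simp add: sum_distrib_left)
  qed
  have "card D = (\<Sum>p\<in>{1..n}. card ({1..n} - {p}))" by (simp add: D_def)
  also have "\<dots> = n * (n - 1)" by simp
  finally have "card D = n * (n - 1)" .
  then have cD: "real (card D) = real n * (real n - 1)" using n by (simp add: of_nat_diff)
  have "real (card (inj_tuples m n)) = real c * (real n * (real n - 1))" using S[of "\<lambda>_. 1"] cD by simp
  then have "real (card (inj_tuples m n)) / (real n * (real n - 1)) = real c" using n by (simp add: field_simps)
  moreover have "(\<Sum>d\<in>D. case_prod f d) = (\<Sum>p\<in>{1..n}. \<Sum>q\<in>{1..n} - {p}. f p q)"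
    by (simp add: D_def sum.Sigma)
  ultimately show ?thesis using S[of "case_prod f"] by simp
qed

text \<open>There are at most m^6 ways to say at which positions of the two tuples three common
  values sit. Once this is fixed, the second tuple is arbitrary and determines the first at three
  positions, so 2m - 3 values remain free.\<close>

lemma card_three_coincidences:
  "card {(j, j'). j \<in> inj_tuples m n \<and> j' \<in> inj_tuples m n \<and> card (j ` {1..m} \<inter> j' ` {1..m}) \<ge> 3}
     \<le> m ^ 6 * n ^ (2 * m - 3)"
proof -
  let ?F = "{1..m} \<rightarrow>\<^sub>E {1..n}"
  have finF: "finite ?F" by (intro finite_PiE) auto
  define T where "T = {1..m} \<times> {1..m} \<times> {1..m} \<times> {1..m} \<times> {1..m} \<times> {1..m}"
  define T' where "T' = {(a, b, c, t). (a, b, c, t) \<in> T \<and> a \<noteq> b \<and> a \<noteq> c \<and> b \<noteq> c}"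
  have T': "finite T'" "card T' \<le> m ^ 6"
  proof -
    have "T' \<subseteq> T" "finite T" "card T = m ^ 6"
      by (auto simp: T_def T'_def card_cartesian_product power_numeral_reduce)
    then show "finite T'" "card T' \<le> m ^ 6" using finite_subset card_mono by metis+
  qed
  define S where "S = (\<lambda>(a, b, c, a', b', c').
    {(j, j'). j \<in> ?F \<and> j' \<in> ?F \<and> j a = j' a' \<and> j b = j' b' \<and> j c = j' c'})"
  have "{(j, j'). j \<in> inj_tuples m n \<and> j' \<in> inj_tuples m n \<and> card (j ` {1..m} \<inter> j' ` {1..m}) \<ge> 3} \<subseteq> (\<Union>t\<in>T'. S t)"
  proof
    fix x assume "x \<in> {(j, j'). j \<in> inj_tuples m n \<and> j' \<in> inj_tuples m n \<and> card (j ` {1..m} \<inter> j' ` {1..m}) \<ge> 3}"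
    then obtain j j' where jj: "x = (j, j')" and j: "j \<in> inj_tuples m n" "j' \<in> inj_tuples m n"
      and c: "3 \<le> card (j ` {1..m} \<inter> j' ` {1..m})" by blast
    obtain X where X: "X \<subseteq> j ` {1..m} \<inter> j' ` {1..m}" "card X = 3"
      using obtain_subset_with_card_n[OF c] by metis
    then obtain u y w where X3: "X = {u, y, w}" "u \<noteq> y" "u \<noteq> w" "y \<noteq> w"
      by (auto simp: card_3_iff)
    from X(1) have "u \<in> j ` {1..m}" "y \<in> j ` {1..m}" "w \<in> j ` {1..m}"
      "u \<in> j' ` {1..m}" "y \<in> j' ` {1..m}" "w \<in> j' ` {1..m}" unfolding X3 by blast+
    then obtain a b c a' b' c' where "a \<in> {1..m}" "u = j a" "b \<in> {1..m}" "y = j b" "c \<in> {1..m}" "w = j c"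
      "a' \<in> {1..m}" "u = j' a'" "b' \<in> {1..m}" "y = j' b'" "c' \<in> {1..m}" "w = j' c'"
      by blast
    then have "(a, b, c, a', b', c') \<in> T'" "(j, j') \<in> S (a, b, c, a', b', c')"
      using X3 j by (auto simp: T'_def T_def S_def inj_tuples_def)
    then show "x \<in> (\<Union>t\<in>T'. S t)" unfolding jj by blast
  qed
  moreover have "finite (S t)" for t
    by (rule finite_subset[OF _ finite_cartesian_product[OF finF finF]]) (auto simp: S_def)
  ultimately have "card {(j, j'). j \<in> inj_tuples m n \<and> j' \<in> inj_tuples m n \<and> card (j ` {1..m} \<inter> j' ` {1..m}) \<ge> 3}
      \<le> card (\<Union>t\<in>T'. S t)" using T' by (intro card_mono) auto
  also have "\<dots> \<le> (\<Sum>t\<in>T'. card (S t))" by (rule card_UN_le[OF T'(1)])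
  also have "\<dots> \<le> (\<Sum>t\<in>T'. n ^ (2 * m - 3))"
  proof (rule sum_mono)
    fix t assume t: "t \<in> T'"
    obtain a b c a' b' c' where tt: "t = (a, b, c, a', b', c')" by (cases t) auto
    have abc: "a \<noteq> b" "a \<noteq> c" "b \<noteq> c" "{a, b, c} \<subseteq> {1..m}" using t by (auto simp: T'_def T_def tt)
    define R where "R = {1..m} - {a, b, c}"
    have cR: "card R = m - 3" using abc by (simp add: R_def card_Diff_subset)
    \<comment> \<open>Three distinct positions exist, so the subtraction in \<open>2 * m - 3\<close>
      is not truncated.\<close>
    have m3: "m \<ge> 3" using card_mono[OF _ abc(4)] abc by simp
    have "card (S t) \<le> card ((R \<rightarrow>\<^sub>E {1..n}) \<times> ?F)"
    proof (rule card_inj_on_le[of "\<lambda>(j, j'). (restrict j R, j')"])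
      show "inj_on (\<lambda>(j, j'). (restrict j R, j')) (S t)"
      proof (rule inj_onI)
        fix x y assume xy: "x \<in> S t" "y \<in> S t"
          "(case x of (j, j') \<Rightarrow> (restrict j R, j')) = (case y of (j, j') \<Rightarrow> (restrict j R, j'))"
        then obtain j1 j' j2 where x: "x = (j1, j')" "y = (j2, j')" and eq: "restrict j1 R = restrict j2 R"
          by (auto split: prod.splits)
        have j: "(j1, j') \<in> S t" "(j2, j') \<in> S t" using xy x by auto
        have "j1 k = j2 k" if "k \<in> {1..m}" for k
          using fun_cong[OF eq, of k] that j by (cases "k \<in> R") (auto simp: S_def tt R_def)
        then have "j1 = j2" using j
          by (intro PiE_ext[where k="{1..m}" and s="\<lambda>_. {1..n}"]) (auto simp: S_def tt)
        then show "x = y" by (simp add: x)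
      qed
      show "(\<lambda>(j, j'). (restrict j R, j')) ` S t \<subseteq> (R \<rightarrow>\<^sub>E {1..n}) \<times> ?F"
        by (auto simp: S_def tt R_def PiE_def Pi_def)
      show "finite ((R \<rightarrow>\<^sub>E {1..n}) \<times> ?F)"
        using finF by (intro finite_cartesian_product finite_PiE) (auto simp: R_def)
    qed
    also have "\<dots> = n ^ (m - 3) * n ^ m"
      using cR by (simp add: card_cartesian_product card_PiE R_def)
    also have "\<dots> = n ^ (2 * m - 3)" using m3 by (simp add: power_add[symmetric] mult_2)
    finally show "card (S t) \<le> n ^ (2 * m - 3)" .
  qed
  also have "\<dots> \<le> m ^ 6 * n ^ (2 * m - 3)" using T'(2) by simp
  finally show ?thesis .
qed

subsection \<open>Degenerate kernels\<close>

text \<open>The common indices of two tuples, when there are at most two, are covered by two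
  positions of the first tuple. The positions may coincide or cover more than needed, which spares a
  case distinction on the cardinality later.\<close>

lemma two_points_cover:
  assumes "card C \<le> 2" "C \<subseteq> f ` A" "finite A" "A \<noteq> {}"
  shows "\<exists>p\<in>A. \<exists>q\<in>A. C \<subseteq> {f p, f q}"
proof -
  have fin: "finite C" using assms(2,3) finite_surj by blast
  obtain p0 where p0: "p0 \<in> A" using assms(4) by auto
  consider "card C = 0" | "card C = 1" | "card C = 2" using assms(1) by linarith
  then show ?thesis
  proof cases
    case 1
    then show ?thesis using fin p0 by auto
  next
    case 2
    then obtain x where "C = {x}" by (auto simp: card_1_singleton_iff)
    then show ?thesis using assms(2) by auto
  next
    case 3
    then obtain x y where "C = {x, y}" by (auto simp: card_2_iff)
    then show ?thesis using assms(2) by auto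
  qed
qed

lemma dep_on_reindex:
  "dep_on A f \<Longrightarrow> dep_on (j ` A) (\<lambda>z. f (\<lambda>i. z (j i)))"
  unfolding dep_on_def by (metis imageI)

lemma bounded_measurable_reindex:
  assumes "bounded_measurable \<mu> f"
  shows "bounded_measurable \<mu> (\<lambda>z. f (\<lambda>i. z (j i)))"
proof -
  have "(\<lambda>z i. z (j i)) \<in> PiM UNIV (\<lambda>_. \<mu>) \<rightarrow>\<^sub>M PiM UNIV (\<lambda>_. \<mu>)"
    by (rule measurable_PiM_single') (auto simp: space_PiM)
  from measurable_compose[OF this] show ?thesis
    using assms by (auto simp: bounded_measurable_def)
qed

context prob_UNIV begin

lemma prob_space_PiM_finite: "prob_space (PiM I (\<lambda>_::nat. \<mu>))"
proof -
  interpret product_prob_space "\<lambda>_::nat. \<mu>" I by unfold_locales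
  show ?thesis by (rule prob_space_axioms)
qed

lemma integrable_PiM_bounded:
  assumes "bounded_measurable \<mu> g"
  shows "integrable (PiM I (\<lambda>_::nat. \<mu>)) g"
proof -
  obtain B where B: "\<And>z. \<bar>g z\<bar> \<le> B" using assms by (auto simp: bounded_measurable_def)
  interpret P: prob_space "PiM I (\<lambda>_::nat. \<mu>)" by (rule prob_space_PiM_finite)
  show ?thesis using bounded_measurable_PiM[OF assms, of I]
    by (intro P.integrable_const_bound[where B=B]) (auto simp: B)
qed

text \<open>
  Tuples with at most two common indices give orthogonal summands, so only the
  \<open>O(n\<^sup>2\<^sup>m\<^sup>-\<^sup>3)\<close> pairs with three coincidences contribute to the second moment.
\<close>

lemma degenerate_sum_bound:
  assumes r: "bounded_measurable \<mu> r" "dep_on {1..m} r" "\<And>z. \<bar>r z\<bar> \<le> B" and m: "m \<ge> 1"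
    and deg: "\<And>p q. p \<in> {1..m} \<Longrightarrow> q \<in> {1..m} \<Longrightarrow>
      \<exists>ss. set ss \<subseteq> {1..m} - {p, q} \<and> iter_int \<mu> ss r = (\<lambda>z. 0)"
  shows "(\<integral>z. (\<Sum>j\<in>inj_tuples m n. r (\<lambda>i. z (j i)))\<^sup>2 \<partial>PiM {1..n} (\<lambda>_. \<mu>))
      \<le> B\<^sup>2 * (real m ^ 6 * real n ^ (2 * m - 3))"
proof -
  let ?P = "PiM {1..n} (\<lambda>_. \<mu>)" and ?J = "inj_tuples m n"
  interpret P: prob_space ?P by (rule prob_space_PiM_finite)
  define rj where "rj j z = r (\<lambda>i. z (j i))" for j :: "nat \<Rightarrow> nat" and z
  have bm: "bounded_measurable \<mu> (rj j)" for j unfolding rj_def by (rule bounded_measurable_reindex[OF r(1)])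
  have dep: "dep_on (j ` {1..m}) (rj j)" for j unfolding rj_def by (rule dep_on_reindex[OF r(2)])
  have zero: "(\<integral>z. rj j z * rj j' z \<partial>?P) = 0"
    if j: "j \<in> ?J" "j' \<in> ?J" and c: "card (j ` {1..m} \<inter> j' ` {1..m}) \<le> 2" for j j'
  proof -
    obtain p q where pq: "p \<in> {1..m}" "q \<in> {1..m}" "j ` {1..m} \<inter> j' ` {1..m} \<subseteq> {j p, j q}"
      using two_points_cover[OF c, of j "{1..m}"] m by auto
    obtain ss where ss: "set ss \<subseteq> {1..m} - {p, q}" "iter_int \<mu> ss r = (\<lambda>z. 0)"
      using deg[OF pq(1,2)] by auto
    have inj: "inj_on j {1..m}" using j(1) by (rule inj_tuples_inj)
    \<comment> \<open>All common indices sit at positions p and q of \<open>j\<close>, which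
      \<open>ss\<close> avoids. Hence the second kernel ignores the coordinates
      \<open>map j ss\<close>, while integrating them out kills the first.\<close>
    have "j' ` {1..m} \<subseteq> - set (map j ss)"
    proof
      fix x assume x: "x \<in> j' ` {1..m}"
      show "x \<in> - set (map j ss)"
      proof
        assume "x \<in> set (map j ss)"
        then obtain s where s: "s \<in> set ss" "x = j s" by auto
        then have "s \<in> {1..m}" "s \<noteq> p" "s \<noteq> q" using ss(1) by auto
        then have "x \<noteq> j p" "x \<noteq> j q" using inj pq(1,2) s(2) by (auto dest: inj_onD)
        moreover have "x \<in> {j p, j q}" using pq(3) x s(2) \<open>s \<in> {1..m}\<close> by blast
        ultimately show False by auto
      qed
    qed
    then have "dep_on (- set (map j ss)) (rj j')" by (rule dep_on_mono[OF dep])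
    moreover have "set (map j ss) \<subseteq> {1..n}" using inj_tuples_mem[OF j(1)] ss(1) by auto
    moreover have "iter_int \<mu> (map j ss) (rj j) = (\<lambda>z. 0)"
      unfolding rj_def using ss by (subst iter_int_reindex[OF r(2) inj]) auto
    ultimately show ?thesis by (intro integral_PiM_mult_eq_zero[OF bm bm]) auto
  qed
  have bound: "(\<integral>z. rj j z * rj j' z \<partial>?P) \<le> B\<^sup>2" for j j'
  proof -
    have "(\<integral>z. rj j z * rj j' z \<partial>?P) \<le> (\<integral>z. B\<^sup>2 \<partial>?P)"
    proof (intro integral_mono integrable_PiM_bounded bounded_measurable_mult bm bounded_measurable_const)
      fix z
      have "rj j z * rj j' z \<le> \<bar>rj j z\<bar> * \<bar>rj j' z\<bar>" by (simp flip: abs_mult)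
      also have "\<dots> \<le> B * B" by (intro mult_mono) (auto simp: rj_def r(3) intro: order_trans[OF abs_ge_zero r(3)])
      finally show "rj j z * rj j' z \<le> B\<^sup>2" by (simp add: power2_eq_square)
    qed
    then show ?thesis using P.prob_space by simp
  qed
  define K where "K = {(j, j'). j \<in> ?J \<and> j' \<in> ?J \<and> card (j ` {1..m} \<inter> j' ` {1..m}) \<ge> 3}"
  have "(\<integral>z. (\<Sum>j\<in>?J. rj j z)\<^sup>2 \<partial>?P) = (\<integral>z. (\<Sum>x\<in>?J \<times> ?J. rj (fst x) z * rj (snd x) z) \<partial>?P)"
    by (simp add: power2_eq_square sum_product sum.cartesian_product split_def)
  also have "\<dots> = (\<Sum>x\<in>?J \<times> ?J. \<integral>z. rj (fst x) z * rj (snd x) z \<partial>?P)"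
    by (intro Bochner_Integration.integral_sum integrable_PiM_bounded bounded_measurable_mult bm)
  also have "\<dots> = (\<Sum>x\<in>K. \<integral>z. rj (fst x) z * rj (snd x) z \<partial>?P)"
  proof (rule sum.mono_neutral_right)
    show "finite (?J \<times> ?J)" by (simp add: finite_tuples)
    show "K \<subseteq> ?J \<times> ?J" by (auto simp: K_def)
    show "\<forall>x\<in>?J \<times> ?J - K. (\<integral>z. rj (fst x) z * rj (snd x) z \<partial>?P) = 0"
    proof
      fix x assume x: "x \<in> ?J \<times> ?J - K"
      then have "\<not> 3 \<le> card (fst x ` {1..m} \<inter> snd x ` {1..m})" by (cases x) (simp add: K_def)
      then have "card (fst x ` {1..m} \<inter> snd x ` {1..m}) \<le> 2" by linarith
      with x show "(\<integral>z. rj (fst x) z * rj (snd x) z \<partial>?P) = 0" by (intro zero) auto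
    qed
  qed
  also have "\<dots> \<le> (\<Sum>x\<in>K. B\<^sup>2)" by (intro sum_mono bound)
  also have "\<dots> = B\<^sup>2 * real (card K)" by simp
  also have "\<dots> \<le> B\<^sup>2 * real (m ^ 6 * n ^ (2 * m - 3))"
    using card_three_coincidences[of m n] unfolding K_def by (intro mult_left_mono) (simp_all only: of_nat_le_iff zero_le_power2)
  finally show ?thesis by (simp add: rj_def)
qed

text \<open>
  The remainder after subtracting the four pair projections is degenerate: integrating out
  \<open>{2,3}\<close> or \<open>{1,4}\<close> kills everything, and for the four remaining pairs the
  corresponding projection is idempotent while it kills the other three.
\<close>

lemma pair_remainder_degenerate:
  assumes k: "bounded_measurable \<mu> k"
    and z23: "iter_int \<mu> [2, 3] k = (\<lambda>z. 0)" and z14: "iter_int \<mu> [1, 4] k = (\<lambda>z. 0)"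
    and R: "set R = {5..m}"
    and m: "4 \<le> m" and pq: "p \<in> {1..m}" "q \<in> {1..m}"
    and r: "r = (\<lambda>z. k z - iter_int \<mu> (R @ [3, 4]) k z - iter_int \<mu> (R @ [2, 4]) k z
                    - iter_int \<mu> (R @ [3, 1]) k z - iter_int \<mu> (R @ [2, 1]) k z)"
  shows "\<exists>ss. set ss \<subseteq> {1..m} - {p, q} \<and> iter_int \<mu> ss r = (\<lambda>z. 0)"
proof -
  note bm = k bounded_measurable_iter[OF k] bounded_measurable_diff
  have ir: "iter_int \<mu> ss r = (\<lambda>z. iter_int \<mu> ss k z - iter_int \<mu> (ss @ R @ [3, 4]) k z
     - iter_int \<mu> (ss @ R @ [2, 4]) k z - iter_int \<mu> (ss @ R @ [3, 1]) k z - iter_int \<mu> (ss @ R @ [2, 1]) k z)" for ss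
    unfolding r by (subst iter_int_diff, (intro bm)+)+ (simp add: iter_int_append)
  have z: "iter_int \<mu> ss k = (\<lambda>z. 0)" if "{2, 3} \<subseteq> set ss \<or> {1, 4} \<subseteq> set ss" for ss
    using that iter_int_eq_zero[OF k _ z23] iter_int_eq_zero[OF k _ z14] by auto
  have same: "iter_int \<mu> (ss @ ss) k = iter_int \<mu> ss k" for ss
    unfolding iter_int_append by (rule iter_int_absorb[OF k]) simp
  have sp: "iter_int \<mu> (R @ a # b # R @ [a, b]) k = iter_int \<mu> (R @ [a, b]) k" for a b
    using same[of "R @ [a, b]"] by (simp del: iter_int.simps)
  \<comment> \<open>Either both points avoid {2,3}, or both avoid {1,4}, or there is one from each
    set. In the last four cases the projection onto the pair {p, q} itself is applied.\<close>
  consider "p \<noteq> 2 \<and> p \<noteq> 3 \<and> q \<noteq> 2 \<and> q \<noteq> 3" | "p \<noteq> 1 \<and> p \<noteq> 4 \<and> q \<noteq> 1 \<and> q \<noteq> 4"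
    | "{p, q} = {1, 2}" | "{p, q} = {1, 3}" | "{p, q} = {2, 4}" | "{p, q} = {3, 4}"
    unfolding doubleton_eq_iff by (smt (verit) numeral_eq_iff one_eq_numeral_iff semiring_norm)
  then show ?thesis
  proof cases
    case 1
    then show ?thesis using m by (intro exI[of _ "[2, 3]"]) (simp add: ir z del: iter_int.simps)
  next
    case 2
    then show ?thesis using m by (intro exI[of _ "[1, 4]"]) (simp add: ir z del: iter_int.simps)
  next
    case 3
    then show ?thesis using m R by (intro exI[of _ "R @ [3, 4]"]) (auto simp: ir z sp simp del: iter_int.simps)
  next
    case 4
    then show ?thesis using m R by (intro exI[of _ "R @ [2, 4]"]) (auto simp: ir z sp simp del: iter_int.simps)
  next
    case 5
    then show ?thesis using m R by (intro exI[of _ "R @ [3, 1]"]) (auto simp: ir z sp simp del: iter_int.simps)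
  next
    case 6
    then show ?thesis using m R by (intro exI[of _ "R @ [2, 1]"]) (auto simp: ir z sp simp del: iter_int.simps)
  qed
qed

end

subsection \<open>The three kernels\<close>

lemma dep_on_UNIV: "dep_on UNIV f"
  unfolding dep_on_def by (metis UNIV_I ext)

text \<open>The two generators are commuting involutions, so they generate a Klein
  four-group.\<close>

lemma H_tau_eq:
  assumes m: "m \<ge> 4"
  shows "H_tau m = {id, Transposition.transpose 1 4, Transposition.transpose 2 3,
    Transposition.transpose 1 4 \<circ> Transposition.transpose 2 3}" (is "_ = ?H")
proof
  let ?G = "sym_group m" and ?a = "Transposition.transpose (1::nat) 4" and ?b = "Transposition.transpose (2::nat) 3"
  have ab: "?a permutes {1..m}" "?b permutes {1..m}" using m by (auto intro!: permutes_swap_id)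
  have comm: "?b \<circ> ?a = ?a \<circ> ?b" by (auto simp: fun_eq_iff Transposition.transpose_def)
  have aa: "?a \<circ> ?a = id" "?b \<circ> ?b = id" by (auto simp: fun_eq_iff)
  interpret G: group ?G by (rule sym_group_is_group)
  have inv: "inv\<^bsub>?G\<^esub> ?a = ?a" "inv\<^bsub>?G\<^esub> ?b = ?b"
    by (rule G.inv_equality; use ab aa in \<open>simp add: sym_group_def\<close>)+
  show "H_tau m \<subseteq> ?H"
  proof
    fix h assume "h \<in> H_tau m"
    then have "h \<in> generate ?G {?a, ?b}" by (simp add: H_tau_def)
    then show "h \<in> ?H"
    proof induction
      case one
      then show ?case by (simp add: sym_group_def)
    next
      case (incl h)
      then show ?case by auto
    next
      case (inv h)
      then show ?case using \<open>inv\<^bsub>?G\<^esub> ?a = ?a\<close> \<open>inv\<^bsub>?G\<^esub> ?b = ?b\<close> by auto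
    next
      case (eng h1 h2)
      then have "h1 \<in> ?H" "h2 \<in> ?H" by auto
      moreover have "?a \<circ> (?a \<circ> ?b) = ?b" "?b \<circ> (?a \<circ> ?b) = ?a" "(?a \<circ> ?b) \<circ> ?a = ?b"
        "(?a \<circ> ?b) \<circ> ?b = ?a" "(?a \<circ> ?b) \<circ> (?a \<circ> ?b) = id"
        by (auto simp: fun_eq_iff Transposition.transpose_def)
      ultimately have "h1 \<circ> h2 \<in> ?H" using comm aa by auto
      moreover have "h1 \<otimes>\<^bsub>?G\<^esub> h2 = h1 \<circ> h2" by (simp add: sym_group_def)
      ultimately show ?case by (simp only:)
    qed
  qed
  have g: "?a \<in> generate ?G {?a, ?b}" "?b \<in> generate ?G {?a, ?b}" by (auto intro: generate.incl)
  have "id \<in> generate ?G {?a, ?b}" using generate.one[of ?G "{?a, ?b}"] by (simp add: sym_group_def)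
  moreover have "?a \<circ> ?b \<in> generate ?G {?a, ?b}"
    using generate.eng[OF g] by (simp add: sym_group_def)
  ultimately show "?H \<subseteq> H_tau m" using g by (auto simp: H_tau_def)
qed

lemma signed_sum_eq:
  assumes m: "m \<ge> 4"
  shows "signed_sum m I w = of_bool (I w) - of_bool (I (\<lambda>i. w (Transposition.transpose 1 4 i)))
    - of_bool (I (\<lambda>i. w (Transposition.transpose 2 3 i)))
    + of_bool (I (\<lambda>i. w (Transposition.transpose 1 4 (Transposition.transpose 2 3 i))))"
proof -
  let ?a = "Transposition.transpose (1::nat) 4" and ?b = "Transposition.transpose (2::nat) 3"
  have comm: "?b \<circ> ?a = ?a \<circ> ?b" by (auto simp: fun_eq_iff Transposition.transpose_def)
  have inv: "inv_into UNIV ?a = ?a" "inv_into UNIV ?b = ?b" "inv_into UNIV (?a \<circ> ?b) = ?a \<circ> ?b"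
    by (simp_all add: o_inv_distrib comm[simplified])
  \<comment> \<open>The values at 3 and 4 tell the four group elements apart.\<close>
  have a4: "?a 4 = 1" "?b 4 = 4" "?a 3 = 3" "?b 3 = 2" "(?a \<circ> ?b) 4 = 1" "(?a \<circ> ?b) 3 = 2" by (auto simp: Transposition.transpose_def)
  then have ne: "id \<noteq> ?a" "id \<noteq> ?b" "?a \<noteq> ?b" "?a \<circ> ?b \<noteq> id" "?a \<circ> ?b \<noteq> ?a" "?a \<circ> ?b \<noteq> ?b"
    by (metis id_apply numeral_eq_iff one_eq_numeral_iff semiring_norm(85,86,89,83))+
  have "sign (?a \<circ> ?b) = sign ?a * sign ?b"
    by (rule sign_compose) (auto simp: permutation_swap_id)
  then have sg: "sign (?a \<circ> ?b) = 1" "sign ?a = -1" "sign ?b = -1" by (auto simp: sign_swap_id)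
  define f where "f \<sigma> = (of_int (sign \<sigma>) * of_bool (I (perm_tuple \<sigma> w)) :: real)" for \<sigma>
  have sum4: "sum f {x, y, z, u} = f x + f y + f z + f u"
    if "x \<noteq> y" "x \<noteq> z" "y \<noteq> z" "u \<noteq> x" "u \<noteq> y" "u \<noteq> z" for x y z u
    using that by (auto simp: add_ac)
  have "signed_sum m I w = f id + f ?a + f ?b + f (?a \<circ> ?b)"
    unfolding signed_sum_def H_tau_eq[OF m] f_def[symmetric] by (rule sum4[OF ne])
  then show ?thesis unfolding f_def perm_tuple_def inv sg by simp
qed

definition tau4 :: "real \<Rightarrow> real \<Rightarrow> real \<Rightarrow> real \<Rightarrow> real" where
  "tau4 a b c d = of_bool (a < c \<and> a < d \<and> b < c \<and> b < d) - of_bool (d < c \<and> d < a \<and> b < c \<and> b < a)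
    - of_bool (a < b \<and> a < d \<and> c < b \<and> c < d) + of_bool (d < b \<and> d < a \<and> c < b \<and> c < a)"

definition tau_sum :: "(nat \<Rightarrow> real) \<Rightarrow> real" where
  "tau_sum w = tau4 (w 1) (w 2) (w 3) (w 4)"

text \<open>For l \<ge> 5 the group fixes the threshold \<open>w l\<close>. The indicator is then a
  product of a factor in the arguments 1, 4 and a factor in 2, 3, and the alternating sum over the
  group splits accordingly.\<close>

definition split_sum :: "nat \<Rightarrow> (nat \<Rightarrow> real) \<Rightarrow> real" where
  "split_sum l w = (of_bool (w 1 \<le> w l) - of_bool (w 4 \<le> w l)) * (of_bool (w 2 \<le> w l) - of_bool (w 3 \<le> w l))"

lemma signed_sum_tau: "signed_sum 4 I_tau = tau_sum"
proof
  fix w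
  show "signed_sum 4 I_tau w = tau_sum w"
    by (simp add: signed_sum_eq I_tau_def tau_sum_def tau4_def Transposition.transpose_def conj_ac)
qed

lemma signed_sum_split:
  assumes "l \<ge> 5" "m \<ge> 4"
  shows "signed_sum m (I_split l) = split_sum l"
proof
  fix w
  show "signed_sum m (I_split l) w = split_sum l w" using assms
    by (auto simp: signed_sum_eq I_split_def split_sum_def Transposition.transpose_def of_bool_def)
qed

text \<open>An alternating sum over the group changes sign under each generator. All degeneracy of
  the kernels is derived from this property for (1 4) and (2 3).\<close>

definition swap_odd :: "nat \<Rightarrow> nat \<Rightarrow> ((nat \<Rightarrow> 'a) \<Rightarrow> real) \<Rightarrow> bool" where
  "swap_odd s t f \<longleftrightarrow> (\<forall>z. f (\<lambda>i. z (Transposition.transpose s t i)) = - f z)"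

lemma swap_odd_tau: "swap_odd 1 4 tau_sum" "swap_odd 2 3 tau_sum"
  by (auto simp: swap_odd_def tau_sum_def tau4_def Transposition.transpose_def of_bool_def)

lemma swap_odd_split: "l \<ge> 5 \<Longrightarrow> swap_odd 1 4 (split_sum l)" "l \<ge> 5 \<Longrightarrow> swap_odd 2 3 (split_sum l)"
  by (auto simp: swap_odd_def split_sum_def Transposition.transpose_def of_bool_def)

context prob_UNIV begin

lemma iter_int_transpose:
  assumes "swap_odd s t f"
  shows "iter_int \<mu> (map (Transposition.transpose s t) ss) f z = - iter_int \<mu> ss f (\<lambda>i. z (Transposition.transpose s t i))"
proof -
  have "iter_int \<mu> (map (Transposition.transpose s t) ss) (\<lambda>z. (-1) * f z) =
      iter_int \<mu> (map (Transposition.transpose s t) ss) (\<lambda>z. f (\<lambda>i. z (Transposition.transpose s t i)))"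
    using assms by (simp add: swap_odd_def)
  also have "\<dots> = (\<lambda>z. iter_int \<mu> ss f (\<lambda>i. z (Transposition.transpose s t i)))"
    by (rule iter_int_reindex[of UNIV]) (auto simp: dep_on_UNIV)
  finally have "iter_int \<mu> ss f (\<lambda>i. z (Transposition.transpose s t i)) =
      (-1) * iter_int \<mu> (map (Transposition.transpose s t) ss) f z"
    unfolding iter_int_cmult by (simp add: fun_eq_iff)
  then show ?thesis by simp
qed

text \<open>Once both coordinates are integrated out, exchanging them has no effect, but oddness
  says that it changes the sign.\<close>

lemma iter_int_swap_odd:
  assumes "bounded_measurable \<mu> f" "swap_odd s t f"
  shows "iter_int \<mu> [s, t] f = (\<lambda>z. 0)"
proof
  fix z
  have "iter_int \<mu> [t, s] f z = - iter_int \<mu> [s, t] f (\<lambda>i. z (Transposition.transpose s t i))"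
    using iter_int_transpose[OF assms(2), of "[s, t]" z] by simp
  also have "iter_int \<mu> [s, t] f (\<lambda>i. z (Transposition.transpose s t i)) = iter_int \<mu> [s, t] f z"
    by (rule dep_onD[OF dep_on_iter[of UNIV]]) (auto simp: dep_on_UNIV)
  finally show "iter_int \<mu> [s, t] f z = 0" using fun_cong[OF iter_int_swap[OF assms(1), of s t], of z] by simp
qed

text \<open>A single projection has to be computed. The swaps (2 3) and (1 4) carry it to the other
  three with signs -, - and +, and they fix \<open>R\<close>, whose entries are at least 5.\<close>

lemma pair_projections:
  assumes o14: "swap_odd 1 4 f" and o23: "swap_odd 2 3 f" and R: "set R \<subseteq> {5..}"
    and g: "iter_int \<mu> (R @ [3, 4]) f = (\<lambda>z. g (z 1) (z 2))"
  shows "iter_int \<mu> (R @ [2, 4]) f = (\<lambda>z. - g (z 1) (z 3))"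
    and "iter_int \<mu> (R @ [3, 1]) f = (\<lambda>z. - g (z 4) (z 2))"
    and "iter_int \<mu> (R @ [2, 1]) f = (\<lambda>z. g (z 4) (z 3))"
proof -
  have "map (Transposition.transpose 2 3) R = R" "map (Transposition.transpose 1 4) R = R"
    using R by (auto intro!: map_idI simp: Transposition.transpose_def)
  then have 1: "map (Transposition.transpose 2 3) (R @ [3, 4]) = R @ [2, 4]"
    "map (Transposition.transpose 1 4) (R @ [3, 4]) = R @ [3, 1]"
    "map (Transposition.transpose 1 4) (R @ [2, 4]) = R @ [2, 1]"
    by (auto simp: Transposition.transpose_def)
  show a: "iter_int \<mu> (R @ [2, 4]) f = (\<lambda>z. - g (z 1) (z 3))"
    using iter_int_transpose[OF o23, of "R @ [3, 4]"] unfolding 1 g by (simp add: fun_eq_iff Transposition.transpose_def)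
  show "iter_int \<mu> (R @ [3, 1]) f = (\<lambda>z. - g (z 4) (z 2))"
    using iter_int_transpose[OF o14, of "R @ [3, 4]"] unfolding 1 g by (simp add: fun_eq_iff Transposition.transpose_def)
  show "iter_int \<mu> (R @ [2, 1]) f = (\<lambda>z. g (z 4) (z 3))"
    using iter_int_transpose[OF o14, of "R @ [2, 4]"] unfolding 1 a by (simp add: fun_eq_iff Transposition.transpose_def)
qed

end

section \<open>Product kernels on pairs and the second order approximation of the
  U-statistic\<close>

lemma bounded_measurable_comp:
  assumes "bounded_measurable \<mu> f" "h \<in> \<nu> \<rightarrow>\<^sub>M \<mu>"
  shows "bounded_measurable \<nu> (\<lambda>z. f (\<lambda>i. h (z i)))"
proof -
  have "h \<in> space \<nu> \<rightarrow> space \<mu>" using assms(2) by (auto simp: measurable_def)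
  then have "(\<lambda>z i. h (z i)) \<in> PiM UNIV (\<lambda>_. \<nu>) \<rightarrow>\<^sub>M PiM UNIV (\<lambda>_. \<mu>)"
    using assms(2) by (intro measurable_PiM_single') (auto simp: space_PiM PiE_def Pi_def)
  from measurable_compose[OF this] show ?thesis
    using assms(1) by (auto simp: bounded_measurable_def)
qed

locale prob_UNIV_pair = M1: prob_UNIV \<mu> + M2: prob_UNIV \<nu> for \<mu> :: "'a measure" and \<nu> :: "'b measure"
begin

sublocale pair: prob_UNIV "\<mu> \<Otimes>\<^sub>M \<nu>"
proof -
  interpret pair_prob_space \<mu> \<nu> ..
  show "prob_UNIV (\<mu> \<Otimes>\<^sub>M \<nu>)"
    by unfold_locales (simp add: space_pair_measure M1.space_UNIV M2.space_UNIV)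
qed

lemma integral_mult_pair:
  fixes f :: "'a \<Rightarrow> real" and g :: "'b \<Rightarrow> real"
  assumes "integrable \<mu> f" "integrable \<nu> g"
  shows "(\<integral>w. f (fst w) * g (snd w) \<partial>(\<mu> \<Otimes>\<^sub>M \<nu>)) = (\<integral>x. f x \<partial>\<mu>) * (\<integral>y. g y \<partial>\<nu>)"
proof -
  interpret P: pair_prob_space \<mu> \<nu> ..
  have "integrable (\<mu> \<Otimes>\<^sub>M \<nu>) (\<lambda>(x, y). f x * g y)"
  proof (rule P.Fubini_integrable)
    have "(\<lambda>w. f (fst w) * g (snd w)) \<in> borel_measurable (\<mu> \<Otimes>\<^sub>M \<nu>)"
      using assms by (intro borel_measurable_times measurable_compose[OF measurable_fst] measurable_compose[OF measurable_snd]) auto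
    then show "(\<lambda>(x, y). f x * g y) \<in> borel_measurable (\<mu> \<Otimes>\<^sub>M \<nu>)" by (simp add: split_def)
    show "integrable \<mu> (\<lambda>x. \<integral>y. norm (case (x, y) of (x, y) \<Rightarrow> f x * g y) \<partial>\<nu>)"
      using assms by (simp add: abs_mult)
  qed (use assms in simp)
  from P.integral_fst'[OF this] show ?thesis by (simp add: split_def)
qed

text \<open>This is where independence of the two components enters: under the product measure,
  projections of a product kernel factor.\<close>

lemma iter_int_pair:
  assumes f: "bounded_measurable \<mu> f" and g: "bounded_measurable \<nu> g"
  shows "iter_int (\<mu> \<Otimes>\<^sub>M \<nu>) ss (\<lambda>z. f (\<lambda>i. fst (z i)) * g (\<lambda>i. snd (z i))) =
    (\<lambda>z. iter_int \<mu> ss f (\<lambda>i. fst (z i)) * iter_int \<nu> ss g (\<lambda>i. snd (z i)))"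
proof (induction ss)
  case (Cons s ss)
  have "(\<lambda>i. fst ((z(s := w)) i)) = (\<lambda>i. fst (z i))(s := fst w)"
    "(\<lambda>i. snd ((z(s := w)) i)) = (\<lambda>i. snd (z i))(s := snd w)" for z :: "nat \<Rightarrow> 'a \<times> 'b" and w
    by auto
  then show ?case unfolding iter_int.simps Cons
    by (simp only:) (subst integral_mult_pair[OF M1.bounded_measurable_section[OF M1.bounded_measurable_iter[OF f]]
      M2.bounded_measurable_section[OF M2.bounded_measurable_iter[OF g]]], rule refl)
qed simp

text \<open>Let N be the number of injective tuples. Over these, each of the four pair projections
  sums to N/(n(n-1)) times \<open>c\<close> times the sum over ordered pairs, so the factor n/N
  produces 4c/(n-1). What remains is degenerate, and its squared sum has mean of order n^(2m-3).
  Since N \<ge> (n/m)^m, the factor (n/N)^2 turns this into order 1/n.\<close>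

lemma U_stat_remainder:
  assumes m: "m \<ge> 4" and n: "n \<ge> m" "n \<ge> 2"
    and a: "bounded_measurable \<mu> a" "dep_on {1..m} a" "swap_odd 1 4 a" "swap_odd 2 3 a"
    and b: "bounded_measurable \<nu> b" "dep_on {1..m} b" "swap_odd 1 4 b" "swap_odd 2 3 b"
    and R: "set R = {5..m}"
    and ga: "iter_int \<mu> (R @ [3, 4]) a = (\<lambda>z. ga (z 1) (z 2))"
    and gb: "iter_int \<nu> (R @ [3, 4]) b = (\<lambda>z. gb (z 1) (z 2))"
    and bound: "\<And>w. \<bar>a w\<bar> \<le> A" "\<And>w. \<bar>b w\<bar> \<le> A" and c: "c > 0"
    and k: "k = (\<lambda>z. c * (a (\<lambda>i. fst (z i)) * b (\<lambda>i. snd (z i))))"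
  shows "(\<integral>z. (real n * ((\<Sum>j\<in>inj_tuples m n. k (\<lambda>i. z (j i))) / (real (n choose m) * fact m))
      - 4 * c / (real n - 1) * (\<Sum>p\<in>{1..n}. \<Sum>q\<in>{1..n} - {p}. ga (fst (z p)) (fst (z q)) * gb (snd (z p)) (snd (z q))))\<^sup>2
      \<partial>PiM {1..n} (\<lambda>_. \<mu> \<Otimes>\<^sub>M \<nu>)) \<le> (5 * c * A\<^sup>2)\<^sup>2 * real m ^ 6 * real m ^ (2 * m) / real n"
proof -
  let ?I = "iter_int (\<mu> \<Otimes>\<^sub>M \<nu>)" and ?P = "PiM {1..n} (\<lambda>_. \<mu> \<Otimes>\<^sub>M \<nu>)"
  have A0: "A \<ge> 0" using order_trans[OF abs_ge_zero bound(1)] .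
  have bk: "bounded_measurable (\<mu> \<Otimes>\<^sub>M \<nu>) k" unfolding k
    by (intro bounded_measurable_mult bounded_measurable_const bounded_measurable_comp[OF a(1)] bounded_measurable_comp[OF b(1)]
        measurable_fst measurable_snd)
  have ik: "?I ss k = (\<lambda>z. c * (iter_int \<mu> ss a (\<lambda>i. fst (z i)) * iter_int \<nu> ss b (\<lambda>i. snd (z i))))" for ss
    unfolding k pair.iter_int_cmult iter_int_pair[OF a(1) b(1)] ..
  have R5: "set R \<subseteq> {5..}" using R by auto
  define H where "H p q z = c * (ga (fst (z p)) (fst (z q)) * gb (snd (z p)) (snd (z q)))" for p q :: nat and z :: "nat \<Rightarrow> 'a \<times> 'b"
  have proj: "?I (R @ [3, 4]) k = H 1 2" "?I (R @ [2, 4]) k = H 1 3" "?I (R @ [3, 1]) k = H 4 2" "?I (R @ [2, 1]) k = H 4 3"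
    unfolding ik ga gb M1.pair_projections[OF a(3,4) R5 ga] M2.pair_projections[OF b(3,4) R5 gb]
    by (auto simp: H_def)
  define r where "r = (\<lambda>z. k z - H 1 2 z - H 1 3 z - H 4 2 z - H 4 3 z)"
  have bH: "bounded_measurable (\<mu> \<Otimes>\<^sub>M \<nu>) (H 1 2)" "bounded_measurable (\<mu> \<Otimes>\<^sub>M \<nu>) (H 1 3)"
    "bounded_measurable (\<mu> \<Otimes>\<^sub>M \<nu>) (H 4 2)" "bounded_measurable (\<mu> \<Otimes>\<^sub>M \<nu>) (H 4 3)"
    unfolding proj[symmetric] by (intro pair.bounded_measurable_iter bk)+
  have br: "bounded_measurable (\<mu> \<Otimes>\<^sub>M \<nu>) r" unfolding r_def by (intro bounded_measurable_diff bk bH)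
  have dk: "dep_on {1..m} k" unfolding dep_on_def k
    using dep_onD[OF a(2)] dep_onD[OF b(2)] by (metis (no_types, lifting))
  have dr: "dep_on {1..m} r"
    using dk m unfolding dep_on_def r_def H_def by auto
  have kb: "\<bar>k z\<bar> \<le> c * A\<^sup>2" for z
  proof -
    have "\<bar>k z\<bar> = c * (\<bar>a (\<lambda>i. fst (z i))\<bar> * \<bar>b (\<lambda>i. snd (z i))\<bar>)"
      using c by (simp add: k abs_mult)
    also have "\<dots> \<le> c * (A * A)" using bound A0 c by (intro mult_left_mono mult_mono) auto
    finally show ?thesis by (simp add: power2_eq_square)
  qed
  have ib: "\<bar>?I ss k z\<bar> \<le> c * A\<^sup>2" for ss z
  proof (induction ss arbitrary: z)
    case (Cons s ss)
    then show ?case by (auto intro: pair.abs_int_le)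
  qed (use kb in simp)
  \<comment> \<open>Five terms: the kernel and its four projections, each bounded by c A^2.\<close>
  have rb: "\<bar>r z\<bar> \<le> 5 * c * A\<^sup>2" for z
    unfolding r_def proj[symmetric]
    using kb[of z] ib[of "R @ [3, 4]" z] ib[of "R @ [2, 4]" z] ib[of "R @ [3, 1]" z] ib[of "R @ [2, 1]" z]
    by linarith
  have z23: "?I [2, 3] k = (\<lambda>z. 0)" unfolding ik M1.iter_int_swap_odd[OF a(1,4)] by simp
  have z14: "?I [1, 4] k = (\<lambda>z. 0)" unfolding ik M1.iter_int_swap_odd[OF a(1,3)] by simp
  have deg: "\<exists>ss. set ss \<subseteq> {1..m} - {p, q} \<and> ?I ss r = (\<lambda>z. 0)" if "p \<in> {1..m}" "q \<in> {1..m}" for p q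
    by (rule pair.pair_remainder_degenerate[OF bk z23 z14 R m that]) (unfold r_def proj, rule refl)
  define N where "N = real (n choose m) * fact m"
  have N: "N = real (card (inj_tuples m n))" by (simp add: N_def card_inj_tuples)
  have Npos: "N > 0" using n by (simp add: N_def)
  define S where "S z = (\<Sum>p\<in>{1..n}. \<Sum>q\<in>{1..n} - {p}. ga (fst (z p)) (fst (z q)) * gb (snd (z p)) (snd (z q)))" for z :: "nat \<Rightarrow> 'a \<times> 'b"
  have HS: "(\<Sum>j\<in>inj_tuples m n. H p q (\<lambda>i. z (j i))) = N / (real n * (real n - 1)) * (c * S z)"
    if "p \<in> {1..m}" "q \<in> {1..m}" "p \<noteq> q" for p q z
    unfolding H_def N S_def
    by (subst inj_tuples_pair_sum[OF that n(2), of "\<lambda>p q. c * (ga (fst (z p)) (fst (z q)) * gb (snd (z p)) (snd (z q)))"])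
      (simp add: sum_distrib_left)
  have eq: "real n * ((\<Sum>j\<in>inj_tuples m n. k (\<lambda>i. z (j i))) / N) - 4 * c / (real n - 1) * S z
      = real n / N * (\<Sum>j\<in>inj_tuples m n. r (\<lambda>i. z (j i)))" for z
  proof -
    have "(\<Sum>j\<in>inj_tuples m n. r (\<lambda>i. z (j i))) = (\<Sum>j\<in>inj_tuples m n. k (\<lambda>i. z (j i)))
      - 4 * (N / (real n * (real n - 1)) * (c * S z))"
      unfolding r_def sum_subtractf using m by (simp add: HS)
    moreover have "real n / N * (4 * (N / (real n * (real n - 1)) * (c * S z))) = 4 * c / (real n - 1) * S z"
      using Npos n(2) by (simp add: field_simps)
    ultimately show ?thesis by (simp add: right_diff_distrib)
  qed
  have "(\<integral>z. (real n * ((\<Sum>j\<in>inj_tuples m n. k (\<lambda>i. z (j i))) / N) - 4 * c / (real n - 1) * S z)\<^sup>2 \<partial>?P)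
     = (real n / N)\<^sup>2 * (\<integral>z. (\<Sum>j\<in>inj_tuples m n. r (\<lambda>i. z (j i)))\<^sup>2 \<partial>?P)"
    unfolding eq power_mult_distrib by simp
  also have "\<dots> \<le> (real n / N)\<^sup>2 * ((5 * c * A\<^sup>2)\<^sup>2 * (real m ^ 6 * real n ^ (2 * m - 3)))"
    using m by (intro mult_left_mono pair.degenerate_sum_bound br dr rb deg) auto
  also have "\<dots> \<le> (5 * c * A\<^sup>2)\<^sup>2 * real m ^ 6 * real m ^ (2 * m) / real n"
  proof -
    have "(real n / real m) ^ m \<le> real (n choose m)" by (rule binomial_ge_n_over_k_pow_k[OF n(1)])
    also have "\<dots> \<le> N" unfolding N_def by (simp add: mult_le_cancel_left1 fact_ge_1)
    finally have le: "(real n / real m) ^ m \<le> N" .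
    have npos: "real n > 0" "real m > 0" using n m by auto
    have "(real n / real m) ^ (2 * m) = ((real n / real m) ^ m)\<^sup>2" by (simp add: power_mult[symmetric] mult.commute)
    also have "\<dots> \<le> N\<^sup>2" using le npos by (intro power_mono) auto
    finally have le2: "real n ^ (2 * m) \<le> N\<^sup>2 * real m ^ (2 * m)"
      using npos by (simp add: power_divide pos_divide_le_eq)
    have "real n ^ (2 * m) = real n * (real n)\<^sup>2 * real n ^ (2 * m - 3)"
    proof -
      have "2 * m = 3 + (2 * m - 3)" using m by simp
      then have "real n ^ (2 * m) = real n ^ 3 * real n ^ (2 * m - 3)" by (metis power_add)
      then show ?thesis by (simp add: power3_eq_cube power2_eq_square mult_ac)
    qed
    with le2 have "(real n)\<^sup>2 * real n ^ (2 * m - 3) * real n \<le> N\<^sup>2 * real m ^ (2 * m)" by (simp add: mult_ac)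
    then have "(real n / N)\<^sup>2 * real n ^ (2 * m - 3) \<le> real m ^ (2 * m) / real n"
      using npos Npos by (simp add: power_divide field_simps)
    then have "(5 * c * A\<^sup>2)\<^sup>2 * real m ^ 6 * ((real n / N)\<^sup>2 * real n ^ (2 * m - 3)) \<le> (5 * c * A\<^sup>2)\<^sup>2 * real m ^ 6 * (real m ^ (2 * m) / real n)"
      by (intro mult_left_mono) auto
    then show ?thesis by (simp add: mult_ac)
  qed
  finally show ?thesis by (simp add: N_def S_def)
qed

end

subsection \<open>Projections under the uniform distribution\<close>

definition U01 :: "real measure" where
  "U01 = uniform_measure lborel {0..1}"

text \<open>On the unit square this is the Cramer-von Mises kernel, the integral over t in [0,1] of
  (1[u \<le> t] - t)(1[v \<le> t] - t).\<close>

definition cvm :: "real \<Rightarrow> real \<Rightarrow> real" where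
  "cvm u v = 1 / 3 - max u v + (u\<^sup>2 + v\<^sup>2) / 2"

lemma sets_U01 [simp, measurable_cong]: "sets U01 = sets borel"
  by (simp add: U01_def)

lemma space_U01 [simp]: "space U01 = UNIV"
  by (simp add: U01_def)

interpretation U01: prob_UNIV U01
proof -
  interpret prob_space U01 unfolding U01_def by (rule prob_space_uniform_measure) auto
  show "prob_UNIV U01" by unfold_locales simp
qed

interpretation U01_pair: prob_UNIV_pair U01 U01 ..

lemma U01_eq_density: "U01 = density lborel (\<lambda>x. ennreal (indicator {0..1} x))"
  unfolding U01_def uniform_measure_def by (intro density_cong) (auto simp: divide_ennreal split: split_indicator)

lemma integral_U01:
  fixes f :: "real \<Rightarrow> real"
  assumes "f \<in> borel_measurable borel"
  shows "(\<integral>x. f x \<partial>U01) = (\<integral>x. indicator {0..1} x * f x \<partial>lborel)"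
  unfolding U01_eq_density using assms by (subst integral_density) auto

lemma integrable_U01:
  fixes f :: "real \<Rightarrow> real"
  assumes "f \<in> borel_measurable borel"
  shows "integrable U01 f \<longleftrightarrow> integrable lborel (\<lambda>x. indicator {0..1} x * f x)"
  unfolding U01_eq_density using assms by (subst integrable_density) auto

lemma AE_U01: "AE x in U01. 0 \<le> x \<and> x \<le> 1"
  unfolding U01_def by (rule AE_uniform_measureI) auto

lemma AE_U01_neq: "AE x in U01. x \<noteq> c"
proof -
  have "AE x in lborel. x \<noteq> c" by (rule AE_lborel_singleton)
  then show ?thesis unfolding U01_def by (intro AE_uniform_measureI) auto
qed

lemma integral_U01_piece:
  fixes P p :: "real \<Rightarrow> real"
  assumes ab: "0 \<le> a" "a \<le> b" "b \<le> 1"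
    and P: "\<And>x. (P has_real_derivative p x) (at x)" and p: "continuous_on UNIV p"
  shows "(\<integral>x. indicator {a..b} x * p x \<partial>U01) = P b - P a"
    and "integrable U01 (\<lambda>x. indicator {a..b} x * p x)"
proof -
  have [measurable]: "p \<in> borel_measurable borel" using p by (rule borel_measurable_continuous_onI)
  have c: "isCont p x" for x using p by (simp add: continuous_on_eq_continuous_at)
  have e: "indicator {0..1} x * (indicator {a..b} x * p x) = p x * indicator {a..b} x" for x
    using ab by (auto split: split_indicator)
  show "(\<integral>x. indicator {a..b} x * p x \<partial>U01) = P b - P a"
    by (subst integral_U01, measurable) (simp only: e integral_FTC_Icc_real[OF ab(2) P c])
  have "set_integrable lborel {a..b} p" by (rule borel_integrable_atLeastAtMost') (use p continuous_on_subset in blast)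
  then show "integrable U01 (\<lambda>x. indicator {a..b} x * p x)"
    by (subst integrable_U01, measurable) (simp only: e, simp add: set_integrable_def mult.commute)
qed

text \<open>Agreement is asked for only off the endpoints, so strict and weak inequalities are
  treated alike.\<close>

lemma integral_U01_indicator:
  fixes f :: "real \<Rightarrow> real"
  assumes "0 \<le> a" "a \<le> b" "b \<le> 1" and [measurable]: "f \<in> borel_measurable borel"
    and f: "\<And>x. 0 \<le> x \<Longrightarrow> x \<le> 1 \<Longrightarrow> x \<noteq> a \<Longrightarrow> x \<noteq> b \<Longrightarrow> f x = indicator {a..b} x"
  shows "(\<integral>x. f x \<partial>U01) = b - a"
proof -
  have "AE x in U01. f x = indicator {a..b} x * 1"
    using AE_U01 AE_U01_neq[of a] AE_U01_neq[of b] by eventually_elim (simp add: f)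
  then have "(\<integral>x. f x \<partial>U01) = (\<integral>x. indicator {a..b} x * 1 \<partial>U01)"
    by (intro integral_cong_AE) auto
  also have "\<dots> = b - a" using assms by (intro integral_U01_piece(1)[where P="\<lambda>x. x"]) auto
  finally show ?thesis .
qed

text \<open>Kept as an integral because it equals t only on [0,1], while the projection identities
  are stated for all real arguments. The same holds for \<open>split_proj\<close> and
  \<open>tau_proj\<close>.\<close>

definition step_int :: "real \<Rightarrow> real" where
  "step_int t = (\<integral>w. of_bool (w \<le> t) \<partial>U01)"

lemma step_int_eq: "0 \<le> t \<Longrightarrow> t \<le> 1 \<Longrightarrow> step_int t = t"
  unfolding step_int_def by (subst integral_U01_indicator[of 0 t]) auto

lemma integrable_U01_bounded:
  fixes f :: "real \<Rightarrow> real"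
  assumes "f \<in> borel_measurable borel" "\<And>x. \<bar>f x\<bar> \<le> B"
  shows "integrable U01 f"
  using assms by (intro U01.integrable_const_bound[where B=B]) (auto simp: measurable_cong_sets[OF sets_U01 refl])

definition split_proj :: "real \<Rightarrow> real \<Rightarrow> real" where
  "split_proj u v = (\<integral>t. (of_bool (u \<le> t) - step_int t) * (of_bool (v \<le> t) - step_int t) \<partial>U01)"

lemma split_proj_le:
  assumes "0 \<le> u" "u \<le> v" "v \<le> 1"
  shows "split_proj u v = cvm u v"
proof -
  \<comment> \<open>Antiderivatives of the integrand on [0,u], [u,v] and [v,1], where it equals t^2,
    t^2 - t and (1-t)^2.\<close>
  define P1 P2 P3 :: "real \<Rightarrow> real" where "P1 x = x ^ 3 / 3" and "P2 x = x ^ 3 / 3 - x\<^sup>2 / 2"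
    and "P3 x = x - x\<^sup>2 + x ^ 3 / 3" for x
  have d: "(P1 has_real_derivative x\<^sup>2) (at x)" "(P2 has_real_derivative x\<^sup>2 - x) (at x)"
    "(P3 has_real_derivative (1 - x)\<^sup>2) (at x)" for x
    unfolding P1_def P2_def P3_def by (auto intro!: derivative_eq_intros simp: power2_eq_square algebra_simps)
  have c: "continuous_on UNIV (\<lambda>x::real. x\<^sup>2)" "continuous_on UNIV (\<lambda>x::real. x\<^sup>2 - x)" "continuous_on UNIV (\<lambda>x::real. (1 - x)\<^sup>2)"
    by (intro continuous_intros)+
  have ints: "(\<integral>x. indicator {0..u} x * x\<^sup>2 \<partial>U01) = P1 u - P1 0" "(\<integral>x. indicator {u..v} x * (x\<^sup>2 - x) \<partial>U01) = P2 v - P2 u"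
    "(\<integral>x. indicator {v..1} x * (1 - x)\<^sup>2 \<partial>U01) = P3 1 - P3 v"
    "integrable U01 (\<lambda>x. indicator {0..u} x * x\<^sup>2)" "integrable U01 (\<lambda>x. indicator {u..v} x * (x\<^sup>2 - x))"
    "integrable U01 (\<lambda>x. indicator {v..1} x * (1 - x)\<^sup>2)"
    using assms by (auto intro!: integral_U01_piece[OF _ _ _ d(1) c(1)] integral_U01_piece[OF _ _ _ d(2) c(2)] integral_U01_piece[OF _ _ _ d(3) c(3)])
  have [measurable]: "step_int \<in> borel_measurable borel" unfolding step_int_def by measurable
  have "AE t in U01. (of_bool (u \<le> t) - step_int t) * (of_bool (v \<le> t) - step_int t) =
    indicator {0..u} t * t\<^sup>2 + indicator {u..v} t * (t\<^sup>2 - t) + indicator {v..1} t * (1 - t)\<^sup>2"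
    using AE_U01 AE_U01_neq[of u] AE_U01_neq[of v]
    by eventually_elim (use assms in \<open>auto simp: step_int_eq power2_eq_square algebra_simps split: split_indicator\<close>)
  then have "split_proj u v = (\<integral>t. indicator {0..u} t * t\<^sup>2 + indicator {u..v} t * (t\<^sup>2 - t) + indicator {v..1} t * (1 - t)\<^sup>2 \<partial>U01)"
    unfolding split_proj_def by (intro integral_cong_AE) auto
  also have "\<dots> = (P1 u - P1 0) + (P2 v - P2 u) + (P3 1 - P3 v)"
    using ints by simp
  also have "\<dots> = cvm u v" using assms
    by (simp add: P1_def P2_def P3_def cvm_def max_def power2_eq_square power3_eq_cube field_simps)
  finally show ?thesis .
qed

lemma split_proj_eq:
  assumes "0 \<le> u" "u \<le> 1" "0 \<le> v" "v \<le> 1"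
  shows "split_proj u v = cvm u v"
proof (cases "u \<le> v")
  case False
  have "split_proj u v = split_proj v u" by (simp add: split_proj_def mult.commute)
  also have "\<dots> = cvm v u" using False assms by (intro split_proj_le) auto
  finally show ?thesis by (simp add: cvm_def max.commute add.commute)
qed (use assms split_proj_le in auto)

definition tau_proj :: "real \<Rightarrow> real \<Rightarrow> real" where
  "tau_proj u v = (\<integral>s. \<integral>t. tau4 u v s t \<partial>U01 \<partial>U01)"

lemma tau4_measurable [measurable]:
  assumes [measurable]: "f \<in> borel_measurable M" "g \<in> borel_measurable M" "h \<in> borel_measurable M" "k \<in> borel_measurable M"
  shows "(\<lambda>x. tau4 (f x) (g x) (h x) (k x)) \<in> borel_measurable M"
  unfolding tau4_def by measurable

lemma tau4_bound: "\<bar>tau4 a b c d\<bar> \<le> 4"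
  unfolding tau4_def by (auto simp: of_bool_def)

text \<open>Replacing the arguments (u, v, s, t) by (v, u, t, s) permutes the four terms of
  \<open>tau4\<close>, and Fubini restores the order of s and t.\<close>

lemma tau_proj_sym: "tau_proj u v = tau_proj v u"
proof -
  define f where "f z = tau4 (z 0) (z 1) (z 2) (z 3)" for z :: "nat \<Rightarrow> real"
  have f: "bounded_measurable U01 f" unfolding f_def
    by (rule bounded_measurableI[OF _ tau4_bound]) measurable
  have "tau_proj u v = iter_int U01 [2, 3] f ((\<lambda>_. 0)(0 := u, 1 := v))"
    by (simp add: tau_proj_def f_def)
  also have "\<dots> = iter_int U01 [3, 2] f ((\<lambda>_. 0)(0 := u, 1 := v))"
    by (rule fun_cong[OF U01.iter_int_swap[OF f]])
  also have "\<dots> = (\<integral>t. \<integral>s. tau4 u v s t \<partial>U01 \<partial>U01)" by (simp add: f_def)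
  also have "\<dots> = tau_proj v u" unfolding tau_proj_def
    by (intro Bochner_Integration.integral_cong refl) (auto simp: tau4_def of_bool_def)
  finally show ?thesis .
qed

lemma tau_proj_less:
  assumes "0 \<le> u" "u < v" "v \<le> 1"
  shows "tau_proj u v = 3 * cvm u v"
proof -
  have in1: "(\<integral>t. (of_bool (a < t) :: real) \<partial>U01) = 1 - a" if "0 \<le> a" "a \<le> 1" for a
    using that by (subst integral_U01_indicator[of a 1]) auto
  have in2: "(\<integral>t. (of_bool (t < a) :: real) \<partial>U01) = a" if "0 \<le> a" "a \<le> 1" for a
    using that by (subst integral_U01_indicator[of 0 a]) auto
  have inner: "(\<integral>t. tau4 u v s t \<partial>U01) = of_bool (v < s) * (1 - v) - of_bool (s < v) * (1 - max u s) + of_bool (s < u) * u"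
    if s: "0 \<le> s" "s \<le> 1" for s
  proof -
    have i: "integrable U01 (\<lambda>t. of_bool (a < t) :: real)" "integrable U01 (\<lambda>t. of_bool (t < a) :: real)" for a
      by (auto intro!: integrable_U01_bounded[where B=1])
    define M where "M = max u s"
    have M: "0 \<le> M" "M \<le> 1" using assms s by (auto simp: M_def)
    \<comment> \<open>For u < v the second term of \<open>tau4\<close> is void; in each other term
      the conditions on s and on t separate once max u s is formed.\<close>
    have "tau4 u v s t = of_bool (v < s) * of_bool (v < t) - of_bool (s < v) * of_bool (M < t) + of_bool (s < u) * of_bool (t < u)" for t
      using assms by (auto simp: tau4_def of_bool_def M_def)
    then show ?thesis using i M assms s by (simp add: in1 in2 flip: M_def)
  qed
  \<comment> \<open>Antiderivatives of the inner integral as a function of s, which equals 2u - 1, s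
    - 1 and 1 - v on [0,u], [u,v] and [v,1].\<close>
  define P1 P2 P3 :: "real \<Rightarrow> real" where "P1 x = (2 * u - 1) * x" and "P2 x = x\<^sup>2 / 2 - x" and "P3 x = (1 - v) * x" for x
  have d: "(P1 has_real_derivative (2 * u - 1)) (at x)" "(P2 has_real_derivative x - 1) (at x)"
    "(P3 has_real_derivative (1 - v)) (at x)" for x
    unfolding P1_def P2_def P3_def by (auto intro!: derivative_eq_intros simp: power2_eq_square algebra_simps)
  have c: "continuous_on UNIV (\<lambda>x::real. 2 * u - 1)" "continuous_on UNIV (\<lambda>x::real. x - 1)" "continuous_on UNIV (\<lambda>x::real. 1 - v)"
    by (intro continuous_intros)+
  have le: "(0::real) \<le> 0" "0 \<le> u" "u \<le> 1" "u \<le> v" "v \<le> 1" "0 \<le> v" "(1::real) \<le> 1" using assms by auto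
  note ints = integral_U01_piece[OF le(1,2,3) d(1) c(1)] integral_U01_piece[OF le(2,4,5) d(2) c(2)]
    integral_U01_piece[OF le(6,5,7) d(3) c(3)]
  have "AE s in U01. (\<integral>t. tau4 u v s t \<partial>U01) =
    indicator {0..u} s * (2 * u - 1) + indicator {u..v} s * (s - 1) + indicator {v..1} s * (1 - v)"
    using AE_U01 AE_U01_neq[of u] AE_U01_neq[of v]
  proof eventually_elim
    case (elim s)
    then show ?case using assms by (subst inner) (auto simp: max_def split: split_indicator)
  qed
  then have "tau_proj u v = (\<integral>s. indicator {0..u} s * (2 * u - 1) + indicator {u..v} s * (s - 1) + indicator {v..1} s * (1 - v) \<partial>U01)"
    unfolding tau_proj_def by (intro integral_cong_AE) auto
  also have "\<dots> = (P1 u - P1 0) + (P2 v - P2 u) + (P3 1 - P3 v)"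
    by (simp only: Bochner_Integration.integral_add Bochner_Integration.integrable_add ints)
  also have "\<dots> = 3 * cvm u v" using assms
    by (simp add: P1_def P2_def P3_def cvm_def max_def power2_eq_square field_simps)
  finally show ?thesis .
qed

text \<open>On the diagonal the two sides differ, because the kernel of \<open>\<tau>\<^sup>*\<close> uses strict inequalities.\<close>

lemma tau_proj_eq:
  assumes "0 \<le> u" "u \<le> 1" "0 \<le> v" "v \<le> 1" "u \<noteq> v"
  shows "tau_proj u v = 3 * cvm u v"
proof (cases "u < v")
  case False
  then have "tau_proj u v = 3 * cvm v u" using assms by (subst tau_proj_sym) (intro tau_proj_less, auto)
  then show ?thesis by (simp add: cvm_def max.commute add.commute)
qed (use assms tau_proj_less in auto)

lemma borel_measurable_of_bool_le:
  fixes f g :: "'a \<Rightarrow> real"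
  assumes [measurable]: "f \<in> borel_measurable M" "g \<in> borel_measurable M"
  shows "(\<lambda>x. of_bool (f x \<le> g x) :: real) \<in> borel_measurable M"
    and "(\<lambda>x. of_bool (f x = g x) :: real) \<in> borel_measurable M"
  by measurable

lemma borel_measurable_cvm:
  assumes [measurable]: "f \<in> borel_measurable M" "g \<in> borel_measurable M"
  shows "(\<lambda>x. cvm (f x) (g x)) \<in> borel_measurable M"
  unfolding cvm_def by measurable

lemma tau_sum_bound: "\<bar>tau_sum w\<bar> \<le> 4"
  unfolding tau_sum_def by (rule tau4_bound)

lemma bounded_measurable_tau: "bounded_measurable U01 tau_sum"
  by (rule bounded_measurableI[OF _ tau_sum_bound]) (unfold tau_sum_def, measurable)

lemma bounded_measurable_split: "bounded_measurable U01 (split_sum l)"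
  and split_sum_bound: "\<bar>split_sum l w\<bar> \<le> 4"
proof -
  show b: "\<bar>split_sum l w\<bar> \<le> 4" for w unfolding split_sum_def by (auto simp: of_bool_def)
  have "(\<lambda>w. w i) \<in> borel_measurable (PiM UNIV (\<lambda>_. U01))" for i :: nat
    using measurable_component_singleton[of i UNIV "\<lambda>_. U01"] by (simp add: measurable_cong_sets[OF refl sets_U01])
  then have "split_sum l \<in> borel_measurable (PiM UNIV (\<lambda>_. U01))"
    unfolding split_sum_def by (intro borel_measurable_times borel_measurable_diff borel_measurable_of_bool_le)
  then show "bounded_measurable U01 (split_sum l)" using b by (rule bounded_measurableI)
qed

lemma dep_on_tau: "dep_on {1..4} tau_sum"
  unfolding dep_on_def tau_sum_def by auto

lemma dep_on_split: "l \<in> {4..m} \<Longrightarrow> dep_on {1..m} (split_sum l)"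
  unfolding dep_on_def split_sum_def by auto

lemma iter_tau: "iter_int U01 ([] @ [3, 4]) tau_sum = (\<lambda>z. tau_proj (z 1) (z 2))"
  by (simp add: fun_eq_iff tau_sum_def tau_proj_def)

lemma integral_step_diff:
  "(\<integral>r. of_bool P - of_bool (r \<le> t) \<partial>U01) = of_bool P - step_int t"
proof -
  have i: "integrable U01 (\<lambda>r. of_bool (r \<le> t) :: real)" by (auto intro!: integrable_U01_bounded[where B=1])
  then show ?thesis using U01.prob_space by (simp add: step_int_def)
qed

lemma iter_split5: "iter_int U01 ([5] @ [3, 4]) (split_sum 5) = (\<lambda>z. split_proj (z 1) (z 2))"
  by (simp add: fun_eq_iff split_sum_def split_proj_def integral_step_diff)

text \<open>Each factor ignores one of the coordinates 5 and 6, and integrating that one out has no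
  effect. The other is the threshold, so both factors have the same projection as with five
  arguments.\<close>

lemma iter_split56:
  "iter_int U01 ([5, 6] @ [3, 4]) (split_sum 5) = (\<lambda>z. split_proj (z 1) (z 2))"
  "iter_int U01 ([5, 6] @ [3, 4]) (split_sum 6) = (\<lambda>z. split_proj (z 1) (z 2))"
  using U01.prob_space
  by (simp_all add: fun_eq_iff split_sum_def split_proj_def integral_step_diff)

section \<open>Mean square approximation of the three U-statistics by one pair sum\<close>

abbreviation "U2 \<equiv> U01 \<Otimes>\<^sub>M U01"

definition pair_sum :: "nat \<Rightarrow> (nat \<Rightarrow> real \<times> real) \<Rightarrow> real" where
  "pair_sum n z = (\<Sum>p\<in>{1..n}. \<Sum>q\<in>{1..n} - {p}. cvm (fst (z p)) (fst (z q)) * cvm (snd (z p)) (snd (z q)))"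

lemma (in prob_UNIV) AE_PiM_eq_zero:
  assumes f: "bounded_measurable \<mu> f" "\<And>z. 0 \<le> f z" and p: "finite I" "p \<in> I"
    and zero: "\<And>z. (\<integral>w. f (z(p := w)) \<partial>\<mu>) = 0"
  shows "AE z in PiM I (\<lambda>_. \<mu>). f z = 0"
proof -
  have "(\<integral>z. f z \<partial>PiM I (\<lambda>_. \<mu>)) = 0" using integral_PiM_int[OF f(1) p] zero by simp
  then show ?thesis
    using integral_nonneg_eq_0_iff_AE[OF integrable_PiM_bounded[OF f(1), of I]] f(2) by simp
qed

text \<open>With all coordinates except \<open>p\<close> fixed, the exceptional set is null in
  coordinate \<open>p\<close>, whatever value coordinate \<open>q\<close> has; integrating over
  \<open>p\<close> first shows that it is null in the product.\<close>

lemma AE_U2_pair: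
  assumes I: "finite I" "p \<in> I" "p \<noteq> q" and h: "h = fst \<or> h = snd"
    and Q [measurable]: "Measurable.pred (borel \<Otimes>\<^sub>M borel) (\<lambda>w. Q (fst w) (snd w))" and AE: "\<And>c. AE x in U01. \<not> Q x c"
  shows "AE z in PiM I (\<lambda>_::nat. U2). \<not> Q (h (z p)) (h (z q))"
proof -
  have [measurable]: "Measurable.pred borel (\<lambda>x. Q x c)" for c
    using measurable_compose[OF _ Q, of "\<lambda>x. (x, c)" borel] by simp
  have zero: "(\<integral>x. of_bool (Q x c) \<partial>U01) = (0::real)" for c
    using AE[of c] by (subst integral_cong_AE[where g="\<lambda>_. 0"]) auto
  have i: "integrable U01 (\<lambda>x. of_bool (Q x c) :: real)" for c by (intro integrable_U01_bounded[where B=1]) auto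
  have zw: "(\<integral>w. of_bool (Q (h w) c) \<partial>U2) = (0::real)" for c
    using h U01_pair.integral_mult_pair[OF i, of "\<lambda>_. 1"] U01_pair.integral_mult_pair[OF _ i, of "\<lambda>_. 1"] zero
    by (elim disjE) simp_all
  have [measurable]: "h \<in> U2 \<rightarrow>\<^sub>M borel" using h by (elim disjE) simp_all
  have hz: "(\<lambda>z. h (z i)) \<in> borel_measurable (PiM UNIV (\<lambda>_. U2))" for i :: nat
    by (rule measurable_compose[OF measurable_component_singleton, of i]) simp_all
  have "AE z in PiM I (\<lambda>_::nat. U2). of_bool (Q (h (z p)) (h (z q))) = (0::real)"
  proof (rule U01_pair.pair.AE_PiM_eq_zero[OF _ _ I(1,2)])
    have "Measurable.pred (PiM UNIV (\<lambda>_. U2)) (\<lambda>z. Q (h (z p)) (h (z q)))"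
      using measurable_compose[OF measurable_Pair[OF hz hz] Q] by simp
    then show "bounded_measurable U2 (\<lambda>z. of_bool (Q (h (z p)) (h (z q))))"
      by (intro bounded_measurableI[where B=1]) auto
  qed (use I(3) in \<open>auto simp: zw\<close>)
  then show ?thesis by eventually_elim auto
qed

lemma AE_U2_generic:
  "AE z in PiM {1..n} (\<lambda>_::nat. U2). \<forall>p\<in>{1..n}. \<forall>q\<in>{1..n} - {p}.
     0 \<le> fst (z p) \<and> fst (z p) \<le> 1 \<and> 0 \<le> snd (z p) \<and> snd (z p) \<le> 1 \<and>
     0 \<le> fst (z q) \<and> fst (z q) \<le> 1 \<and> 0 \<le> snd (z q) \<and> snd (z q) \<le> 1 \<and>
     fst (z p) \<noteq> fst (z q) \<and> snd (z p) \<noteq> snd (z q)"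
proof -
  \<comment> \<open>A condition on one coordinate is treated as a relation that ignores its second
    argument. The index 0 lies outside \<open>{1..n}\<close> and serves as a dummy partner.\<close>
  have r: "AE z in PiM {1..n} (\<lambda>_::nat. U2). \<not> \<not> (0 \<le> h (z p) \<and> h (z p) \<le> 1)"
    if "p \<in> {1..n}" "h = fst \<or> h = snd" for p h
    using that AE_U01 by (intro AE_U2_pair[where q=0 and Q="\<lambda>x c. \<not> (0 \<le> x \<and> x \<le> 1)"]) auto
  have d: "AE z in PiM {1..n} (\<lambda>_::nat. U2). h (z p) \<noteq> h (z q)"
    if "p \<in> {1..n}" "p \<noteq> q" "h = fst \<or> h = snd" for p q h
    using that AE_U01_neq by (intro AE_U2_pair[where Q="\<lambda>x c. x = c"]) auto
  have "AE z in PiM {1..n} (\<lambda>_::nat. U2).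
     0 \<le> fst (z p) \<and> fst (z p) \<le> 1 \<and> 0 \<le> snd (z p) \<and> snd (z p) \<le> 1 \<and>
     0 \<le> fst (z q) \<and> fst (z q) \<le> 1 \<and> 0 \<le> snd (z q) \<and> snd (z q) \<le> 1 \<and>
     fst (z p) \<noteq> fst (z q) \<and> snd (z p) \<noteq> snd (z q)"
    if pq: "p \<in> {1..n}" "q \<in> {1..n} - {p}" for p q
    using r[of p fst] r[of p snd] r[of q fst] r[of q snd]
      d[of p q fst] d[of p q snd] pq
    by (auto elim: eventually_elim2)
  then show ?thesis by (intro AE_finite_allI) auto
qed

lemma pair_sum_measurable: "pair_sum n \<in> borel_measurable (PiM UNIV (\<lambda>_. U2))"
proof -
  have hz: "(\<lambda>z. h (z i)) \<in> borel_measurable (PiM UNIV (\<lambda>_. U2))" if "h = fst \<or> h = snd" for i :: nat and h :: "real \<times> real \<Rightarrow> real"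
  proof -
    have "h \<in> U2 \<rightarrow>\<^sub>M borel" using that by (elim disjE) simp_all
    then show ?thesis by (rule measurable_compose[OF measurable_component_singleton, rotated]) simp
  qed
  show ?thesis unfolding pair_sum_def
    by (intro borel_measurable_sum borel_measurable_times borel_measurable_cvm hz) simp_all
qed

lemma kernel_of_signed_sums:
  assumes a: "bounded_measurable U01 (signed_sum m IX)" "dep_on {1..m} (signed_sum m IX)"
    and b: "bounded_measurable U01 (signed_sum m IY)" "dep_on {1..m} (signed_sum m IY)"
  shows "kernel m c IX IY = (\<lambda>z. c * (signed_sum m IX (\<lambda>i. fst (z i)) * signed_sum m IY (\<lambda>i. snd (z i))))" (is "_ = ?k")
    and "dep_on {1..m} (kernel m c IX IY)" and "bounded_measurable U2 (kernel m c IX IY)"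
proof -
  show k: "kernel m c IX IY = ?k" unfolding kernel_def by (simp add: mult.assoc)
  show "dep_on {1..m} (kernel m c IX IY)" unfolding dep_on_def k
    using dep_onD[OF a(2)] dep_onD[OF b(2)] by (metis (no_types, lifting))
  show "bounded_measurable U2 (kernel m c IX IY)" unfolding k
    by (intro bounded_measurable_mult bounded_measurable_const bounded_measurable_comp[OF a(1)] bounded_measurable_comp[OF b(1)]
        measurable_fst measurable_snd)
qed

text \<open>The projection need only be a multiple of \<open>cvm\<close> at distinct points of
  [0,1], because the sum runs over distinct indices and ties have probability zero. The factor d
  appears squared, once for each component.\<close>

lemma U_stat_pair_sum:
  assumes m: "m \<ge> 4"
    and a: "bounded_measurable U01 a" "dep_on {1..m} a" "swap_odd 1 4 a" "swap_odd 2 3 a"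
    and b: "bounded_measurable U01 b" "dep_on {1..m} b" "swap_odd 1 4 b" "swap_odd 2 3 b"
    and R: "set R = {5..m}"
    and ga: "iter_int U01 (R @ [3, 4]) a = (\<lambda>z. g (z 1) (z 2))"
    and gb: "iter_int U01 (R @ [3, 4]) b = (\<lambda>z. g (z 1) (z 2))"
    and g: "\<And>u v. 0 \<le> u \<Longrightarrow> u \<le> 1 \<Longrightarrow> 0 \<le> v \<Longrightarrow> v \<le> 1 \<Longrightarrow> u \<noteq> v \<Longrightarrow> g u v = d * cvm u v"
    and bound: "\<And>w. \<bar>a w\<bar> \<le> A" "\<And>w. \<bar>b w\<bar> \<le> A" and c: "c > 0"
    and IX: "signed_sum m IX = a" and IY: "signed_sum m IY = b"
  shows "\<exists>K. \<forall>n\<ge>m. (\<integral>z. (real n * U_stat m c IX IY n z - 4 * c * d\<^sup>2 / (real n - 1) * pair_sum n z)\<^sup>2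
      \<partial>PiM {1..n} (\<lambda>_. U2)) \<le> K / real n"
proof (intro exI allI impI)
  fix n assume n: "n \<ge> m"
  let ?P = "PiM {1..n} (\<lambda>_::nat. U2)"
  define k where "k = kernel m c IX IY"
  note kf = kernel_of_signed_sums[of m IX IY c, folded k_def, unfolded IX IY, OF a(1,2) b(1,2)]
  have U: "U_stat m c IX IY n z = (\<Sum>j\<in>inj_tuples m n. k (\<lambda>i. z (j i))) / (real (n choose m) * fact m)" for z
    using kf(2) unfolding k_def by (rule U_stat_eq_inj_sum)
  define S where "S z = (\<Sum>p\<in>{1..n}. \<Sum>q\<in>{1..n} - {p}. g (fst (z p)) (fst (z q)) * g (snd (z p)) (snd (z q)))" for z :: "nat \<Rightarrow> real \<times> real"
  have "bounded_measurable U01 (\<lambda>z. g (z 1) (z 2))" unfolding ga[symmetric] by (intro U01.bounded_measurable_iter a)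
  then have bg: "bounded_measurable U01 (\<lambda>z. g (z p) (z q))" for p q
    using bounded_measurable_reindex[of U01 "\<lambda>z. g (z 1) (z 2)" "\<lambda>i. if i = 1 then p else q"] by simp
  have bgg: "bounded_measurable U2 (\<lambda>z. g (fst (z p)) (fst (z q)) * g (snd (z p)) (snd (z q)))" for p q
    by (intro bounded_measurable_mult bounded_measurable_comp[OF bg] measurable_fst measurable_snd)
  have [measurable]: "(\<lambda>z. g (fst (z p)) (fst (z q)) * g (snd (z p)) (snd (z q))) \<in> borel_measurable ?P" for p q
    by (rule U01_pair.pair.bounded_measurable_PiM[OF bgg])
  have [measurable]: "(\<lambda>z. k (\<lambda>i. z (j i))) \<in> borel_measurable ?P" for j
    by (rule U01_pair.pair.bounded_measurable_PiM[OF bounded_measurable_reindex[OF kf(3)]])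
  have [measurable]: "pair_sum n \<in> borel_measurable ?P"
    by (rule measurable_compose[OF U01_pair.pair.measurable_PiM_UNIV pair_sum_measurable])
  have [measurable]: "S \<in> borel_measurable ?P" unfolding S_def by measurable
  have "AE z in ?P. d\<^sup>2 * pair_sum n z = S z"
    using AE_U2_generic[of n]
  proof eventually_elim
    case (elim z)
    show ?case unfolding S_def pair_sum_def sum_distrib_left
    proof (intro sum.cong refl)
      fix p q assume "p \<in> {1..n}" "q \<in> {1..n} - {p}"
      with elim have "g (fst (z p)) (fst (z q)) = d * cvm (fst (z p)) (fst (z q))"
        "g (snd (z p)) (snd (z q)) = d * cvm (snd (z p)) (snd (z q))" by (blast intro: g)+
      then show "d\<^sup>2 * (cvm (fst (z p)) (fst (z q)) * cvm (snd (z p)) (snd (z q))) = g (fst (z p)) (fst (z q)) * g (snd (z p)) (snd (z q))"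
        by (simp add: power2_eq_square)
    qed
  qed
  then have "AE z in ?P. (real n * U_stat m c IX IY n z - 4 * c * d\<^sup>2 / (real n - 1) * pair_sum n z)\<^sup>2
     = (real n * ((\<Sum>j\<in>inj_tuples m n. k (\<lambda>i. z (j i))) / (real (n choose m) * fact m)) - 4 * c / (real n - 1) * S z)\<^sup>2"
    unfolding U
  proof eventually_elim
    case (elim z)
    have "4 * c * d\<^sup>2 / (real n - 1) * pair_sum n z = 4 * c / (real n - 1) * (d\<^sup>2 * pair_sum n z)" by simp
    then show ?case by (simp only: elim)
  qed
  then have "(\<integral>z. (real n * U_stat m c IX IY n z - 4 * c * d\<^sup>2 / (real n - 1) * pair_sum n z)\<^sup>2 \<partial>?P)
    = (\<integral>z. (real n * ((\<Sum>j\<in>inj_tuples m n. k (\<lambda>i. z (j i))) / (real (n choose m) * fact m)) - 4 * c / (real n - 1) * S z)\<^sup>2 \<partial>?P)"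
    by (intro integral_cong_AE) (unfold U, measurable)
  also have "\<dots> \<le> (5 * c * A\<^sup>2)\<^sup>2 * real m ^ 6 * real m ^ (2 * m) / real n"
    unfolding S_def using n m by (intro U01_pair.U_stat_remainder[OF _ _ _ a b R ga gb bound c kf(1)]) auto
  finally show "(\<integral>z. (real n * U_stat m c IX IY n z - 4 * c * d\<^sup>2 / (real n - 1) * pair_sum n z)\<^sup>2 \<partial>?P)
    \<le> (5 * c * A\<^sup>2)\<^sup>2 * real m ^ 6 * real m ^ (2 * m) / real n" .
qed

text \<open>Here 36 = 4 c d^2 with c = 1 and d = 3.\<close>

lemma U_tau_pair_sum:
  "\<exists>K. \<forall>n\<ge>4. (\<integral>z. (real n * U_tau n z - 36 / (real n - 1) * pair_sum n z)\<^sup>2 \<partial>PiM {1..n} (\<lambda>_. U2)) \<le> K / real n"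
  using U_stat_pair_sum[OF _ bounded_measurable_tau dep_on_tau swap_odd_tau bounded_measurable_tau dep_on_tau swap_odd_tau _
      iter_tau iter_tau tau_proj_eq tau_sum_bound tau_sum_bound _ signed_sum_tau signed_sum_tau, of 1]
  by (simp add: U_tau_def)

text \<open>Here 4 c d^2 = 1 with c = 1/4 and d = 1.\<close>

lemma U_D_pair_sum:
  "\<exists>K. \<forall>n\<ge>5. (\<integral>z. (real n * U_D n z - 1 / (real n - 1) * pair_sum n z)\<^sup>2 \<partial>PiM {1..n} (\<lambda>_. U2)) \<le> K / real n"
proof -
  have s: "dep_on {1..5} (split_sum 5)" "swap_odd 1 4 (split_sum 5)" "swap_odd 2 3 (split_sum 5)"
    "signed_sum 5 (I_split 5) = split_sum 5"
    by (rule dep_on_split swap_odd_split signed_sum_split; simp)+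
  show ?thesis
    using U_stat_pair_sum[OF _ bounded_measurable_split s(1-3) bounded_measurable_split s(1-3) _
      iter_split5 iter_split5 _ split_sum_bound split_sum_bound _ s(4) s(4), of 1 "1/4"] split_proj_eq
    by (simp add: U_D_def)
qed

lemma U_R_pair_sum:
  "\<exists>K. \<forall>n\<ge>6. (\<integral>z. (real n * U_R n z - 1 / (real n - 1) * pair_sum n z)\<^sup>2 \<partial>PiM {1..n} (\<lambda>_. U2)) \<le> K / real n"
proof -
  have s: "dep_on {1..6} (split_sum l)" "swap_odd 1 4 (split_sum l)" "swap_odd 2 3 (split_sum l)"
    "signed_sum 6 (I_split l) = split_sum l" if "l \<in> {5, 6}" for l
    by (rule dep_on_split swap_odd_split signed_sum_split; use that in auto)+
  have l: "5 \<in> {5, 6::nat}" "6 \<in> {5, 6::nat}" by auto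
  have R: "set [5, 6] = {5..6::nat}" by auto
  show ?thesis
    using U_stat_pair_sum[OF _ bounded_measurable_split s(1-3)[OF l(1)] bounded_measurable_split s(1-3)[OF l(2)] R
      iter_split56 _ split_sum_bound split_sum_bound _ s(4)[OF l(1)] s(4)[OF l(2)], of 1 "1/4"] split_proj_eq
    by (simp add: U_R_def)
qed

subsection \<open>Fourier expansion of the limit kernel\<close>

text \<open>Multiplied by 2 sin(x/2), each cosine becomes a difference of consecutive half-integer
  sines, and the sum telescopes.\<close>

lemma dirichlet_kernel_cos:
  fixes x :: real
  shows "2 * sin (x / 2) * (1 / 2 + (\<Sum>k\<in>{1..N}. cos (real k * x))) = sin ((real N + 1 / 2) * x)"
proof (induction N)
  case (Suc N)
  have "2 * sin (x / 2) * cos (real (Suc N) * x) = sin ((real (Suc N) + 1 / 2) * x) - sin ((real N + 1 / 2) * x)"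
  proof -
    have "(real (Suc N) + 1 / 2) * x = real (Suc N) * x + x / 2" "(real N + 1 / 2) * x = real (Suc N) * x - x / 2"
      by (auto simp: algebra_simps)
    then show ?thesis by (simp only: sin_add sin_diff) simp
  qed
  then show ?case using Suc by (simp add: algebra_simps)
qed simp

definition sawtooth_err :: "nat \<Rightarrow> real \<Rightarrow> real" where
  "sawtooth_err N x = (\<Sum>k\<in>{1..N}. sin (real k * x) / real k) - (pi - x) / 2"

text \<open>
  Integrating the Dirichlet kernel by parts from \<open>\<pi>\<close>, where the error vanishes, shows that
  the error is \<open>O(1/N)\<close> away from the endpoints.
\<close>

lemma sawtooth_err_bound:
  fixes N :: nat and x \<delta> :: real
  assumes \<delta>: "0 < \<delta>" "\<delta> < pi" and x: "x \<in> {\<delta>..2 * pi - \<delta>}"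
  defines "a \<equiv> real N + 1 / 2" and "s \<equiv> sin (\<delta> / 2)"
  shows "\<bar>sawtooth_err N x\<bar> \<le> (pi / (4 * s\<^sup>2) + 1 / (2 * s)) / a"
proof -
  have a: "a > 0" by (simp add: a_def)
  have s: "s > 0" unfolding s_def using \<delta> by (intro sin_gt_zero) auto
  \<comment> \<open>The sine of x/2 is symmetric about x = pi, so on the interval it is smallest at
    the endpoints.\<close>
  have sx: "s \<le> sin (x / 2)" if "x \<in> {\<delta>..2 * pi - \<delta>}" for x
  proof (cases "x \<le> pi")
    case True
    then show ?thesis unfolding s_def using that \<delta> by (intro sin_monotone_2pi_le) auto
  next
    case False
    have "s \<le> sin ((2 * pi - x) / 2)" unfolding s_def using that \<delta> False by (intro sin_monotone_2pi_le) auto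
    also have "(2 * pi - x) / 2 = pi - x / 2" by simp
    finally show ?thesis by simp
  qed
  \<comment> \<open>The error plus the boundary term of the integration by parts; the derivative of
    this sum carries the factor 1/a.\<close>
  define G where "G x = sawtooth_err N x + cos (a * x) / (2 * a * sin (x / 2))" for x
  define G' where "G' x = - (cos (a * x) * cos (x / 2)) / (4 * a * (sin (x / 2))\<^sup>2)" for x
  have der: "(G has_field_derivative G' x) (at x within {\<delta>..2 * pi - \<delta>})" if "x \<in> {\<delta>..2 * pi - \<delta>}" for x
  proof -
    have nz: "sin (x / 2) \<noteq> 0" using sx[OF that] s by auto
    have "((\<lambda>x. sin (real k * x) / real k) has_field_derivative cos (real k * x)) (at x)" if "k \<in> {1..N}" for k
      using that by (auto intro!: derivative_eq_intros)
    then have "((\<lambda>x. \<Sum>k\<in>{1..N}. sin (real k * x) / real k) has_field_derivative (\<Sum>k\<in>{1..N}. cos (real k * x))) (at x)"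
      by (intro DERIV_sum) auto
    then have e: "(sawtooth_err N has_field_derivative (\<Sum>k\<in>{1..N}. cos (real k * x)) + 1 / 2) (at x)"
      unfolding sawtooth_err_def[abs_def] by (auto intro!: derivative_eq_intros)
    have c: "((\<lambda>x. cos (a * x) / (2 * a * sin (x / 2))) has_field_derivative
      - sin (a * x) / (2 * sin (x / 2)) - cos (a * x) * cos (x / 2) / (4 * a * (sin (x / 2))\<^sup>2)) (at x)"
      using nz a by (auto intro!: derivative_eq_intros simp: field_simps power2_eq_square)
    have "(\<Sum>k\<in>{1..N}. cos (real k * x)) + 1 / 2 = sin (a * x) / (2 * sin (x / 2))"
      using dirichlet_kernel_cos[of x N] nz by (simp add: a_def field_simps)
    then have "(\<Sum>k\<in>{1..N}. cos (real k * x)) + 1 / 2 +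
      (- sin (a * x) / (2 * sin (x / 2)) - cos (a * x) * cos (x / 2) / (4 * a * (sin (x / 2))\<^sup>2)) = G' x"
      by (simp add: G'_def)
    with DERIV_add[OF e c] have "(G has_field_derivative G' x) (at x)" by (simp add: G_def[abs_def])
    then show ?thesis by (rule has_field_derivative_at_within)
  qed
  have bd: "norm (G' x) \<le> 1 / (4 * a * s\<^sup>2)" if "x \<in> {\<delta>..2 * pi - \<delta>}" for x
  proof -
    have "\<bar>cos (a * x) * cos (x / 2)\<bar> \<le> 1" unfolding abs_mult
      by (intro mult_le_one) auto
    moreover have "s\<^sup>2 \<le> (sin (x / 2))\<^sup>2" using sx[OF that] s by (intro power_mono) auto
    ultimately show ?thesis unfolding G'_def using a s
      by (simp add: abs_mult) (intro frac_le mult_left_mono; simp)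
  qed
  \<comment> \<open>The base point pi makes everything vanish: all sines, the linear term, and
    cos((N + 1/2) pi).\<close>
  have Gpi: "G pi = 0"
  proof -
    have "sin (real k * pi) = 0" for k by simp
    moreover have "cos (a * pi) = 0"
      by (simp add: a_def distrib_right cos_add cos_npi)
    ultimately show ?thesis by (simp add: G_def sawtooth_err_def)
  qed
  have "norm (G x - G pi) \<le> 1 / (4 * a * s\<^sup>2) * norm (x - pi)"
    using \<delta> x by (intro field_differentiable_bound[OF _ der bd]) auto
  also have "\<dots> \<le> 1 / (4 * a * s\<^sup>2) * pi" using x \<delta> a by (intro mult_left_mono) auto
  finally have 1: "\<bar>G x\<bar> \<le> pi / (4 * a * s\<^sup>2)" using Gpi by simp
  have 2: "\<bar>cos (a * x) / (2 * a * sin (x / 2))\<bar> \<le> 1 / (2 * a * s)"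
    using sx[OF x] s a unfolding abs_divide by (intro frac_le) (auto simp: abs_mult)
  have "\<bar>sawtooth_err N x\<bar> \<le> pi / (4 * a * s\<^sup>2) + 1 / (2 * a * s)"
    using 1 2 unfolding G_def by linarith
  also have "\<dots> = (pi / (4 * s\<^sup>2) + 1 / (2 * s)) / a" using a s by (simp add: field_simps)
  finally show ?thesis .
qed

definition cos_sum :: "real \<Rightarrow> real" where
  "cos_sum x = (\<Sum>k. cos (real (Suc k) * x) / (real (Suc k))\<^sup>2)"

lemma inverse_squares_sums': "(\<lambda>k. 1 / (real (Suc k))\<^sup>2) sums (pi\<^sup>2 / 6)"
  using inverse_squares_sums by (simp add: add.commute)

lemma cos_sum_sums: "(\<lambda>k. cos (real (Suc k) * x) / (real (Suc k))\<^sup>2) sums cos_sum x"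
  unfolding cos_sum_def
proof (rule summable_sums, rule summable_comparison_test)
  show "summable (\<lambda>k. 1 / (real (Suc k))\<^sup>2)" using inverse_squares_sums' by (simp add: sums_iff)
  show "\<exists>N. \<forall>n\<ge>N. norm (cos (real (Suc n) * x) / (real (Suc n))\<^sup>2) \<le> 1 / (real (Suc n))\<^sup>2"
    by (auto intro!: divide_right_mono)
qed

lemma continuous_cos_sum: "continuous_on UNIV cos_sum"
proof (rule uniform_limit_theorem)
  show "uniform_limit UNIV (\<lambda>n x. \<Sum>k<n. cos (real (Suc k) * x) / (real (Suc k))\<^sup>2) cos_sum sequentially"
    unfolding cos_sum_def[abs_def]
  proof (rule Weierstrass_m_test)
    show "summable (\<lambda>k. 1 / (real (Suc k))\<^sup>2)" using inverse_squares_sums' by (simp add: sums_iff)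
  qed (auto intro!: divide_right_mono)
  show "\<forall>\<^sub>F n in sequentially. continuous_on UNIV (\<lambda>x. \<Sum>k<n. cos (real (Suc k) * x) / (real (Suc k))\<^sup>2)"
    by (intro always_eventually allI continuous_intros) auto
qed simp

text \<open>This is pi^2 B_2(x/(2 pi)) for the second Bernoulli polynomial B_2(y) = y^2 - y +
  1/6.\<close>

definition bern_poly :: "real \<Rightarrow> real" where
  "bern_poly x = pi\<^sup>2 / 6 - pi * x / 2 + x\<^sup>2 / 4"

text \<open>The partial sums minus the polynomial have derivative \<open>- sawtooth_err N\<close>,
  which tends to 0 uniformly on a closed interval inside (0, 2 pi) containing both x and pi. In the
  limit the difference of the values at x and pi vanishes.\<close>

lemma cos_sum_diff_const:
  assumes x: "0 < x" "x < 2 * pi"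
  shows "cos_sum x - bern_poly x = cos_sum pi - bern_poly pi"
proof -
  define \<delta> where "\<delta> = min (min x (2 * pi - x)) (pi / 2)"
  have \<delta>: "0 < \<delta>" "\<delta> < pi" using x by (auto simp: \<delta>_def)
  have xd: "x \<in> {\<delta>..2 * pi - \<delta>}" "pi \<in> {\<delta>..2 * pi - \<delta>}" using x \<delta> by (auto simp: \<delta>_def)
  define s where "s = sin (\<delta> / 2)"
  define C where "C = pi / (4 * s\<^sup>2) + 1 / (2 * s)"
  define d where "d N x = (\<Sum>k\<in>{1..N}. cos (real k * x) / (real k)\<^sup>2) - bern_poly x" for N x
  have der: "(d N has_field_derivative - sawtooth_err N y) (at y within {\<delta>..2 * pi - \<delta>})" for N y
  proof -
    have "((\<lambda>x. cos (real k * x) / (real k)\<^sup>2) has_field_derivative - (sin (real k * y) / real k)) (at y)" if "k \<in> {1..N}" for k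
      using that by (auto intro!: derivative_eq_intros simp: power2_eq_square)
    then have 1: "((\<lambda>x. \<Sum>k\<in>{1..N}. cos (real k * x) / (real k)\<^sup>2) has_field_derivative (\<Sum>k\<in>{1..N}. - (sin (real k * y) / real k))) (at y)"
      by (intro DERIV_sum) auto
    have 2: "(bern_poly has_field_derivative - (pi - y) / 2) (at y)"
    proof -
      have "(bern_poly has_field_derivative 0 - pi * 1 / 2 + 2 * y / 4) (at y)"
        unfolding bern_poly_def[abs_def] by (auto intro!: derivative_eq_intros)
      moreover have "0 - pi * 1 / 2 + 2 * y / 4 = - (pi - y) / 2" by (simp add: diff_divide_distrib)
      ultimately show ?thesis by (simp only:)
    qed
    have "(\<Sum>k\<in>{1..N}. - (sin (real k * y) / real k)) - - (pi - y) / 2 = - sawtooth_err N y"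
      by (simp add: sawtooth_err_def sum_negf diff_divide_distrib)
    with DERIV_diff[OF 1 2] have "(d N has_field_derivative - sawtooth_err N y) (at y)"
      by (simp only: d_def[abs_def])
    then show ?thesis by (rule has_field_derivative_at_within)
  qed
  have bd: "\<bar>d N x - d N pi\<bar> \<le> C / (real N + 1 / 2) * \<bar>x - pi\<bar>" for N
  proof -
    have "norm (d N x - d N pi) \<le> C / (real N + 1 / 2) * norm (x - pi)"
    proof (rule field_differentiable_bound[OF _ der])
      show "norm (- sawtooth_err N y) \<le> C / (real N + 1 / 2)" if "y \<in> {\<delta>..2 * pi - \<delta>}" for y
        using sawtooth_err_bound[OF \<delta> that, of N] by (simp add: C_def s_def)
    qed (use xd in auto)
    then show ?thesis by simp
  qed
  have lim: "(\<lambda>N. d N y) \<longlonglongrightarrow> cos_sum y - bern_poly y" for y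
  proof -
    have "(\<Sum>k\<in>{1..N}. cos (real k * y) / (real k)\<^sup>2) = (\<Sum>k<N. cos (real (Suc k) * y) / (real (Suc k))\<^sup>2)" for N
      by (rule sum.reindex_bij_witness[of _ Suc "\<lambda>k. k - 1"]) auto
    then show ?thesis unfolding d_def using cos_sum_sums[of y] by (intro tendsto_diff) (auto simp: sums_def)
  qed
  have "(\<lambda>N. C / (real N + 1 / 2) * \<bar>x - pi\<bar>) \<longlonglongrightarrow> 0"
    by real_asymp
  then have "(\<lambda>N. d N x - d N pi) \<longlonglongrightarrow> 0"
    by (rule Lim_null_comparison[rotated]) (use bd in auto)
  moreover have "(\<lambda>N. d N x - d N pi) \<longlonglongrightarrow> (cos_sum x - bern_poly x) - (cos_sum pi - bern_poly pi)"
    by (intro tendsto_diff[OF lim lim])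
  ultimately show ?thesis using LIMSEQ_unique by fastforce
qed

text \<open>The constant left open by differentiation is found at 0, where continuity applies and
  the series is the Basel sum. At 2 pi the series has the same value.\<close>

lemma cos_sum_eq:
  assumes "0 \<le> x" "x \<le> 2 * pi"
  shows "cos_sum x = bern_poly x"
proof -
  define c where "c = cos_sum pi - bern_poly pi"
  have z: "cos_sum 0 = pi\<^sup>2 / 6" using inverse_squares_sums' by (simp add: cos_sum_def sums_iff)
  have "cos (real (Suc k) * (2 * pi)) = 1" for k
    using cos_int_2pin[of "int (Suc k)"] by (simp add: mult.commute)
  then have z2: "cos_sum (2 * pi) = pi\<^sup>2 / 6"
    unfolding cos_sum_def using inverse_squares_sums' by (simp only: sums_iff)
  have cont: "isCont (\<lambda>x. cos_sum x - bern_poly x) 0"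
    using continuous_cos_sum unfolding bern_poly_def by (intro continuous_intros) (auto simp: continuous_on_eq_continuous_at)
  \<comment> \<open>Interior points tending to 0, along which the difference is already known to be
    constant.\<close>
  have "(\<lambda>n. 1 / real (Suc n)) \<longlonglongrightarrow> 0" by (rule LIMSEQ_inverse_real_of_nat[unfolded inverse_eq_divide])
  then have "(\<lambda>n. cos_sum (1 / real (Suc n)) - bern_poly (1 / real (Suc n))) \<longlonglongrightarrow> cos_sum 0 - bern_poly 0"
    by (rule isCont_tendsto_compose[OF cont])
  moreover have "cos_sum (1 / real (Suc n)) - bern_poly (1 / real (Suc n)) = c" for n
    unfolding c_def
  proof (rule cos_sum_diff_const)
    have "1 / real (Suc n) \<le> 1" by simp
    also have "\<dots> < 2 * pi" using pi_gt3 by simp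
    finally show "1 / real (Suc n) < 2 * pi" .
  qed simp
  ultimately have "(\<lambda>n::nat. c) \<longlonglongrightarrow> cos_sum 0 - bern_poly 0" by simp
  then have "c = 0" using z by (simp add: LIMSEQ_const_iff bern_poly_def)
  consider "x = 0" | "x = 2 * pi" | "0 < x" "x < 2 * pi" using assms by linarith
  then show ?thesis
  proof cases
    case 3
    then show ?thesis using cos_sum_diff_const[OF 3] \<open>c = 0\<close> by (simp add: c_def)
  qed (use z z2 in \<open>simp_all add: bern_poly_def power2_eq_square algebra_simps\<close>)
qed

text \<open>The product of cosines is a sum of cosines of pi(u - v) and pi(u + v). For v \<le> u
  both angles lie in [0, 2 pi], and the linear parts of the two polynomials add up to -u, which is
  the maximum.\<close>

lemma cos_product_series:
  fixes u v :: real
  assumes "0 \<le> u" "u \<le> 1" "0 \<le> v" "v \<le> 1"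
  shows "(\<lambda>k. 2 * cos (real (Suc k) * pi * u) * cos (real (Suc k) * pi * v) / (pi\<^sup>2 * (real (Suc k))\<^sup>2))
    sums (1 / 3 - max u v + (u\<^sup>2 + v\<^sup>2) / 2)"
proof -
  have *: "(\<lambda>k. 2 * cos (real (Suc k) * pi * u) * cos (real (Suc k) * pi * v) / (pi\<^sup>2 * (real (Suc k))\<^sup>2))
    sums (1 / 3 - u + (u\<^sup>2 + v\<^sup>2) / 2)" if "0 \<le> v" "v \<le> u" "u \<le> 1" for u v :: real
  proof -
    have 1: "(\<lambda>k. 1 / pi\<^sup>2 * (cos (real (Suc k) * (pi * (u - v))) / (real (Suc k))\<^sup>2 + cos (real (Suc k) * (pi * (u + v))) / (real (Suc k))\<^sup>2))
      sums (1 / pi\<^sup>2 * (cos_sum (pi * (u - v)) + cos_sum (pi * (u + v))))"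
      by (intro sums_mult sums_add cos_sum_sums)
    have "pi * (u - v) \<le> pi * 2" "pi * (u + v) \<le> pi * 2" using that by (intro mult_left_mono; simp)+
    then have 2: "cos_sum (pi * (u - v)) = bern_poly (pi * (u - v))" "cos_sum (pi * (u + v)) = bern_poly (pi * (u + v))"
      using that by (auto intro!: cos_sum_eq)
    have 3: "1 / pi\<^sup>2 * (bern_poly (pi * (u - v)) + bern_poly (pi * (u + v))) = 1 / 3 - u + (u\<^sup>2 + v\<^sup>2) / 2"
      by (simp add: bern_poly_def power2_eq_square field_simps)
    have 4: "1 / pi\<^sup>2 * (cos (real (Suc k) * (pi * (u - v))) / (real (Suc k))\<^sup>2 + cos (real (Suc k) * (pi * (u + v))) / (real (Suc k))\<^sup>2)
      = 2 * cos (real (Suc k) * pi * u) * cos (real (Suc k) * pi * v) / (pi\<^sup>2 * (real (Suc k))\<^sup>2)" for k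
    proof -
      have "real (Suc k) * (pi * (u - v)) = real (Suc k) * pi * u - real (Suc k) * pi * v"
        "real (Suc k) * (pi * (u + v)) = real (Suc k) * pi * u + real (Suc k) * pi * v"
        by (auto simp: algebra_simps)
      then have "cos (real (Suc k) * (pi * (u - v))) + cos (real (Suc k) * (pi * (u + v))) = 2 * cos (real (Suc k) * pi * u) * cos (real (Suc k) * pi * v)"
        by (simp only: cos_add cos_diff)
      then show ?thesis by (simp only: add_divide_distrib[symmetric] times_divide_times_eq mult_1)
    qed
    from 1 show ?thesis by (simp only: 2 3 4)
  qed
  show ?thesis
  proof (cases "v \<le> u")
    case True
    then show ?thesis using *[of v u] assms by (simp add: max_def)
  next
    case False
    then show ?thesis using *[of u v] assms by (simp add: max_def mult_ac add.commute)
  qed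
qed

subsection \<open>Laplace transforms and weak convergence\<close>

lemma integrable_power_01:
  assumes "prob_space M" "U \<in> borel_measurable M" "AE x in M. 0 \<le> U x \<and> U x \<le> (1::real)"
  shows "integrable M (\<lambda>x. U x ^ k * (1 - U x) ^ j)"
proof -
  interpret prob_space M by fact
  have "AE x in M. norm (U x ^ k * (1 - U x) ^ j) \<le> 1"
    using assms(3) by eventually_elim (auto simp: abs_mult intro!: mult_le_one power_le_one)
  then show ?thesis using assms(2) by (intro integrable_const_bound[where B=1]) auto
qed

lemma integral_close:
  fixes f g :: "'a \<Rightarrow> real"
  assumes M: "prob_space M" and int: "integrable M f" "integrable M g"
    and close: "AE x in M. \<bar>f x - g x\<bar> \<le> e"
  shows "\<bar>(\<integral>x. f x \<partial>M) - (\<integral>x. g x \<partial>M)\<bar> \<le> e"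
proof -
  interpret prob_space M by fact
  have "\<bar>(\<integral>x. f x \<partial>M) - (\<integral>x. g x \<partial>M)\<bar> = \<bar>\<integral>x. f x - g x \<partial>M\<bar>" using int by simp
  also have "\<dots> \<le> (\<integral>x. \<bar>f x - g x\<bar> \<partial>M)" using integral_norm_bound[of M "\<lambda>x. f x - g x"] by simp
  also have "\<dots> \<le> (\<integral>x. e \<partial>M)" using int close by (intro integral_mono_AE) auto
  finally show ?thesis by (simp add: prob_space)
qed

text \<open>On [0,1] moments determine convergence, since Bernstein polynomials approximate each
  continuous step function uniformly, and continuous step functions suffice for weak
  convergence.\<close>

lemma moments_01_imp_weak_conv:
  fixes U :: "nat \<Rightarrow> 'a \<Rightarrow> real" and W :: "'b \<Rightarrow> real"
  assumes M: "prob_space M" and N: "prob_space N"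
    and U: "\<And>n. U n \<in> borel_measurable M" "\<And>n. AE x in M. 0 \<le> U n x \<and> U n x \<le> 1"
    and W: "W \<in> borel_measurable N" "AE x in N. 0 \<le> W x \<and> W x \<le> 1"
    and mom: "\<And>k. (\<lambda>n. \<integral>x. U n x ^ k \<partial>M) \<longlonglongrightarrow> (\<integral>x. W x ^ k \<partial>N)"
  shows "weak_conv_m (\<lambda>n. distr M borel (U n)) (distr N borel W)"
proof (rule integral_cts_step_conv_imp_weak_conv)
  interpret M: prob_space M by fact
  interpret N: prob_space N by fact
  show "real_distribution (distr M borel (U n))" for n using U(1) by (rule M.real_distribution_distr)
  show "real_distribution (distr N borel W)" using W(1) by (rule N.real_distribution_distr)
  note iU = integrable_power_01[OF M U] and iW = integrable_power_01[OF N W]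
  \<comment> \<open>The building blocks u^k (1-u)^j of the Bernstein polynomials reduce to moments
    by expanding one factor 1 - u at a time.\<close>
  have mono: "(\<lambda>n. \<integral>x. U n x ^ k * (1 - U n x) ^ j \<partial>M) \<longlonglongrightarrow> (\<integral>x. W x ^ k * (1 - W x) ^ j \<partial>N)" for k j
  proof (induction j arbitrary: k)
    case 0
    then show ?case using mom by simp
  next
    case (Suc j)
    have e: "u ^ k * (1 - u) ^ Suc j = u ^ k * (1 - u) ^ j - u ^ Suc k * (1 - u) ^ j" for u :: real
      by (simp add: algebra_simps)
    have "(\<lambda>n. (\<integral>x. U n x ^ k * (1 - U n x) ^ j \<partial>M) - (\<integral>x. U n x ^ Suc k * (1 - U n x) ^ j \<partial>M))
      \<longlonglongrightarrow> (\<integral>x. W x ^ k * (1 - W x) ^ j \<partial>N) - (\<integral>x. W x ^ Suc k * (1 - W x) ^ j \<partial>N)"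
      by (intro tendsto_diff Suc)
    then show ?case unfolding e
      by (simp only: Bochner_Integration.integral_diff[OF iU iU] Bochner_Integration.integral_diff[OF iW iW])
  qed
  fix a b :: real assume ab: "a < b"
  define f where "f = cts_step a b"
  have fc: "continuous_on A f" for A unfolding f_def
    using uniformly_continuous_imp_continuous[OF cts_step_uniformly_continuous[OF ab]] continuous_on_subset by blast
  have [measurable]: "f \<in> borel_measurable borel" using fc by (intro borel_measurable_continuous_onI)
  have fb: "\<bar>f x\<bar> \<le> 1" for x using ab by (auto simp: f_def cts_step_def)
  have ifU: "integrable M (\<lambda>x. f (U n x))" for n using fb U(1) by (intro M.integrable_const_bound[where B=1]) auto
  have ifW: "integrable N (\<lambda>x. f (W x))" using fb W(1) by (intro N.integrable_const_bound[where B=1]) auto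
  define B where "B m x = (\<Sum>k\<le>m. f (k / m) * Bernstein m k x)" for m :: nat and x
  have Bsum: "B m x = (\<Sum>k\<le>m. (f (k / m) * (m choose k)) * (x ^ k * (1 - x) ^ (m - k)))" for m x
    by (simp add: B_def Bernstein_def mult_ac)
  have iBU: "integrable M (\<lambda>x. B m (U n x))" for m n unfolding Bsum
    by (intro Bochner_Integration.integrable_sum integrable_mult_right iU)
  have iBW: "integrable N (\<lambda>x. B m (W x))" for m unfolding Bsum
    by (intro Bochner_Integration.integrable_sum integrable_mult_right iW)
  have limB: "(\<lambda>n. \<integral>x. B m (U n x) \<partial>M) \<longlonglongrightarrow> (\<integral>x. B m (W x) \<partial>N)" for m
    unfolding Bsum
    by (subst Bochner_Integration.integral_sum[OF integrable_mult_right[OF iU]] Bochner_Integration.integral_sum[OF integrable_mult_right[OF iW]])+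
      (simp only: integral_mult_right_zero, intro tendsto_sum tendsto_mult_left mono)
  have "(\<lambda>n. \<integral>x. f (U n x) \<partial>M) \<longlonglongrightarrow> (\<integral>x. f (W x) \<partial>N)"
  proof (rule LIMSEQ_I)
    fix e :: real assume e: "0 < e"
    have "e / 3 > 0" using e by simp
    from Bernstein_Weierstrass[OF fc this]
    obtain m where "\<forall>n x. m \<le> n \<and> x \<in> {0..1} \<longrightarrow> \<bar>f x - B n x\<bar> < e / 3" unfolding B_def by blast
    then have m: "\<bar>f x - B m x\<bar> < e / 3" if "x \<in> {0..1}" for x using that by blast
    obtain n0 where n0: "\<And>n. n \<ge> n0 \<Longrightarrow> \<bar>(\<integral>x. B m (U n x) \<partial>M) - (\<integral>x. B m (W x) \<partial>N)\<bar> < e / 3"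
      using LIMSEQ_D[OF limB, of "e / 3" m] e by auto
    have 1: "\<bar>(\<integral>x. f (U n x) \<partial>M) - (\<integral>x. B m (U n x) \<partial>M)\<bar> \<le> e / 3" for n
      by (rule integral_close[OF M ifU iBU eventually_mono[OF U(2)[of n]]], rule less_imp_le[OF m]) simp
    have 2: "\<bar>(\<integral>x. f (W x) \<partial>N) - (\<integral>x. B m (W x) \<partial>N)\<bar> \<le> e / 3"
      by (rule integral_close[OF N ifW iBW eventually_mono[OF W(2)]], rule less_imp_le[OF m]) simp
    have "norm ((\<integral>x. f (U n x) \<partial>M) - (\<integral>x. f (W x) \<partial>N)) < e" if "n \<ge> n0" for n
      using 1[of n] 2 n0[OF that] unfolding real_norm_def by linarith
    then show "\<exists>no. \<forall>n\<ge>no. norm ((\<integral>x. f (U n x) \<partial>M) - (\<integral>x. f (W x) \<partial>N)) < e" by blast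
  qed
  then show "(\<lambda>n. integral\<^sup>L (distr M borel (U n)) (cts_step a b)) \<longlonglongrightarrow> integral\<^sup>L (distr N borel W) (cts_step a b)"
    unfolding f_def[symmetric] using U(1) W(1) by (simp add: integral_distr)
qed

text \<open>The Laplace transform at k is the k-th moment of exp(-V), a variable in [0,1], so
  exp(-V) converges weakly. The characteristic function of V is the expectation of a bounded
  function of exp(-V), recovered through the logarithm; it may be discontinuous only on
  (-\<infinity>, 0], which the limit law does not charge.\<close>

lemma laplace_imp_char:
  fixes V :: "nat \<Rightarrow> 'a \<Rightarrow> real" and W :: "'b \<Rightarrow> real"
  assumes M: "prob_space M" and N: "prob_space N"
    and V: "\<And>n. V n \<in> borel_measurable M" "\<And>n. AE x in M. 0 \<le> V n x"
    and W: "W \<in> borel_measurable N" "AE x in N. 0 \<le> W x"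
    and lap: "\<And>k. (\<lambda>n. \<integral>x. exp (- real k * V n x) \<partial>M) \<longlonglongrightarrow> (\<integral>x. exp (- real k * W x) \<partial>N)"
  shows "(\<lambda>n. char (distr M borel (V n)) t) \<longlonglongrightarrow> char (distr N borel W) t"
proof -
  interpret M: prob_space M by fact
  interpret N: prob_space N by fact
  note [measurable] = V(1) W(1)
  have e: "exp (- y) ^ k = exp (- real k * y)" for y :: real and k by (simp add: exp_of_nat_mult[symmetric])
  have w: "weak_conv_m (\<lambda>n. distr M borel (\<lambda>x. exp (- V n x))) (distr N borel (\<lambda>x. exp (- W x)))"
  proof (rule moments_01_imp_weak_conv[OF M N])
    show "(\<lambda>n. \<integral>x. exp (- V n x) ^ k \<partial>M) \<longlonglongrightarrow> (\<integral>x. exp (- W x) ^ k \<partial>N)" for k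
      unfolding e by (rule lap)
  qed (use V(2) W(2) in auto)
  define f where "f u = iexp (t * (- ln u))" for u
  have [measurable]: "f \<in> borel_measurable borel" unfolding f_def by measurable
  have "isCont f u" if "u > 0" for u
    unfolding f_def using that by (intro continuous_intros) auto
  then have sub: "{u. \<not> isCont f u} \<subseteq> {..0}" by (force simp: not_le[symmetric])
  have "emeasure (distr N borel (\<lambda>x. exp (- W x))) {..0} = 0"
  proof -
    have "(\<lambda>x. exp (- W x)) -` {..0} \<inter> space N = {}" by (auto simp: not_le)
    then show ?thesis by (subst emeasure_distr) auto
  qed
  then have null: "emeasure (distr N borel (\<lambda>x. exp (- W x))) {u. \<not> isCont f u} = 0"
    using emeasure_mono[OF sub, of "distr N borel (\<lambda>x. exp (- W x))"] by simp
  have "(\<lambda>n. integral\<^sup>L (distr M borel (\<lambda>x. exp (- V n x))) f) \<longlonglongrightarrow> integral\<^sup>L (distr N borel (\<lambda>x. exp (- W x))) f"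
  proof (rule weak_conv_imp_bdd_ae_continuous_conv[OF _ _ w])
    show "real_distribution (distr M borel (\<lambda>x. exp (- V n x)))" for n by (rule M.real_distribution_distr) measurable
    show "real_distribution (distr N borel (\<lambda>x. exp (- W x)))" by (rule N.real_distribution_distr) measurable
    show "emeasure (distr N borel (\<lambda>x. exp (- W x))) {x. \<not> isCont f x} = 0" by (rule null)
    show "norm (f x) \<le> 1" for x by (simp add: f_def)
  qed measurable
  then show ?thesis
    unfolding char_def by (simp add: integral_distr f_def)
qed

lemma norm_iexp_diff_le: "norm (iexp x - iexp y) \<le> \<bar>x - y\<bar>"
proof -
  have "iexp x - iexp y = iexp y * (iexp (x - y) - 1)"
    by (simp add: algebra_simps flip: exp_add)
  then have "norm (iexp x - iexp y) = norm (iexp (x - y) - 1)" by (simp add: norm_mult)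
  also have "\<dots> \<le> \<bar>x - y\<bar>" using iexp_approx1[of "x - y" 0] by simp
  finally show ?thesis .
qed

text \<open>Characteristic functions at t differ by at most |t| times the L1 distance, so the limit
  for \<open>B\<close> transfers to \<open>A\<close> before the continuity theorem is
  applied.\<close>

lemma weak_conv_of_L1_close:
  fixes A B :: "nat \<Rightarrow> 'a \<Rightarrow> real" and W :: "'b \<Rightarrow> real"
  assumes M: "prob_space M" and N: "prob_space N"
    and A: "\<And>n. A n \<in> borel_measurable M" and W: "W \<in> borel_measurable N"
    and B: "\<And>n. B n \<in> borel_measurable M"
    and close: "(\<lambda>n. \<integral>x. \<bar>A n x - B n x\<bar> \<partial>M) \<longlonglongrightarrow> 0" and int: "\<And>n. integrable M (\<lambda>x. A n x - B n x)"
    and char: "\<And>t. (\<lambda>n. char (distr M borel (B n)) t) \<longlonglongrightarrow> char (distr N borel W) t"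
  shows "weak_conv_m (\<lambda>n. distr M borel (A n)) (distr N borel W)"
proof (rule levy_continuity)
  interpret M: prob_space M by fact
  interpret N: prob_space N by fact
  note [measurable] = A B W
  show "real_distribution (distr M borel (A n))" for n by (rule M.real_distribution_distr) measurable
  show "real_distribution (distr N borel W)" by (rule N.real_distribution_distr) measurable
  fix t
  have bd: "norm (char (distr M borel (A n)) t - char (distr M borel (B n)) t) \<le> \<bar>t\<bar> * (\<integral>x. \<bar>A n x - B n x\<bar> \<partial>M)" for n
  proof -
    have i: "integrable M (\<lambda>x. iexp (t * A n x))" "integrable M (\<lambda>x. iexp (t * B n x))"
      by (intro M.integrable_iexp; simp)+
    have "char (distr M borel (A n)) t - char (distr M borel (B n)) t = (\<integral>x. iexp (t * A n x) - iexp (t * B n x) \<partial>M)"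
      using i by (simp add: char_def integral_distr)
    also have "norm \<dots> \<le> (\<integral>x. norm (iexp (t * A n x) - iexp (t * B n x)) \<partial>M)" by (rule integral_norm_bound)
    also have "\<dots> \<le> (\<integral>x. \<bar>t\<bar> * \<bar>A n x - B n x\<bar> \<partial>M)"
    proof (rule integral_mono)
      show "norm (iexp (t * A n x) - iexp (t * B n x)) \<le> \<bar>t\<bar> * \<bar>A n x - B n x\<bar>" for x
        using norm_iexp_diff_le[of "t * A n x" "t * B n x"] by (simp add: abs_mult right_diff_distrib[symmetric])
    qed (use i int in auto)
    finally show ?thesis by simp
  qed
  have "(\<lambda>n. \<bar>t\<bar> * (\<integral>x. \<bar>A n x - B n x\<bar> \<partial>M)) \<longlonglongrightarrow> 0"
    using tendsto_mult_left[OF close, of "\<bar>t\<bar>"] by simp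
  then have "(\<lambda>n. char (distr M borel (A n)) t - char (distr M borel (B n)) t) \<longlonglongrightarrow> 0"
    by (rule Lim_null_comparison[rotated]) (use bd in auto)
  from tendsto_add[OF this char[of t]] show "(\<lambda>n. char (distr M borel (A n)) t) \<longlonglongrightarrow> char (distr N borel W) t" by simp
qed

lemma char_affine:
  assumes "V \<in> borel_measurable M"
  shows "char (distr M borel (\<lambda>x. c * (V x - d))) t = iexp (- t * c * d) * char (distr M borel V) (t * c)"
proof -
  note [measurable] = assms
  have e: "iexp (t * (c * (v - d))) = iexp (- t * c * d) * iexp (t * c * v)" for v
    by (simp add: algebra_simps flip: exp_add)
  have "char (distr M borel (\<lambda>x. c * (V x - d))) t = (\<integral>x. iexp (t * (c * (V x - d))) \<partial>M)"
    by (simp add: char_def integral_distr)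
  also have "\<dots> = iexp (- t * c * d) * (\<integral>x. iexp (t * c * V x) \<partial>M)"
    unfolding e by (rule integral_mult_right_zero)
  also have "(\<integral>x. iexp (t * c * V x) \<partial>M) = char (distr M borel V) (t * c)"
    by (simp add: char_def integral_distr)
  finally show ?thesis .
qed

section \<open>I.i.d. sequences and the one-dimensional central limit theorem\<close>

locale iid_seq = prob_space M for M :: "'a measure" +
  fixes P :: "nat \<Rightarrow> 'a \<Rightarrow> 'b" and \<mu> :: "'b measure"
  assumes indep: "indep_vars (\<lambda>_. \<mu>) P {1..}"
    and distr: "\<And>i. i \<ge> 1 \<Longrightarrow> distr M \<mu> (P i) = \<mu>"
begin

lemma rv [measurable]: "i \<ge> 1 \<Longrightarrow> P i \<in> M \<rightarrow>\<^sub>M \<mu>"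
  using indep by (auto simp: indep_vars_def)

lemma rv_Suc [measurable]: "P (Suc i) \<in> M \<rightarrow>\<^sub>M \<mu>"
  by (rule rv) simp

lemma prob_space_law: "prob_space \<mu>"
  using prob_space_distr[OF rv, of 1] distr[of 1] by simp

lemma expectation_comp:
  fixes f :: "'b \<Rightarrow> real"
  assumes [measurable]: "f \<in> borel_measurable \<mu>" and i: "i \<ge> 1"
  shows "expectation (\<lambda>x. f (P i x)) = (\<integral>y. f y \<partial>\<mu>)"
  using integral_distr[OF rv[OF i], of f] distr[OF i] by simp

lemma AE_comp:
  assumes i: "i \<ge> 1" and ae: "AE y in \<mu>. Q y"
  shows "AE x in M. Q (P i x)"
proof -
  have "AE y in distr M \<mu> (P i). Q y" unfolding distr[OF i] by (rule ae)
  then show ?thesis by (rule AE_distrD[OF rv[OF i]])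
qed

text \<open>The sample starts at index 1, the central limit theorem at index 0; this shifts the
  independence statement.\<close>

lemma indep_comp_Suc:
  assumes [measurable]: "f \<in> borel_measurable \<mu>"
  shows "indep_vars (\<lambda>_. borel) (\<lambda>i x. f (P (Suc i) x) :: real) UNIV"
proof -
  have "indep_vars (\<lambda>_. borel) (\<lambda>i x. f (P i x)) {1..}"
    by (rule indep_vars_compose2[OF indep]) measurable
  then have ind: "indep_sets (\<lambda>i. {(\<lambda>x. f (P i x)) -` A \<inter> space M | A. A \<in> sets borel}) {1..}"
    by (simp add: indep_vars_def2)
  have "indep_sets (\<lambda>i. {(\<lambda>x. f (P (Suc i) x)) -` A \<inter> space M | A. A \<in> sets borel}) UNIV"
  proof (rule indep_setsI)
    fix i show "{(\<lambda>x. f (P (Suc i) x)) -` A \<inter> space M | A. A \<in> sets borel} \<subseteq> events"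
      by (auto intro!: measurable_sets[where A=borel])
  next
    fix A J assume J: "J \<noteq> {}" "finite J"
      and A: "\<forall>j\<in>J. A j \<in> {(\<lambda>x. f (P (Suc j) x)) -` A \<inter> space M | A. A \<in> sets borel}"
    have "prob (\<Inter>j\<in>Suc ` J. A (j - 1)) = (\<Prod>j\<in>Suc ` J. prob (A (j - 1)))"
      by (rule indep_setsD[OF ind]) (use J A in auto)
    then show "prob (\<Inter>j\<in>J. A j) = (\<Prod>j\<in>J. prob (A j))"
      by (simp add: prod.reindex)
  qed
  then show ?thesis by (simp add: indep_vars_def2)
qed

text \<open>Dividing by sqrt n only, the variance moves into the exponent and may be zero. That case
  is kept because the result is applied to linear combinations whose coefficients may all
  vanish.\<close>

lemma char_clt:
  fixes Q :: "'b \<Rightarrow> real"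
  assumes Q: "Q \<in> borel_measurable \<mu>" "\<And>x. \<bar>Q x\<bar> \<le> C" and mean: "(\<integral>y. Q y \<partial>\<mu>) = 0"
  shows "(\<lambda>n. \<integral>x. iexp ((\<Sum>i\<in>{1..n}. Q (P i x)) / sqrt (real n)) \<partial>M)
    \<longlonglongrightarrow> exp (- (\<integral>y. (Q y)\<^sup>2 \<partial>\<mu>) / 2)"
proof -
  interpret mu: prob_space \<mu> by (rule prob_space_law)
  note [measurable] = Q(1)
  define v where "v = (\<integral>y. (Q y)\<^sup>2 \<partial>\<mu>)"
  have Q2: "integrable \<mu> (\<lambda>y. (Q y)\<^sup>2)"
  proof (rule mu.integrable_const_bound[where B="C\<^sup>2"])
    show "AE x in \<mu>. norm ((Q x)\<^sup>2) \<le> C\<^sup>2"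
      using Q(2) by (auto intro!: AE_I2 simp: abs_le_square_iff[symmetric] intro: order_trans[OF Q(2)])
  qed measurable
  have v0: "v \<ge> 0" unfolding v_def by simp
  have sh: "(\<Sum>i\<in>{1..n}. Q (P i x)) = (\<Sum>i<n. Q (P (Suc i) x))" for n x
    by (rule sum.reindex_bij_witness[of _ Suc "\<lambda>k. k - 1"]) auto
  show ?thesis
  proof (cases "v = 0")
    case True
    then have "AE y in \<mu>. (Q y)\<^sup>2 = 0" using integral_nonneg_eq_0_iff_AE[OF Q2] by (simp add: v_def)
    then have "AE y in \<mu>. Q y = 0" by simp
    then have "AE x in M. Q (P (Suc i) x) = 0" for i by (intro AE_comp) auto
    then have "AE x in M. \<forall>i. Q (P (Suc i) x) = 0" by (simp add: AE_all_countable)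
    then have "(\<integral>x. iexp ((\<Sum>i\<in>{1..n}. Q (P i x)) / sqrt (real n)) \<partial>M) = (\<integral>x. 1 \<partial>M)" for n
      unfolding sh by (intro integral_cong_AE) (auto elim!: eventually_mono)
    then show ?thesis using True by (simp add: prob_space v_def)
  next
    case False
    define \<sigma> where "\<sigma> = sqrt v"
    have \<sigma>: "\<sigma> > 0" "\<sigma>\<^sup>2 = v" using False v0 by (auto simp: \<sigma>_def)
    have m: "expectation (\<lambda>x. Q (P (Suc i) x)) = 0" for i using mean by (subst expectation_comp) auto
    have "weak_conv_m (\<lambda>n. distr M borel (\<lambda>x. (\<Sum>i<n. Q (P (Suc i) x)) / sqrt (real n * \<sigma>\<^sup>2))) std_normal_distribution"
    proof (rule central_limit_theorem_zero_mean[where \<mu>="distr \<mu> borel Q"])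
      show "indep_vars (\<lambda>i. borel) (\<lambda>i x. Q (P (Suc i) x)) UNIV" by (rule indep_comp_Suc) measurable
      show "integrable M (\<lambda>x. (Q (P (Suc n) x))\<^sup>2)" for n
        using integrable_distr[OF rv_Suc, of n "\<lambda>y. (Q y)\<^sup>2"] Q2 distr[of "Suc n"] by simp
      show "variance (\<lambda>x. Q (P (Suc n) x)) = \<sigma>\<^sup>2" for n
        unfolding m \<sigma>(2) v_def using expectation_comp[of "\<lambda>y. (Q y)\<^sup>2" "Suc n"] by simp
      show "distr M borel (\<lambda>x. Q (P (Suc n) x)) = distr \<mu> borel Q" for n
        using distr_distr[OF Q(1) rv_Suc, of n] distr[of "Suc n"] by (simp add: comp_def)
    qed (use m \<sigma> in auto)
    \<comment> \<open>Evaluating the characteristic function at \<sigma> undoes the division by the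
      standard deviation.\<close>
    from levy_continuity1[OF _ _ this, of \<sigma>]
    have "(\<lambda>n. char (distr M borel (\<lambda>x. (\<Sum>i<n. Q (P (Suc i) x)) / sqrt (real n * \<sigma>\<^sup>2))) \<sigma>) \<longlonglongrightarrow> char std_normal_distribution \<sigma>"
      by (simp add: real_distribution_distr real_dist_normal_dist)
    moreover have "char (distr M borel (\<lambda>x. (\<Sum>i<n. Q (P (Suc i) x)) / sqrt (real n * \<sigma>\<^sup>2))) \<sigma> =
      (\<integral>x. iexp ((\<Sum>i\<in>{1..n}. Q (P i x)) / sqrt (real n)) \<partial>M)" for n
      unfolding sh using \<sigma>(1) by (simp add: char_def integral_distr real_sqrt_mult)
    ultimately show ?thesis using \<sigma>(2) by (simp add: char_std_normal_distribution v_def)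
  qed
qed

end

subsection \<open>Sums of squares\<close>

interpretation std_normal: prob_space std_normal_distribution
  using real_dist_normal_dist by (simp add: real_distribution_def)

text \<open>The Gaussian characteristic function read backwards; the factor sqrt(2w) compensates the
  1/2 in its exponent.\<close>

lemma exp_neg_square_eq_char:
  assumes "0 \<le> w"
  shows "complex_of_real (exp (- w * s\<^sup>2)) = (\<integral>y. iexp (sqrt (2 * w) * s * y) \<partial>std_normal_distribution)"
proof -
  have "char std_normal_distribution (sqrt (2 * w) * s) = complex_of_real (exp (- ((sqrt (2 * w) * s)\<^sup>2) / 2))"
    by (simp add: char_std_normal_distribution)
  also have "(sqrt (2 * w) * s)\<^sup>2 = 2 * w * s\<^sup>2" using assms by (simp add: power_mult_distrib)
  finally show ?thesis by (simp add: char_def)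
qed

lemma exp_neg_sum_squares_eq_integral:
  fixes w s :: "'j \<Rightarrow> real"
  assumes J: "finite J" and w: "\<And>j. j \<in> J \<Longrightarrow> 0 \<le> w j"
  shows "complex_of_real (exp (- (\<Sum>j\<in>J. w j * (s j)\<^sup>2))) =
    (\<integral>g. iexp (\<Sum>j\<in>J. sqrt (2 * w j) * s j * g j) \<partial>PiM J (\<lambda>_. std_normal_distribution))"
proof -
  interpret product_prob_space "\<lambda>_::'j. std_normal_distribution" J by unfold_locales
  have "complex_of_real (exp (- (\<Sum>j\<in>J. w j * (s j)\<^sup>2))) = (\<Prod>j\<in>J. complex_of_real (exp (- w j * (s j)\<^sup>2)))"
    using J by (simp add: exp_sum flip: sum_negf)
  also have "\<dots> = (\<Prod>j\<in>J. \<integral>y. iexp (sqrt (2 * w j) * s j * y) \<partial>std_normal_distribution)"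
    by (intro prod.cong refl exp_neg_square_eq_char w)
  also have "\<dots> = (\<integral>g. (\<Prod>j\<in>J. iexp (sqrt (2 * w j) * s j * g j)) \<partial>PiM J (\<lambda>_. std_normal_distribution))"
    by (rule product_integral_prod[symmetric, OF J]) (intro std_normal.integrable_iexp; simp)
  also have "\<dots> = (\<integral>g. iexp (\<Sum>j\<in>J. sqrt (2 * w j) * s j * g j) \<partial>PiM J (\<lambda>_. std_normal_distribution))"
    using J by (simp add: exp_sum sum_distrib_left)
  finally show ?thesis .
qed

lemma prob_space_PiM_std_normal: "prob_space (PiM J (\<lambda>_::'j. std_normal_distribution))"
proof -
  interpret product_prob_space "\<lambda>_::'j. std_normal_distribution" J by unfold_locales
  show ?thesis by (rule prob_space_axioms)
qed

lemma integral_sum_squares_orthonormal: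
  fixes \<phi> :: "'j \<Rightarrow> 'b \<Rightarrow> real"
  assumes J: "finite J" and int: "\<And>i j. i \<in> J \<Longrightarrow> j \<in> J \<Longrightarrow> integrable \<mu> (\<lambda>y. \<phi> i y * \<phi> j y)"
    and on: "\<And>i j. i \<in> J \<Longrightarrow> j \<in> J \<Longrightarrow> (\<integral>y. \<phi> i y * \<phi> j y \<partial>\<mu>) = of_bool (i = j)"
  shows "(\<integral>y. (\<Sum>j\<in>J. a j * \<phi> j y)\<^sup>2 \<partial>\<mu>) = (\<Sum>j\<in>J. (a j)\<^sup>2)"
proof -
  have "(\<integral>y. (\<Sum>j\<in>J. a j * \<phi> j y)\<^sup>2 \<partial>\<mu>) = (\<integral>y. (\<Sum>i\<in>J. \<Sum>j\<in>J. (a i * a j) * (\<phi> i y * \<phi> j y)) \<partial>\<mu>)"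
    by (simp add: power2_eq_square sum_product mult_ac)
  also have "\<dots> = (\<Sum>i\<in>J. \<Sum>j\<in>J. (a i * a j) * (\<integral>y. \<phi> i y * \<phi> j y \<partial>\<mu>))"
    using int by (subst Bochner_Integration.integral_sum, intro Bochner_Integration.integrable_sum integrable_mult_right, simp)
      (intro sum.cong refl, subst Bochner_Integration.integral_sum, intro integrable_mult_right, simp_all)
  also have "\<dots> = (\<Sum>i\<in>J. \<Sum>j\<in>J. if i = j then (a i)\<^sup>2 else 0)"
    by (intro sum.cong refl) (simp add: on power2_eq_square)
  also have "\<dots> = (\<Sum>j\<in>J. (a j)\<^sup>2)" using J by simp
  finally show ?thesis .
qed

lemma integrable_le_bound:
  fixes f :: "'b \<Rightarrow> real"
  assumes "prob_space \<mu>" "f \<in> borel_measurable \<mu>" "\<And>y. \<bar>f y\<bar> \<le> C"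
  shows "integrable \<mu> f"
proof -
  interpret prob_space \<mu> by fact
  show ?thesis using assms by (intro integrable_const_bound[where B=C]) auto
qed

lemma abs_mult_le: "\<bar>a\<bar> \<le> C \<Longrightarrow> \<bar>b\<bar> \<le> D \<Longrightarrow> \<bar>a * b\<bar> \<le> C * (D :: real)"
  unfolding abs_mult by (intro mult_mono) auto

context iid_seq begin

text \<open>
  The Laplace transform of a weighted sum of squares is a Gaussian mixture of one-dimensional
  characteristic functions, so the one-dimensional central limit theorem suffices.
\<close>

lemma laplace_sum_squares:
  fixes \<phi> :: "'j \<Rightarrow> 'b \<Rightarrow> real"
  assumes J: "finite J" and \<phi>: "\<And>j. \<phi> j \<in> borel_measurable \<mu>" "\<And>j y. \<bar>\<phi> j y\<bar> \<le> C"
    and mean: "\<And>j. j \<in> J \<Longrightarrow> (\<integral>y. \<phi> j y \<partial>\<mu>) = 0"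
    and on: "\<And>i j. i \<in> J \<Longrightarrow> j \<in> J \<Longrightarrow> (\<integral>y. \<phi> i y * \<phi> j y \<partial>\<mu>) = of_bool (i = j)"
    and w: "\<And>j. j \<in> J \<Longrightarrow> 0 \<le> w j"
  shows "(\<lambda>n. \<integral>x. exp (- (\<Sum>j\<in>J. w j * ((\<Sum>i\<in>{1..n}. \<phi> j (P i x)) / sqrt (real n))\<^sup>2)) \<partial>M)
    \<longlonglongrightarrow> (\<Prod>j\<in>J. \<integral>y. exp (- w j * y\<^sup>2) \<partial>std_normal_distribution)"
proof -
  let ?N = "PiM J (\<lambda>_. std_normal_distribution)"
  interpret N: prob_space ?N by (rule prob_space_PiM_std_normal)
  interpret MN: pair_prob_space M ?N ..
  interpret mu: prob_space \<mu> by (rule prob_space_law)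
  note [measurable] = \<phi>(1)
  define S where "S n j x = (\<Sum>i\<in>{1..n}. \<phi> j (P i x)) / sqrt (real n)" for n j x
  have S_meas [measurable]: "S n j \<in> borel_measurable M" for n j
    unfolding S_def by (intro borel_measurable_divide borel_measurable_sum) auto
  \<comment> \<open>For fixed Gaussian weights g the whole exponent is a normalised sum of one real
    function of the sample points, with mean 0 and variance 2 \<Sum> w_j g_j^2 by
    orthonormality.\<close>
  define Q where "Q g y = (\<Sum>j\<in>J. (sqrt (2 * w j) * g j) * \<phi> j y)" for g y
  have SQ: "(\<Sum>j\<in>J. sqrt (2 * w j) * S n j x * g j) = (\<Sum>i\<in>{1..n}. Q g (P i x)) / sqrt (real n)" for n g x
  proof -
    have "(\<Sum>i\<in>{1..n}. Q g (P i x)) = (\<Sum>j\<in>J. \<Sum>i\<in>{1..n}. (sqrt (2 * w j) * g j) * \<phi> j (P i x))"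
      unfolding Q_def by (rule sum.swap)
    then show ?thesis by (simp add: S_def sum_divide_distrib sum_distrib_left mult_ac)
  qed
  have Qm: "Q g \<in> borel_measurable \<mu>" for g unfolding Q_def by measurable
  have Qb: "\<bar>Q g y\<bar> \<le> (\<Sum>j\<in>J. \<bar>sqrt (2 * w j) * g j\<bar> * C)" for g y
    unfolding Q_def by (rule order_trans[OF sum_abs]) (auto intro!: sum_mono mult_left_mono \<phi>(2) simp: abs_mult)
  have int1: "integrable \<mu> (\<phi> j)" for j by (rule integrable_le_bound[OF prob_space_law \<phi>])
  have int2: "integrable \<mu> (\<lambda>y. \<phi> i y * \<phi> j y)" for i j
    by (rule integrable_le_bound[OF prob_space_law _ abs_mult_le[OF \<phi>(2) \<phi>(2)]]) measurable
  have Q0: "(\<integral>y. Q g y \<partial>\<mu>) = 0" for g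
    unfolding Q_def using int1 by (subst Bochner_Integration.integral_sum) (auto simp: mean)
  have Qv: "(\<integral>y. (Q g y)\<^sup>2 \<partial>\<mu>) = 2 * (\<Sum>j\<in>J. w j * (g j)\<^sup>2)" for g
    unfolding Q_def using w
    by (subst integral_sum_squares_orthonormal[OF J int2 on]) (simp_all add: power_mult_distrib sum_distrib_left mult_ac)
  have meas: "(\<lambda>x. iexp (\<Sum>j\<in>J. sqrt (2 * w j) * S n j (fst x) * snd x j)) \<in> borel_measurable (M \<Otimes>\<^sub>M ?N)" for n
  proof -
    have "(\<lambda>x. \<Sum>j\<in>J. sqrt (2 * w j) * S n j (fst x) * snd x j) \<in> borel_measurable (M \<Otimes>\<^sub>M ?N)"
    proof (intro borel_measurable_sum borel_measurable_times borel_measurable_const)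
      fix j assume j: "j \<in> J"
      show "(\<lambda>x. S n j (fst x)) \<in> borel_measurable (M \<Otimes>\<^sub>M ?N)" by measurable
      have "(\<lambda>g. g j) \<in> ?N \<rightarrow>\<^sub>M std_normal_distribution" using j by (rule measurable_component_singleton)
      then have "(\<lambda>g. g j) \<in> borel_measurable ?N" by (simp add: measurable_cong_sets[OF refl, of std_normal_distribution borel])
      then show "(\<lambda>x. snd x j) \<in> borel_measurable (M \<Otimes>\<^sub>M ?N)" by (rule measurable_compose[OF measurable_snd])
    qed
    then show ?thesis by measurable
  qed
  have key: "complex_of_real (\<integral>x. exp (- (\<Sum>j\<in>J. w j * (S n j x)\<^sup>2)) \<partial>M) =
    (\<integral>g. (\<integral>x. iexp ((\<Sum>i\<in>{1..n}. Q g (P i x)) / sqrt (real n)) \<partial>M) \<partial>?N)" for n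
  proof -
    have "complex_of_real (\<integral>x. exp (- (\<Sum>j\<in>J. w j * (S n j x)\<^sup>2)) \<partial>M)
      = (\<integral>x. complex_of_real (exp (- (\<Sum>j\<in>J. w j * (S n j x)\<^sup>2))) \<partial>M)" by simp
    also have "\<dots> = (\<integral>x. (\<integral>g. iexp (\<Sum>j\<in>J. sqrt (2 * w j) * S n j x * g j) \<partial>?N) \<partial>M)"
      using exp_neg_sum_squares_eq_integral[OF J w, where s="\<lambda>j. S n j x" for x] by simp
    also have "\<dots> = (\<integral>g. (\<integral>x. iexp (\<Sum>j\<in>J. sqrt (2 * w j) * S n j x * g j) \<partial>M) \<partial>?N)"
    proof (rule MN.Fubini_integral[symmetric])
      have "integrable (M \<Otimes>\<^sub>M ?N) (\<lambda>x. iexp (\<Sum>j\<in>J. sqrt (2 * w j) * S n j (fst x) * snd x j))"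
        by (rule MN.P.integrable_const_bound[where B=1]) (auto intro: meas)
      then show "integrable (M \<Otimes>\<^sub>M ?N) (\<lambda>(x, g). iexp (\<Sum>j\<in>J. sqrt (2 * w j) * S n j x * g j))"
        by (simp add: split_def)
    qed
    finally show ?thesis by (simp only: SQ)
  qed
  \<comment> \<open>The central limit theorem holds for each fixed g, and dominated convergence
    carries it through the Gaussian mixture. The limit integrand is a product over the coordinates
    of g.\<close>
  have "(\<lambda>n. \<integral>g. (\<integral>x. iexp ((\<Sum>i\<in>{1..n}. Q g (P i x)) / sqrt (real n)) \<partial>M) \<partial>?N)
    \<longlonglongrightarrow> (\<integral>g. complex_of_real (exp (- (\<Sum>j\<in>J. w j * (g j)\<^sup>2))) \<partial>?N)"
  proof (rule integral_dominated_convergence[where w="\<lambda>_. 1"])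
    show "AE g in ?N. (\<lambda>n. \<integral>x. iexp ((\<Sum>i\<in>{1..n}. Q g (P i x)) / sqrt (real n)) \<partial>M)
      \<longlonglongrightarrow> complex_of_real (exp (- (\<Sum>j\<in>J. w j * (g j)\<^sup>2)))"
      using char_clt[OF Qm Qb Q0] by (simp add: Qv)
    show "AE g in ?N. norm (\<integral>x. iexp ((\<Sum>i\<in>{1..n}. Q g (P i x)) / sqrt (real n)) \<partial>M) \<le> 1" for n
    proof (rule AE_I2)
      fix g
      have "norm (\<integral>x. iexp ((\<Sum>i\<in>{1..n}. Q g (P i x)) / sqrt (real n)) \<partial>M)
        \<le> (\<integral>x. norm (iexp ((\<Sum>i\<in>{1..n}. Q g (P i x)) / sqrt (real n))) \<partial>M)" by (rule integral_norm_bound)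
      then show "norm (\<integral>x. iexp ((\<Sum>i\<in>{1..n}. Q g (P i x)) / sqrt (real n)) \<partial>M) \<le> 1" by (simp add: prob_space)
    qed
    show "(\<lambda>g. \<integral>x. iexp ((\<Sum>i\<in>{1..n}. Q g (P i x)) / sqrt (real n)) \<partial>M) \<in> borel_measurable ?N" for n
    proof -
      have "(\<lambda>(g, x). iexp (\<Sum>j\<in>J. sqrt (2 * w j) * S n j x * g j)) \<in> borel_measurable (?N \<Otimes>\<^sub>M M)"
        using measurable_compose[OF measurable_pair_swap' meas[of n]] by (simp add: split_def)
      then show ?thesis unfolding SQ[symmetric] by (rule borel_measurable_lebesgue_integral)
    qed
    have gm: "(\<lambda>g. g j) \<in> borel_measurable ?N" if "j \<in> J" for j
      using measurable_component_singleton[OF that, of "\<lambda>_. std_normal_distribution"]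
      by (simp add: measurable_cong_sets[OF refl, of std_normal_distribution borel])
    have "(\<lambda>g. \<Sum>j\<in>J. w j * (g j)\<^sup>2) \<in> borel_measurable ?N"
      by (intro borel_measurable_sum borel_measurable_times borel_measurable_power gm) auto
    then show "(\<lambda>g. complex_of_real (exp (- (\<Sum>j\<in>J. w j * (g j)\<^sup>2)))) \<in> borel_measurable ?N" by measurable
  qed simp
  also have "(\<integral>g. complex_of_real (exp (- (\<Sum>j\<in>J. w j * (g j)\<^sup>2))) \<partial>?N) =
    complex_of_real (\<integral>g. (\<Prod>j\<in>J. exp (- w j * (g j)\<^sup>2)) \<partial>?N)"
  proof -
    have "exp (- (\<Sum>j\<in>J. w j * (g j)\<^sup>2)) = (\<Prod>j\<in>J. exp (- w j * (g j)\<^sup>2))" for g :: "'j \<Rightarrow> real"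
      using J by (simp add: exp_sum flip: sum_negf)
    then show ?thesis by (simp only: integral_complex_of_real)
  qed
  also have "(\<integral>g. (\<Prod>j\<in>J. exp (- w j * (g j)\<^sup>2)) \<partial>?N) = (\<Prod>j\<in>J. \<integral>y. exp (- w j * y\<^sup>2) \<partial>std_normal_distribution)"
  proof -
    interpret product_prob_space "\<lambda>_::'j. std_normal_distribution" J by unfold_locales
    show ?thesis
    proof (rule product_integral_prod[OF J])
      fix j assume "j \<in> J"
      then show "integrable std_normal_distribution (\<lambda>y. exp (- w j * y\<^sup>2))"
        using w by (intro std_normal.integrable_const_bound[where B=1]) auto
    qed
  qed
  finally have "(\<lambda>n. complex_of_real (\<integral>x. exp (- (\<Sum>j\<in>J. w j * (S n j x)\<^sup>2)) \<partial>M))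
    \<longlonglongrightarrow> complex_of_real (\<Prod>j\<in>J. \<integral>y. exp (- w j * y\<^sup>2) \<partial>std_normal_distribution)"
    unfolding key .
  then show ?thesis unfolding tendsto_of_real_iff S_def .
qed

text \<open>Cross terms vanish by independence and zero mean.\<close>

lemma second_moment_sum:
  fixes q :: "'b \<Rightarrow> real"
  assumes q: "q \<in> borel_measurable \<mu>" "\<And>y. \<bar>q y\<bar> \<le> C" and mean: "(\<integral>y. q y \<partial>\<mu>) = 0"
  shows "expectation (\<lambda>x. (\<Sum>i\<in>{1..n}. q (P i x))\<^sup>2) = real n * (\<integral>y. (q y)\<^sup>2 \<partial>\<mu>)"
proof -
  note [measurable] = q(1)
  have m: "(\<lambda>x. q (P i x)) \<in> borel_measurable M" if "i \<in> {1..n}" for i using that by auto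
  have int: "integrable M (\<lambda>x. q (P i x) * q (P j x))" if "i \<in> {1..n}" "j \<in> {1..n}" for i j
    by (rule integrable_le_bound[OF prob_space_axioms _ abs_mult_le[OF q(2) q(2)]]) (intro borel_measurable_times m that)
  have e: "expectation (\<lambda>x. q (P i x) * q (P j x)) = (if i = j then \<integral>y. (q y)\<^sup>2 \<partial>\<mu> else 0)"
    if ij: "i \<in> {1..n}" "j \<in> {1..n}" for i j
  proof (cases "i = j")
    case True
    have "expectation (\<lambda>x. (q (P i x))\<^sup>2) = (\<integral>y. (q y)\<^sup>2 \<partial>\<mu>)" using ij by (intro expectation_comp) auto
    then show ?thesis using True by (simp add: power2_eq_square)
  next
    case False
    have "indep_vars (\<lambda>_. borel) (\<lambda>i x. q (P i x)) {1..}"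
      by (rule indep_vars_compose2[OF indep]) measurable
    then have ind: "indep_vars (\<lambda>_. borel) (\<lambda>i x. q (P i x)) {i, j}" by (rule indep_vars_subset) (use ij in auto)
    have "integrable M (\<lambda>x. q (P l x))" if "l \<in> {i, j}" for l
      by (rule integrable_le_bound[OF prob_space_axioms m q(2)]) (use that ij in auto)
    with ind have "expectation (\<lambda>x. \<Prod>l\<in>{i, j}. q (P l x)) = (\<Prod>l\<in>{i, j}. expectation (\<lambda>x. q (P l x)))"
      by (intro indep_vars_lebesgue_integral) auto
    moreover have "expectation (\<lambda>x. q (P i x)) = 0" using expectation_comp[OF q(1), of i] ij mean by simp
    ultimately show ?thesis using False by simp
  qed
  have "expectation (\<lambda>x. (\<Sum>i\<in>{1..n}. q (P i x))\<^sup>2) = expectation (\<lambda>x. \<Sum>i\<in>{1..n}. \<Sum>j\<in>{1..n}. q (P i x) * q (P j x))"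
    by (simp add: power2_eq_square sum_product)
  also have "\<dots> = (\<Sum>i\<in>{1..n}. \<Sum>j\<in>{1..n}. expectation (\<lambda>x. q (P i x) * q (P j x)))"
    using int by (subst Bochner_Integration.integral_sum, intro Bochner_Integration.integrable_sum, simp)
      (intro sum.cong refl Bochner_Integration.integral_sum, simp)
  also have "\<dots> = (\<Sum>i\<in>{1..n}. \<Sum>j\<in>{1..n}. if i = j then \<integral>y. (q y)\<^sup>2 \<partial>\<mu> else 0)"
    by (intro sum.cong refl e)
  also have "\<dots> = real n * (\<integral>y. (q y)\<^sup>2 \<partial>\<mu>)" by simp
  finally show ?thesis .
qed

end

text \<open>Integrates the pointwise bound 2|X| \<le> 1/r + r X^2, which is (r|X| - 1)^2 \<ge> 0
  divided by r, at r = sqrt n.\<close>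

lemma L1_le_of_L2:
  fixes X :: "'a \<Rightarrow> real"
  assumes "prob_space M" and int: "integrable M (\<lambda>x. (X x)\<^sup>2)" "integrable M X"
    and le: "(\<integral>x. (X x)\<^sup>2 \<partial>M) \<le> K / real n" and n: "n \<ge> 1"
  shows "(\<integral>x. \<bar>X x\<bar> \<partial>M) \<le> (1 + K) / (2 * sqrt (real n))"
proof -
  interpret prob_space M by fact
  define r where "r = sqrt (real n)"
  have r: "r > 0" "r\<^sup>2 = real n" using n by (auto simp: r_def)
  have pt: "\<bar>X x\<bar> \<le> (1 / r + r * (X x)\<^sup>2) / 2" for x
  proof -
    have "0 \<le> (r * \<bar>X x\<bar> - 1)\<^sup>2 / (2 * r)" using r by simp
    also have "\<dots> = (1 / r + r * (X x)\<^sup>2) / 2 - \<bar>X x\<bar>" using r by (simp add: power2_eq_square field_simps)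
    finally show ?thesis by simp
  qed
  have "(\<integral>x. \<bar>X x\<bar> \<partial>M) \<le> (\<integral>x. (1 / r + r * (X x)\<^sup>2) / 2 \<partial>M)"
    using int pt by (intro integral_mono) auto
  also have "\<dots> = (1 / r + r * (\<integral>x. (X x)\<^sup>2 \<partial>M)) / 2" using int by (simp add: prob_space)
  also have "\<dots> \<le> (1 / r + r * (K / real n)) / 2" using le r by (intro divide_right_mono add_left_mono mult_left_mono) auto
  also have "\<dots> = (1 + K) / (2 * r)" unfolding r(2)[symmetric] using r(1) by (simp add: power2_eq_square field_simps)
  finally show ?thesis by (simp add: r_def)
qed

text \<open>The limit variable is an iterated series, while the truncations run over squares. For
  nonnegative terms a large square contains enough of finitely many rows, and no square exceeds the
  iterated sum.\<close>

lemma double_sum_square_limit: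
  fixes a :: "nat \<Rightarrow> nat \<Rightarrow> real"
  assumes nonneg: "\<And>k l. 0 \<le> a k l" and inner: "\<And>k. summable (a k)" and outer: "summable (\<lambda>k. \<Sum>l. a k l)"
  shows "(\<lambda>K. \<Sum>k<K. \<Sum>l<K. a k l) \<longlonglongrightarrow> (\<Sum>k. \<Sum>l. a k l)"
proof -
  have le: "(\<Sum>l<K. a k l) \<le> (\<Sum>l. a k l)" for k K
    using inner nonneg by (intro sum_le_suminf) auto
  have pos: "0 \<le> (\<Sum>l. a k l)" for k using inner nonneg by (intro suminf_nonneg) auto
  show ?thesis
  proof (rule LIMSEQ_I)
    fix e :: real assume e: "e > 0"
    have lim: "(\<lambda>K. \<Sum>k<K. \<Sum>l. a k l) \<longlonglongrightarrow> (\<Sum>k. \<Sum>l. a k l)" by (rule summable_LIMSEQ[OF outer])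
    obtain K0 where K0: "\<bar>(\<Sum>k<K0. \<Sum>l. a k l) - (\<Sum>k. \<Sum>l. a k l)\<bar> < e / 2"
      using LIMSEQ_D[OF lim, of "e / 2"] e by auto
    have "(\<lambda>K. \<Sum>k<K0. \<Sum>l<K. a k l) \<longlonglongrightarrow> (\<Sum>k<K0. \<Sum>l. a k l)"
      by (intro tendsto_sum summable_LIMSEQ inner)
    then obtain K1 where K1: "\<And>K. K \<ge> K1 \<Longrightarrow> \<bar>(\<Sum>k<K0. \<Sum>l<K. a k l) - (\<Sum>k<K0. \<Sum>l. a k l)\<bar> < e / 2"
      using LIMSEQ_D[of _ _ "e / 2"] e by (metis half_gt_zero real_norm_def)
    have "norm ((\<Sum>k<K. \<Sum>l<K. a k l) - (\<Sum>k. \<Sum>l. a k l)) < e" if K: "K \<ge> max K0 K1" for K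
    proof -
      have "(\<Sum>k<K0. \<Sum>l<K. a k l) \<le> (\<Sum>k<K. \<Sum>l<K. a k l)"
        using K nonneg by (intro sum_mono2) (auto intro: sum_nonneg)
      moreover have "(\<Sum>k<K. \<Sum>l<K. a k l) \<le> (\<Sum>k<K. \<Sum>l. a k l)" by (intro sum_mono le)
      moreover have "(\<Sum>k<K. \<Sum>l. a k l) \<le> (\<Sum>k. \<Sum>l. a k l)" using pos by (intro sum_le_suminf outer) auto
      ultimately show ?thesis using K0 K1[of K] K unfolding real_norm_def by linarith
    qed
    then show "\<exists>no. \<forall>K\<ge>no. norm ((\<Sum>k<K. \<Sum>l<K. a k l) - (\<Sum>k. \<Sum>l. a k l)) < e" by blast
  qed
qed

text \<open>The approximation error depends on the truncation level K but not on n, which makes the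
  limits in n and K interchangeable.\<close>

lemma limit_interchange:
  fixes a :: "nat \<Rightarrow> nat \<Rightarrow> real"
  assumes a: "\<And>K. (\<lambda>n. a K n) \<longlonglongrightarrow> b K" and b: "b \<longlonglongrightarrow> B" and \<epsilon>: "\<epsilon> \<longlonglongrightarrow> 0"
    and close: "\<And>K n. n \<ge> 1 \<Longrightarrow> \<bar>c n - a K n\<bar> \<le> \<epsilon> K"
  shows "c \<longlonglongrightarrow> B"
proof (rule LIMSEQ_I)
  fix e :: real assume e: "e > 0"
  obtain K1 where K1: "\<And>K. K \<ge> K1 \<Longrightarrow> \<bar>b K - B\<bar> < e / 3" using LIMSEQ_D[OF b, of "e / 3"] e by auto
  obtain K2 where K2: "\<And>K. K \<ge> K2 \<Longrightarrow> \<bar>\<epsilon> K\<bar> < e / 3" using LIMSEQ_D[OF \<epsilon>, of "e / 3"] e by auto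
  define K where "K = max K1 K2"
  obtain n0 where n0: "\<And>n. n \<ge> n0 \<Longrightarrow> \<bar>a K n - b K\<bar> < e / 3" using LIMSEQ_D[OF a, of "e / 3" K] e by auto
  have "norm (c n - B) < e" if "n \<ge> max n0 1" for n
  proof -
    have "\<bar>b K - B\<bar> < e / 3" "\<bar>\<epsilon> K\<bar> < e / 3" by (rule K1 K2, simp add: K_def)+
    moreover have "\<bar>a K n - b K\<bar> < e / 3" "\<bar>c n - a K n\<bar> \<le> \<epsilon> K" using n0 close that by auto
    ultimately show ?thesis unfolding real_norm_def by linarith
  qed
  then show "\<exists>no. \<forall>n\<ge>no. norm (c n - B) < e" by blast
qed

subsection \<open>The V-statistic of the limit kernel\<close>

text \<open>For k \<ge> 1 these are the orthonormal eigenfunctions of \<open>cvm\<close> on [0,1].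
  The constant function is absent from the expansion, and for k = 0 the factor sqrt 2 would not be
  the right normalisation.\<close>

definition cosb :: "nat \<Rightarrow> real \<Rightarrow> real" where
  "cosb k x = sqrt 2 * cos (real k * pi * x)"

definition cosb2 :: "nat \<times> nat \<Rightarrow> real \<times> real \<Rightarrow> real" where
  "cosb2 j z = cosb (fst j) (fst z) * cosb (snd j) (snd z)"

text \<open>Eigenvalues of the product kernel: products of the eigenvalues 1/(pi k)^2 of the two
  factors.\<close>

definition eigval :: "nat \<times> nat \<Rightarrow> real" where
  "eigval j = 1 / (pi\<^sup>2 * (real (fst j))\<^sup>2) * (1 / (pi\<^sup>2 * (real (snd j))\<^sup>2))"

lemma integral_U01_FTC:
  fixes P p :: "real \<Rightarrow> real"
  assumes P: "\<And>x. (P has_real_derivative p x) (at x)" and p: "continuous_on UNIV p"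
  shows "(\<integral>x. p x \<partial>U01) = P 1 - P 0"
proof -
  have [measurable]: "p \<in> borel_measurable borel" using p by (rule borel_measurable_continuous_onI)
  have "AE x in U01. p x = indicator {0..1} x * p x"
    using AE_U01 by eventually_elim auto
  then have "(\<integral>x. p x \<partial>U01) = (\<integral>x. indicator {0..1} x * p x \<partial>U01)"
    by (intro integral_cong_AE) auto
  also have "\<dots> = P 1 - P 0" by (rule integral_U01_piece[OF _ _ _ P p]) auto
  finally show ?thesis .
qed

lemma integral_cos_U01:
  fixes a :: real
  assumes "a \<in> \<int>" "a \<noteq> 0"
  shows "(\<integral>x. cos (a * pi * x) \<partial>U01) = 0"
proof -
  have "sin (a * pi) = 0" using assms(1) by (simp add: sin_times_pi_eq_0)
  moreover have "(\<integral>x. cos (a * pi * x) \<partial>U01) = sin (a * pi * 1) / (a * pi) - sin (a * pi * 0) / (a * pi)"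
    using assms(2) by (intro integral_U01_FTC) (auto intro!: derivative_eq_intros continuous_intros)
  ultimately show ?thesis by simp
qed

lemma integrable_cos_U01: "integrable U01 (\<lambda>x. cos (a * pi * x))"
  by (rule integrable_U01_bounded[where B=1]) auto

lemma cosb_measurable [measurable]: "cosb k \<in> borel_measurable borel"
  unfolding cosb_def by measurable

lemma cosb_bound: "\<bar>cosb k x\<bar> \<le> 2"
proof -
  have "\<bar>cosb k x\<bar> \<le> sqrt 2 * 1" unfolding cosb_def abs_mult by (intro mult_mono) auto
  also have "\<dots> \<le> 2" using real_sqrt_le_mono[of 2 4] by simp
  finally show ?thesis .
qed

lemma integral_cosb: "k \<ge> 1 \<Longrightarrow> (\<integral>x. cosb k x \<partial>U01) = 0"
  unfolding cosb_def using integral_cos_U01[of "real k"] by simp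

lemma integral_cosb_cosb:
  assumes "k \<ge> 1" "l \<ge> 1"
  shows "(\<integral>x. cosb k x * cosb l x \<partial>U01) = of_bool (k = l)"
proof -
  have e: "cosb k x * cosb l x = cos ((real k - real l) * pi * x) + cos ((real k + real l) * pi * x)" for x
  proof -
    have "(real k - real l) * pi * x = real k * pi * x - real l * pi * x"
      "(real k + real l) * pi * x = real k * pi * x + real l * pi * x" by (auto simp: algebra_simps)
    then show ?thesis by (simp only: cos_add cos_diff) (simp add: cosb_def)
  qed
  have "(\<integral>x. cos ((real k + real l) * pi * x) \<partial>U01) = 0"
    using assms by (intro integral_cos_U01) auto
  moreover have "(\<integral>x. cos ((real k - real l) * pi * x) \<partial>U01) = of_bool (k = l)"
    using U01.prob_space by (cases "k = l") (auto intro!: integral_cos_U01)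
  ultimately show ?thesis unfolding e
    by (subst Bochner_Integration.integral_add[OF integrable_cos_U01 integrable_cos_U01]) simp
qed

lemma cosb2_measurable [measurable]: "cosb2 j \<in> borel_measurable U2"
  unfolding cosb2_def by measurable

lemma cosb2_bound: "\<bar>cosb2 j z\<bar> \<le> 2 * 2"
  unfolding cosb2_def by (rule abs_mult_le[OF cosb_bound cosb_bound])

lemma integrable_cosb: "integrable U01 (cosb k)" "integrable U01 (\<lambda>x. cosb k x * cosb l x)"
  by (rule integrable_U01_bounded[OF _ cosb_bound], measurable)
    (rule integrable_U01_bounded[OF _ abs_mult_le[OF cosb_bound cosb_bound]], measurable)

lemma integral_cosb2: "j \<in> {1..K} \<times> {1..K} \<Longrightarrow> (\<integral>z. cosb2 j z \<partial>U2) = 0"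
  unfolding cosb2_def by (subst U01_pair.integral_mult_pair[OF integrable_cosb(1) integrable_cosb(1)]) (auto simp: integral_cosb)

lemma integral_cosb2_cosb2:
  assumes "i \<in> {1..K} \<times> {1..K}" "j \<in> {1..K} \<times> {1..K}"
  shows "(\<integral>z. cosb2 i z * cosb2 j z \<partial>U2) = of_bool (i = j)"
proof -
  have "(\<integral>z. cosb2 i z * cosb2 j z \<partial>U2) =
    (\<integral>z. (cosb (fst i) (fst z) * cosb (fst j) (fst z)) * (cosb (snd i) (snd z) * cosb (snd j) (snd z)) \<partial>U2)"
    by (simp add: cosb2_def mult_ac)
  also have "\<dots> = of_bool (fst i = fst j) * of_bool (snd i = snd j)"
    using assms by (subst U01_pair.integral_mult_pair[OF integrable_cosb(2) integrable_cosb(2)])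
      (auto simp: integral_cosb_cosb mem_Times_iff)
  finally show ?thesis by (auto simp: prod_eq_iff of_bool_def)
qed

definition cvm_trunc :: "nat \<Rightarrow> real \<Rightarrow> real \<Rightarrow> real" where
  "cvm_trunc K u v = (\<Sum>k\<in>{1..K}. cosb k u * cosb k v / (pi\<^sup>2 * (real k)\<^sup>2))"

definition eigval_sum :: "nat \<Rightarrow> real" where
  "eigval_sum K = (\<Sum>k\<in>{1..K}. 1 / (pi\<^sup>2 * (real k)\<^sup>2))"

lemma sum_Suc_shift: "(\<Sum>k\<in>{Suc 0..K}. f k) = (\<Sum>k<K. f (Suc k) :: real)"
  by (rule sum.reindex_bij_witness[of _ Suc "\<lambda>k. k - 1"]) auto

lemma cvm_trunc_tendsto:
  assumes "u \<in> {0..1}" "v \<in> {0..1}"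
  shows "(\<lambda>K. cvm_trunc K u v) \<longlonglongrightarrow> cvm u v"
proof -
  have "cosb k u * cosb k v = 2 * cos (real k * pi * u) * cos (real k * pi * v)" for k
    by (simp add: cosb_def)
  then show ?thesis using cos_product_series[of u v] assms
    by (simp add: cvm_trunc_def cvm_def sums_def sum_Suc_shift del: of_nat_Suc)
qed

lemma eigval_sums: "(\<lambda>k. 1 / (pi\<^sup>2 * (real (Suc k))\<^sup>2)) sums (1 / 6)"
proof -
  have "(\<lambda>k. 1 / pi\<^sup>2 * (1 / (real (Suc k))\<^sup>2)) sums (1 / pi\<^sup>2 * (pi\<^sup>2 / 6))"
    by (intro sums_mult inverse_squares_sums')
  then show ?thesis by simp
qed

lemma eigval_sum_tendsto: "eigval_sum \<longlonglongrightarrow> 1 / 6"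
  using eigval_sums by (simp add: eigval_sum_def[abs_def] sums_def sum_Suc_shift del: of_nat_Suc)

lemma eigval_sum_le: "eigval_sum K \<le> 1 / 6"
  using sum_le_suminf[OF sums_summable[OF eigval_sums], of "{..<K}"] eigval_sums
  by (simp add: eigval_sum_def sum_Suc_shift sums_iff del: of_nat_Suc)

lemma sum_eigval: "(\<Sum>j\<in>{1..K} \<times> {1..K}. eigval j) = (eigval_sum K)\<^sup>2"
  by (simp add: eigval_def eigval_sum_def power2_eq_square sum_product sum.cartesian_product split_def)

text \<open>Each cosine product is at most 4 in absolute value and the eigenvalues sum to at most
  1/6. Uniformity in K allows dominated convergence.\<close>

lemma cvm_trunc_bound: "\<bar>cvm_trunc K u v\<bar> \<le> 1"
proof -
  have "\<bar>cvm_trunc K u v\<bar> \<le> (\<Sum>k\<in>{1..K}. \<bar>cosb k u * cosb k v / (pi\<^sup>2 * (real k)\<^sup>2)\<bar>)"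
    unfolding cvm_trunc_def by (rule sum_abs)
  also have "\<dots> \<le> (\<Sum>k\<in>{1..K}. (2 * 2) * (1 / (pi\<^sup>2 * (real k)\<^sup>2)))"
  proof (rule sum_mono)
    fix k
    have "\<bar>cosb k u * cosb k v / (pi\<^sup>2 * (real k)\<^sup>2)\<bar> = \<bar>cosb k u * cosb k v\<bar> * (1 / (pi\<^sup>2 * (real k)\<^sup>2))" by simp
    also have "\<dots> \<le> (2 * 2) * (1 / (pi\<^sup>2 * (real k)\<^sup>2))"
      by (intro mult_right_mono abs_mult_le cosb_bound) simp
    finally show "\<bar>cosb k u * cosb k v / (pi\<^sup>2 * (real k)\<^sup>2)\<bar> \<le> (2 * 2) * (1 / (pi\<^sup>2 * (real k)\<^sup>2))" .
  qed
  also have "\<dots> = 4 * eigval_sum K" by (simp add: eigval_sum_def sum_distrib_left)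
  finally show ?thesis using eigval_sum_le[of K] by linarith
qed

lemma cvm_bound: "u \<in> {0..1} \<Longrightarrow> v \<in> {0..1} \<Longrightarrow> \<bar>cvm u v\<bar> \<le> 1"
  using LIMSEQ_le_const2[OF tendsto_rabs[OF cvm_trunc_tendsto[of u v]], of 1] cvm_trunc_bound by blast

definition vstat :: "nat \<Rightarrow> (nat \<Rightarrow> real \<times> real) \<Rightarrow> real" where
  "vstat n z = (\<Sum>p\<in>{1..n}. \<Sum>q\<in>{1..n}. cvm (fst (z p)) (fst (z q)) * cvm (snd (z p)) (snd (z q))) / real n"

text \<open>In this form the truncated V-statistic is visibly nonnegative and increasing in K;
  \<open>vstat_trunc_eq\<close> links it to the kernel.\<close>

definition vstat_trunc :: "nat \<Rightarrow> nat \<Rightarrow> (nat \<Rightarrow> real \<times> real) \<Rightarrow> real" where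
  "vstat_trunc K n z = (\<Sum>j\<in>{1..K} \<times> {1..K}. eigval j * ((\<Sum>i\<in>{1..n}. cosb2 j (z i)) / sqrt (real n))\<^sup>2)"

lemma vstat_trunc_eq:
  "vstat_trunc K n z = (\<Sum>p\<in>{1..n}. \<Sum>q\<in>{1..n}. cvm_trunc K (fst (z p)) (fst (z q)) * cvm_trunc K (snd (z p)) (snd (z q))) / real n"
proof -
  have 1: "cvm_trunc K a b * cvm_trunc K c d = (\<Sum>j\<in>{1..K} \<times> {1..K}. eigval j * (cosb2 j (a, c) * cosb2 j (b, d)))" for a b c d
    unfolding cvm_trunc_def sum_product sum.cartesian_product
    by (intro sum.cong refl) (auto simp: eigval_def cosb2_def)
  have 2: "((\<Sum>i\<in>{1..n}. cosb2 j (z i)) / sqrt (real n))\<^sup>2 = (\<Sum>p\<in>{1..n}. \<Sum>q\<in>{1..n}. cosb2 j (z p) * cosb2 j (z q)) / real n" for j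
    by (simp add: power_divide power2_eq_square sum_product)
  have "vstat_trunc K n z = (\<Sum>j\<in>{1..K} \<times> {1..K}. \<Sum>p\<in>{1..n}. \<Sum>q\<in>{1..n}. eigval j * (cosb2 j (z p) * cosb2 j (z q))) / real n"
    unfolding vstat_trunc_def 2 by (simp add: sum_distrib_left sum_divide_distrib)
  also have "(\<Sum>j\<in>{1..K} \<times> {1..K}. \<Sum>p\<in>{1..n}. \<Sum>q\<in>{1..n}. eigval j * (cosb2 j (z p) * cosb2 j (z q))) =
    (\<Sum>p\<in>{1..n}. \<Sum>q\<in>{1..n}. \<Sum>j\<in>{1..K} \<times> {1..K}. eigval j * (cosb2 j (z p) * cosb2 j (z q)))"
    by (subst sum.swap) (intro sum.cong refl sum.swap)
  finally show ?thesis by (simp only: 1 prod.collapse)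
qed

lemma vstat_trunc_nonneg: "0 \<le> vstat_trunc K n z"
  unfolding vstat_trunc_def by (intro sum_nonneg mult_nonneg_nonneg) (auto simp: eigval_def)

lemma vstat_trunc_mono: "K \<le> L \<Longrightarrow> vstat_trunc K n z \<le> vstat_trunc L n z"
  unfolding vstat_trunc_def by (intro sum_mono2 mult_nonneg_nonneg) (auto simp: eigval_def)

lemma vstat_trunc_tendsto:
  assumes "\<And>i. z i \<in> {0..1} \<times> {0..1}"
  shows "(\<lambda>K. vstat_trunc K n z) \<longlonglongrightarrow> vstat n z"
  unfolding vstat_trunc_eq vstat_def
  by (cases "n = 0", simp, intro tendsto_divide tendsto_sum tendsto_mult cvm_trunc_tendsto tendsto_const)
    (use assms in \<open>auto simp: mem_Times_iff\<close>)

lemma vstat_trunc_le: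
  assumes "\<And>i. z i \<in> {0..1} \<times> {0..1}"
  shows "vstat_trunc K n z \<le> vstat n z"
  by (rule LIMSEQ_le_const[OF vstat_trunc_tendsto[OF assms]]) (auto intro: vstat_trunc_mono)

lemma vstat_trunc_bound: "\<bar>vstat_trunc K n z\<bar> \<le> real n"
proof -
  have "\<bar>\<Sum>p\<in>{1..n}. \<Sum>q\<in>{1..n}. cvm_trunc K (fst (z p)) (fst (z q)) * cvm_trunc K (snd (z p)) (snd (z q))\<bar>
    \<le> (\<Sum>p\<in>{1..n}. \<Sum>q\<in>{1..n}. 1 * 1)"
    by (intro order_trans[OF sum_abs] sum_mono abs_mult_le cvm_trunc_bound)
  then have "\<bar>\<Sum>p\<in>{1..n}. \<Sum>q\<in>{1..n}. cvm_trunc K (fst (z p)) (fst (z q)) * cvm_trunc K (snd (z p)) (snd (z q))\<bar> \<le> real n * real n"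
    by simp
  then show ?thesis unfolding vstat_trunc_eq by (cases "n = 0") (simp_all add: divide_le_eq)
qed

lemma exp_neg_diff_le:
  fixes x y t :: real
  assumes "0 \<le> t" "0 \<le> x" "x \<le> y"
  shows "\<bar>exp (- t * y) - exp (- t * x)\<bar> \<le> t * (y - x)"
proof -
  have "exp (- t * x) - exp (- t * y) = exp (- t * x) * (1 - exp (- (t * (y - x))))"
    by (simp add: right_diff_distrib flip: exp_add)
  also have "\<dots> \<le> 1 * (t * (y - x))"
    using assms exp_ge_add_one_self[of "- (t * (y - x))"] by (intro mult_mono) auto
  finally show ?thesis using assms by (simp add: mult_left_mono)
qed

text \<open>Membership in the unit square is required everywhere, so the cosine expansion holds at
  every sample point. This is attainable because the points will be values of distribution
  functions.\<close>

locale uniform_seq = iid_seq M P U2 for M :: "'a measure" and P :: "nat \<Rightarrow> 'a \<Rightarrow> real \<times> real" +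
  assumes range: "\<And>i x. P i x \<in> {0..1} \<times> {0..1}"
begin

lemma coord_measurable [measurable]:
  "i \<ge> 1 \<Longrightarrow> (\<lambda>x. fst (P i x)) \<in> borel_measurable M" "i \<ge> 1 \<Longrightarrow> (\<lambda>x. snd (P i x)) \<in> borel_measurable M"
  using measurable_compose[OF rv measurable_fst] measurable_compose[OF rv measurable_snd]
  by (simp_all add: measurable_cong_sets[OF refl sets_U01])

abbreviation "V n x \<equiv> vstat n (\<lambda>i. P i x)"
abbreviation "VT K n x \<equiv> vstat_trunc K n (\<lambda>i. P i x)"

lemma V_measurable: "V n \<in> borel_measurable M"
  unfolding vstat_def
  by (intro borel_measurable_divide borel_measurable_sum borel_measurable_times borel_measurable_cvm coord_measurable) auto

lemma VT_measurable: "VT K n \<in> borel_measurable M"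
  unfolding vstat_trunc_def
proof (intro borel_measurable_sum borel_measurable_times borel_measurable_power borel_measurable_divide borel_measurable_const)
  fix i j assume "i \<in> {1..n}"
  then show "(\<lambda>x. cosb2 j (P i x)) \<in> borel_measurable M"
    by (intro measurable_compose[OF rv cosb2_measurable]) auto
qed

lemma V_nonneg: "0 \<le> V n x"
  by (rule order_trans[OF vstat_trunc_nonneg vstat_trunc_le[OF range, of 0]])

lemma V_bound: "V n x \<le> real n"
proof (rule LIMSEQ_le_const2)
  show "(\<lambda>K. VT K n x) \<longlonglongrightarrow> V n x" by (rule vstat_trunc_tendsto[OF range])
  show "\<exists>N. \<forall>K\<ge>N. VT K n x \<le> real n" using abs_le_D1[OF vstat_trunc_bound] by simp
qed

lemma V_integrable: "integrable M (V n)"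
  by (rule integrable_le_bound[OF prob_space_axioms V_measurable, of n "real n"]) (use V_nonneg V_bound in auto)

lemma VT_integrable: "integrable M (VT K n)"
  by (rule integrable_le_bound[OF prob_space_axioms VT_measurable vstat_trunc_bound])

lemma expectation_VT:
  assumes "n \<ge> 1"
  shows "expectation (VT K n) = (eigval_sum K)\<^sup>2"
proof -
  have e: "expectation (\<lambda>x. ((\<Sum>i\<in>{1..n}. cosb2 j (P i x)) / sqrt (real n))\<^sup>2) = 1"
    and i: "integrable M (\<lambda>x. ((\<Sum>i\<in>{1..n}. cosb2 j (P i x)) / sqrt (real n))\<^sup>2)" if j: "j \<in> {1..K} \<times> {1..K}" for j
  proof -
    have "expectation (\<lambda>x. (\<Sum>i\<in>{1..n}. cosb2 j (P i x))\<^sup>2) = real n * (\<integral>y. (cosb2 j y)\<^sup>2 \<partial>U2)"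
      by (rule second_moment_sum[OF cosb2_measurable cosb2_bound integral_cosb2[OF j]])
    also have "(\<integral>y. (cosb2 j y)\<^sup>2 \<partial>U2) = 1" using integral_cosb2_cosb2[OF j j] by (simp add: power2_eq_square)
    finally show "expectation (\<lambda>x. ((\<Sum>i\<in>{1..n}. cosb2 j (P i x)) / sqrt (real n))\<^sup>2) = 1"
      using assms by (simp add: power_divide)
    \<comment> \<open>A function with nonzero integral is integrable, as non-integrable functions
      have integral 0 by convention.\<close>
    then show "integrable M (\<lambda>x. ((\<Sum>i\<in>{1..n}. cosb2 j (P i x)) / sqrt (real n))\<^sup>2)"
      using not_integrable_integral_eq by fastforce
  qed
  have "expectation (VT K n) = (\<Sum>j\<in>{1..K} \<times> {1..K}. eigval j * 1)"
    unfolding vstat_trunc_def using e i by (subst Bochner_Integration.integral_sum) auto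
  then show ?thesis by (simp only: mult_1_right sum_eigval)
qed

text \<open>The limit of the truncated means, with the constant \<open>real n\<close> as dominating
  function for fixed n.\<close>

lemma expectation_V:
  assumes "n \<ge> 1"
  shows "expectation (V n) = 1 / 36"
proof -
  have "(\<lambda>K. expectation (VT K n)) \<longlonglongrightarrow> expectation (V n)"
    by (rule integral_dominated_convergence[where w="\<lambda>_. real n"])
      (use V_measurable VT_measurable vstat_trunc_bound vstat_trunc_tendsto[OF range] in auto)
  moreover have "(\<lambda>K. expectation (VT K n)) \<longlonglongrightarrow> (1 / 6)\<^sup>2"
    unfolding expectation_VT[OF assms] by (intro tendsto_power eigval_sum_tendsto)
  ultimately show ?thesis using LIMSEQ_unique by (fastforce simp: power2_eq_square)
qed

lemma laplace_VT:
  assumes "0 \<le> t"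
  shows "(\<lambda>n. expectation (\<lambda>x. exp (- t * VT K n x))) \<longlonglongrightarrow>
    (\<Prod>j\<in>{1..K} \<times> {1..K}. \<integral>y. exp (- (t * eigval j) * y\<^sup>2) \<partial>std_normal_distribution)"
proof -
  have e: "- t * VT K n x = - (\<Sum>j\<in>{1..K} \<times> {1..K}. (t * eigval j) * ((\<Sum>i\<in>{1..n}. cosb2 j (P i x)) / sqrt (real n))\<^sup>2)" for n x
    by (simp add: vstat_trunc_def sum_distrib_left sum_negf mult_ac)
  show ?thesis unfolding e
    by (rule laplace_sum_squares[OF _ cosb2_measurable cosb2_bound integral_cosb2 integral_cosb2_cosb2])
      (use assms in \<open>auto simp: eigval_def\<close>)
qed

text \<open>Truncation only lowers the V-statistic, and exp(-t y) is Lipschitz with constant t on y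
  \<ge> 0. The error is therefore at most t times the difference of means, a tail of the eigenvalue
  sum independent of n.\<close>

lemma laplace_V:
  assumes t: "0 \<le> t"
    and B: "(\<lambda>K. \<Prod>j\<in>{1..K} \<times> {1..K}. \<integral>y. exp (- (t * eigval j) * y\<^sup>2) \<partial>std_normal_distribution) \<longlonglongrightarrow> B"
  shows "(\<lambda>n. expectation (\<lambda>x. exp (- t * V n x))) \<longlonglongrightarrow> B"
proof (rule limit_interchange[OF laplace_VT[OF t] B])
  have "(\<lambda>K. t * (1 / 36 - (eigval_sum K)\<^sup>2)) \<longlonglongrightarrow> t * (1 / 36 - (1 / 6)\<^sup>2)"
    by (intro tendsto_intros eigval_sum_tendsto)
  then show "(\<lambda>K. t * (1 / 36 - (eigval_sum K)\<^sup>2)) \<longlonglongrightarrow> 0" by (simp add: power2_eq_square)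
  fix K n :: nat assume n: "n \<ge> 1"
  note [measurable] = V_measurable VT_measurable
  have i: "integrable M (\<lambda>x. exp (- t * V n x))" "integrable M (\<lambda>x. exp (- t * VT K n x))"
    by (rule integrable_le_bound[OF prob_space_axioms, where C=1]; use V_nonneg vstat_trunc_nonneg t in simp)+
  have "\<bar>expectation (\<lambda>x. exp (- t * V n x)) - expectation (\<lambda>x. exp (- t * VT K n x))\<bar>
    = \<bar>expectation (\<lambda>x. exp (- t * V n x) - exp (- t * VT K n x))\<bar>" using i by simp
  also have "\<dots> \<le> expectation (\<lambda>x. \<bar>exp (- t * V n x) - exp (- t * VT K n x)\<bar>)"
    using integral_norm_bound[of M "\<lambda>x. exp (- t * V n x) - exp (- t * VT K n x)"] by simp
  also have "\<dots> \<le> expectation (\<lambda>x. t * (V n x - VT K n x))"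
  proof (rule integral_mono)
    show "\<bar>exp (- t * V n x) - exp (- t * VT K n x)\<bar> \<le> t * (V n x - VT K n x)" for x
      by (rule exp_neg_diff_le[OF t vstat_trunc_nonneg vstat_trunc_le[OF range]])
  qed (use i V_integrable VT_integrable in auto)
  also have "\<dots> = t * (1 / 36 - (eigval_sum K)\<^sup>2)"
    using V_integrable VT_integrable by (simp add: expectation_V[OF n] expectation_VT[OF n])
  finally show "\<bar>expectation (\<lambda>x. exp (- t * V n x)) - expectation (\<lambda>x. exp (- t * VT K n x))\<bar> \<le> t * (1 / 36 - (eigval_sum K)\<^sup>2)" .
qed

end

subsection \<open>The limit law\<close>

locale chi_family = prob_space N for N :: "'a measure" +
  fixes chi :: "nat \<Rightarrow> nat \<Rightarrow> 'a \<Rightarrow> real"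
  assumes indep: "indep_vars (\<lambda>_. borel) (\<lambda>(i, j). chi i j) ({1..} \<times> {1..})"
    and law: "\<And>i j. i \<ge> 1 \<Longrightarrow> j \<ge> 1 \<Longrightarrow> distr N borel (chi i j) = chi_square_1"
begin

lemma chi_measurable: "i \<ge> 1 \<Longrightarrow> j \<ge> 1 \<Longrightarrow> chi i j \<in> borel_measurable N"
proof -
  assume "i \<ge> 1" "j \<ge> 1"
  then have "(i, j) \<in> {1..} \<times> {1..}" by simp
  with indep have "(case (i, j) of (i, j) \<Rightarrow> chi i j) \<in> borel_measurable N" unfolding indep_vars_def by blast
  then show ?thesis by simp
qed

lemma chi_measurable_Suc [measurable]: "chi (Suc i) (Suc j) \<in> borel_measurable N"
  by (rule chi_measurable) auto

lemma expectation_chi: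
  fixes f :: "real \<Rightarrow> real"
  assumes [measurable]: "f \<in> borel_measurable borel" and ij: "i \<ge> 1" "j \<ge> 1"
  shows "expectation (\<lambda>x. f (chi i j x)) = (\<integral>y. f (y\<^sup>2) \<partial>std_normal_distribution)"
proof -
  have "expectation (\<lambda>x. f (chi i j x)) = (\<integral>y. f y \<partial>distr N borel (chi i j))"
    using chi_measurable[OF ij] by (subst integral_distr) auto
  also have "\<dots> = (\<integral>y. f (y\<^sup>2) \<partial>std_normal_distribution)"
    unfolding law[OF ij] chi_square_1_def by (subst integral_distr) auto
  finally show ?thesis .
qed

lemma nn_integral_chi:
  assumes ij: "i \<ge> 1" "j \<ge> 1"
  shows "(\<integral>\<^sup>+x. ennreal (chi i j x) \<partial>N) = 1"
proof -
  have "(\<integral>\<^sup>+x. ennreal (chi i j x) \<partial>N) = (\<integral>\<^sup>+y. ennreal y \<partial>distr N borel (chi i j))"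
    using chi_measurable[OF ij] by (subst nn_integral_distr) auto
  also have "\<dots> = (\<integral>\<^sup>+y. ennreal (y\<^sup>2) \<partial>std_normal_distribution)"
    unfolding law[OF ij] chi_square_1_def by (subst nn_integral_distr) auto
  also have "\<dots> = ennreal (\<integral>y. y\<^sup>2 \<partial>std_normal_distribution)"
    using std_normal_distribution_even_moments(2)[of 1] by (intro nn_integral_eq_integral) auto
  also have "(\<integral>y. y\<^sup>2 \<partial>std_normal_distribution) = 1"
    using std_normal_distribution_even_moments(1)[of 1] by simp
  finally show ?thesis by simp
qed

lemma AE_chi_nonneg: "AE x in N. \<forall>i j. 0 \<le> chi (Suc i) (Suc j) x"
proof -
  have "AE x in N. 0 \<le> chi (Suc i) (Suc j) x" for i j
  proof -
    have "AE y in chi_square_1. 0 \<le> y"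
      unfolding chi_square_1_def by (subst AE_distr_iff) auto
    then have "AE y in distr N borel (chi (Suc i) (Suc j)). 0 \<le> y"
      by (subst law) auto
    then show ?thesis by (rule AE_distrD[OF chi_measurable_Suc])
  qed
  then show ?thesis by (simp add: AE_all_countable)
qed

definition WT :: "nat \<Rightarrow> 'a \<Rightarrow> real" where
  "WT K x = (\<Sum>j\<in>{1..K} \<times> {1..K}. eigval j * chi (fst j) (snd j) x)"

text \<open>Almost surely the uncentred series of eigenvalues times chi-square variables: 1/36 is
  the sum of the eigenvalues, which the centring in \<open>chi_series\<close> had removed. It is
  almost surely nonnegative, as the Laplace argument needs.\<close>

definition W :: "'a \<Rightarrow> real" where
  "W x = chi_series chi x / pi ^ 4 + 1 / 36"

lemma W_measurable: "W \<in> borel_measurable N"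
  unfolding W_def[abs_def] chi_series_def by measurable

lemma WT_measurable: "WT K \<in> borel_measurable N"
  unfolding WT_def[abs_def] by (intro borel_measurable_sum borel_measurable_times borel_measurable_const chi_measurable) auto

lemma laplace_WT:
  assumes "0 \<le> t"
  shows "expectation (\<lambda>x. exp (- t * WT K x)) =
    (\<Prod>j\<in>{1..K} \<times> {1..K}. \<integral>y. exp (- (t * eigval j) * y\<^sup>2) \<partial>std_normal_distribution)"
proof -
  let ?J = "{1..K} \<times> {1..K}"
  have ind: "indep_vars (\<lambda>_. borel) (\<lambda>j x. exp (- (t * eigval j) * chi (fst j) (snd j) x)) ?J"
  proof -
    have "indep_vars (\<lambda>_. borel) (\<lambda>j x. exp (- (t * eigval j) * (case j of (i, j) \<Rightarrow> chi i j) x)) ({1..} \<times> {1..})"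
      by (rule indep_vars_compose2[OF indep]) measurable
    then have "indep_vars (\<lambda>_. borel) (\<lambda>j x. exp (- (t * eigval j) * (case j of (i, j) \<Rightarrow> chi i j) x)) ?J"
      by (rule indep_vars_subset) auto
    then show ?thesis by (simp add: split_def)
  qed
  have int: "integrable N (\<lambda>x. exp (- (t * eigval j) * chi (fst j) (snd j) x))" if j: "j \<in> ?J" for j
  proof (rule integrable_const_bound[where B=1])
    obtain k l where kl: "fst j = Suc k" "snd j = Suc l"
      using j by (auto simp: mem_Times_iff dest!: Suc_le_D)
    show "AE x in N. norm (exp (- (t * eigval j) * chi (fst j) (snd j) x)) \<le> 1"
      using AE_chi_nonneg by eventually_elim (use assms in \<open>auto simp: kl eigval_def intro!: mult_nonneg_nonneg\<close>)
    show "(\<lambda>x. exp (- (t * eigval j) * chi (fst j) (snd j) x)) \<in> borel_measurable N"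
      unfolding kl by measurable
  qed
  have "expectation (\<lambda>x. exp (- t * WT K x)) = expectation (\<lambda>x. \<Prod>j\<in>?J. exp (- (t * eigval j) * chi (fst j) (snd j) x))"
    by (simp add: WT_def sum_distrib_left mult.assoc flip: exp_sum sum_negf)
  also have "\<dots> = (\<Prod>j\<in>?J. expectation (\<lambda>x. exp (- (t * eigval j) * chi (fst j) (snd j) x)))"
    by (rule indep_vars_lebesgue_integral[OF _ ind int]) auto
  also have "\<dots> = (\<Prod>j\<in>?J. \<integral>y. exp (- (t * eigval j) * y\<^sup>2) \<partial>std_normal_distribution)"
    by (intro prod.cong refl expectation_chi) auto
  finally show ?thesis .
qed

text \<open>By Tonelli the expectation of the double series is the sum of the eigenvalues, since
  each variable has mean 1. The coercion \<open>ennreal\<close> cuts off negative values, which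
  occur with probability zero.\<close>

lemma AE_chi_summable:
  "AE x in N. (\<Sum>k. \<Sum>l. ennreal (eigval (Suc k, Suc l) * chi (Suc k) (Suc l) x)) \<noteq> \<infinity>"
proof -
  define r where "r k = 1 / (pi\<^sup>2 * (real (Suc k))\<^sup>2)" for k
  have r: "r sums (1 / 6)" "\<And>k. 0 \<le> r k" unfolding r_def using eigval_sums by auto
  have e: "eigval (Suc k, Suc l) = r k * r l" for k l by (simp add: eigval_def r_def)
  have rs: "(\<Sum>k. ennreal (r k)) = ennreal (1 / 6)"
    using suminf_ennreal2[OF r(2) sums_summable[OF r(1)]] r(1) by (simp add: sums_iff)
  have "(\<integral>\<^sup>+x. (\<Sum>k. \<Sum>l. ennreal (eigval (Suc k, Suc l) * chi (Suc k) (Suc l) x)) \<partial>N)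
    = (\<Sum>k. \<Sum>l. \<integral>\<^sup>+x. ennreal (r k * r l * chi (Suc k) (Suc l) x) \<partial>N)"
    unfolding e by (subst nn_integral_suminf, measurable, subst nn_integral_suminf, measurable)
  also have "\<dots> = (\<Sum>k. \<Sum>l. ennreal (r k) * ennreal (r l))"
  proof -
    have "(\<integral>\<^sup>+x. ennreal (r k * r l * chi (Suc k) (Suc l) x) \<partial>N) = ennreal (r k) * ennreal (r l)" for k l
    proof -
      have "(\<integral>\<^sup>+x. ennreal (r k * r l * chi (Suc k) (Suc l) x) \<partial>N) = (\<integral>\<^sup>+x. ennreal (r k * r l) * ennreal (chi (Suc k) (Suc l) x) \<partial>N)"
        using r(2) by (intro nn_integral_cong ennreal_mult') auto
      also have "\<dots> = ennreal (r k * r l)" by (subst nn_integral_cmult) (auto simp: nn_integral_chi)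
      finally show ?thesis using r(2) by (simp add: ennreal_mult')
    qed
    then show ?thesis by simp
  qed
  also have "\<dots> = ennreal (1 / 6) * ennreal (1 / 6)" by (simp only: ennreal_suminf_cmult ennreal_suminf_multc rs)
  also have "\<dots> < \<infinity>" by (simp add: ennreal_mult_less_top infinity_ennreal_def)
  finally have "(\<integral>\<^sup>+x. (\<Sum>k. \<Sum>l. ennreal (eigval (Suc k, Suc l) * chi (Suc k) (Suc l) x)) \<partial>N) \<noteq> \<infinity>" by simp
  then show ?thesis by (intro nn_integral_noteq_infinite) measurable
qed

text \<open>Finiteness of the extended sum gives summability of the rows and of the row sums, so the
  square truncations converge to the iterated sum. It remains to match this sum with the centred
  series.\<close>

lemma AE_WT_tendsto: "AE x in N. (\<lambda>K. WT K x) \<longlonglongrightarrow> W x"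
  using AE_chi_nonneg AE_chi_summable
proof eventually_elim
  case (elim x)
  define r where "r k = 1 / (pi\<^sup>2 * (real (Suc k))\<^sup>2)" for k
  have r: "r sums (1 / 6)" "\<And>k. 0 \<le> r k" unfolding r_def using eigval_sums by auto
  define a where "a k l = eigval (Suc k, Suc l) * chi (Suc k) (Suc l) x" for k l
  have a0: "0 \<le> a k l" for k l using elim(1) by (simp add: a_def eigval_def)
  have fin: "(\<Sum>k. \<Sum>l. ennreal (a k l)) \<noteq> \<infinity>" using elim(2) by (simp add: a_def)
  have inner: "summable (a k)" for k
  proof (rule summable_suminf_not_top[OF a0, folded infinity_ennreal_def])
    have "(\<Sum>l. ennreal (a k l)) \<le> (\<Sum>k. \<Sum>l. ennreal (a k l))"
      using sum_le_suminf[of "\<lambda>k. \<Sum>l. ennreal (a k l)" "{k}"] by simp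
    then show "(\<Sum>l. ennreal (a k l)) \<noteq> \<infinity>" using fin by (auto simp: top_unique infinity_ennreal_def)
  qed
  have "(\<Sum>l. ennreal (a k l)) = ennreal (\<Sum>l. a k l)" for k by (rule suminf_ennreal2[OF a0 inner])
  then have outer: "summable (\<lambda>k. \<Sum>l. a k l)"
    using fin by (intro summable_suminf_not_top[folded infinity_ennreal_def] suminf_nonneg[OF inner] a0) simp
  have "(\<lambda>K. \<Sum>k<K. \<Sum>l<K. a k l) \<longlonglongrightarrow> (\<Sum>k. \<Sum>l. a k l)"
    by (rule double_sum_square_limit[OF a0 inner outer])
  moreover have "WT K x = (\<Sum>k<K. \<Sum>l<K. a k l)" for K
  proof -
    have "WT K x = (\<Sum>k\<in>{1..K}. \<Sum>l\<in>{1..K}. eigval (k, l) * chi k l x)"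
      by (simp add: WT_def sum.cartesian_product split_def)
    then show ?thesis by (simp add: sum_Suc_shift a_def)
  qed
  moreover have "(\<Sum>k. \<Sum>l. a k l) = W x"
  proof -
    \<comment> \<open>Each -1 in the centred series contributes minus the eigenvalue r_k r_l, after
      pi^4 is taken out.\<close>
    have pt: "1 / ((real (Suc k))\<^sup>2 * (real (Suc l))\<^sup>2) * (chi (Suc k) (Suc l) x - 1) = pi ^ 4 * (a k l - r k * r l)" for k l
    proof -
      have "pi ^ 4 = pi\<^sup>2 * pi\<^sup>2" by (simp flip: power_add)
      then show ?thesis by (simp add: a_def eigval_def r_def field_simps del: of_nat_Suc)
    qed
    have rl: "(\<lambda>l. r k * r l) sums (r k * (1 / 6))" for k by (rule sums_mult[OF r(1)])
    have in2: "(\<Sum>l. pi ^ 4 * (a k l - r k * r l)) = pi ^ 4 * ((\<Sum>l. a k l) - r k * (1 / 6))" for k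
      using sums_mult[OF sums_diff[OF summable_sums[OF inner[of k]] rl[of k]], of "pi ^ 4"] by (simp add: sums_iff)
    have "(\<lambda>k. pi ^ 4 * ((\<Sum>l. a k l) - r k * (1 / 6))) sums (pi ^ 4 * ((\<Sum>k. \<Sum>l. a k l) - 1 / 6 * (1 / 6)))"
      by (intro sums_mult sums_diff summable_sums[OF outer] sums_mult2 r(1))
    then have "chi_series chi x = pi ^ 4 * ((\<Sum>k. \<Sum>l. a k l) - 1 / 36)"
      unfolding chi_series_def pt in2 by (simp add: sums_iff)
    then show ?thesis by (simp add: W_def)
  qed
  ultimately show "(\<lambda>K. WT K x) \<longlonglongrightarrow> W x" by simp
qed

lemma AE_WT_nonneg: "AE x in N. \<forall>K. 0 \<le> WT K x"
  using AE_chi_nonneg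
proof eventually_elim
  case (elim x)
  have "0 \<le> eigval j * chi (fst j) (snd j) x" if j: "j \<in> {1..K} \<times> {1..K}" for j and K :: nat
  proof -
    obtain k l where "fst j = Suc k" "snd j = Suc l"
      using j by (auto simp: mem_Times_iff dest!: Suc_le_D)
    then show ?thesis using elim by (simp add: eigval_def)
  qed
  then show ?case by (auto simp: WT_def intro!: sum_nonneg)
qed

lemma AE_W_nonneg: "AE x in N. 0 \<le> W x"
  using AE_WT_tendsto AE_WT_nonneg
  by eventually_elim (auto intro: LIMSEQ_le_const)

text \<open>The finite products are Laplace transforms of the truncations \<open>WT\<close>, by
  independence; these lie in [0,1] almost surely, so dominated convergence applies.\<close>

lemma laplace_W:
  assumes "0 \<le> t"
  shows "(\<lambda>K. \<Prod>j\<in>{1..K} \<times> {1..K}. \<integral>y. exp (- (t * eigval j) * y\<^sup>2) \<partial>std_normal_distribution)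
    \<longlonglongrightarrow> expectation (\<lambda>x. exp (- t * W x))"
  unfolding laplace_WT[OF assms, symmetric]
proof (rule integral_dominated_convergence[where w="\<lambda>_. 1"])
  note [measurable] = W_measurable WT_measurable
  show "(\<lambda>x. exp (- t * W x)) \<in> borel_measurable N" "(\<lambda>x. exp (- t * WT K x)) \<in> borel_measurable N" for K
    by measurable
  show "AE x in N. (\<lambda>K. exp (- t * WT K x)) \<longlonglongrightarrow> exp (- t * W x)"
    using AE_WT_tendsto by eventually_elim (intro tendsto_intros)
  show "AE x in N. norm (exp (- t * WT K x)) \<le> 1" for K
    using AE_WT_nonneg by eventually_elim (use assms in auto)
qed simp

lemma char_V_tendsto:
  assumes "uniform_seq M P"
  shows "(\<lambda>n. char (distr M borel (\<lambda>x. vstat n (\<lambda>i. P i x))) t) \<longlonglongrightarrow> char (distr N borel W) t"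
proof -
  interpret U: uniform_seq M P by fact
  show ?thesis
  proof (rule laplace_imp_char[OF U.prob_space_axioms prob_space_axioms U.V_measurable _ W_measurable AE_W_nonneg])
    show "AE x in M. 0 \<le> vstat n (\<lambda>i. P i x)" for n using U.V_nonneg by simp
    show "(\<lambda>n. \<integral>x. exp (- real k * vstat n (\<lambda>i. P i x)) \<partial>M) \<longlonglongrightarrow> expectation (\<lambda>x. exp (- real k * W x))" for k
      by (rule U.laplace_V[OF _ laplace_W]) auto
  qed
qed

end

subsection \<open>Reduction to the uniform case\<close>

lemma bounded_measurable_add:
  assumes "bounded_measurable \<mu> f" "bounded_measurable \<mu> g"
  shows "bounded_measurable \<mu> (\<lambda>z. f z + g z)"
  using bounded_measurable_diff[OF assms(1) bounded_measurable_diff[OF bounded_measurable_const[of \<mu> 0] assms(2)]] by simp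

lemma bounded_measurable_sum:
  "(\<And>i. i \<in> A \<Longrightarrow> bounded_measurable \<mu> (f i)) \<Longrightarrow> bounded_measurable \<mu> (\<lambda>z. \<Sum>i\<in>A. f i z)"
  by (induction A rule: infinite_finite_induct) (auto intro: bounded_measurable_add)

lemma U_stat_regular:
  assumes a: "bounded_measurable U01 (signed_sum m IX)" "dep_on {1..m} (signed_sum m IX)"
    and b: "bounded_measurable U01 (signed_sum m IY)" "dep_on {1..m} (signed_sum m IY)"
  shows "bounded_measurable U2 (U_stat m c IX IY n)" "dep_on {1..n} (U_stat m c IX IY n)"
proof -
  define k where "k = kernel m c IX IY"
  note kf = kernel_of_signed_sums[OF a b, of c, folded k_def]
  have U: "U_stat m c IX IY n = (\<lambda>z. 1 / (real (n choose m) * fact m) * (\<Sum>j\<in>inj_tuples m n. k (\<lambda>i. z (j i))))"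
    using U_stat_eq_inj_sum[OF kf(2)[unfolded k_def]] unfolding k_def by (simp add: fun_eq_iff)
  show "bounded_measurable U2 (U_stat m c IX IY n)" unfolding U
    by (rule bounded_measurable_mult[OF bounded_measurable_const bounded_measurable_sum[OF bounded_measurable_reindex[OF kf(3)]]])
  show "dep_on {1..n} (U_stat m c IX IY n)" unfolding dep_on_def
  proof (intro allI impI)
    fix z z' :: "nat \<Rightarrow> real \<times> real" assume eq: "\<forall>i\<in>{1..n}. z i = z' i"
    have "k (\<lambda>i. z (j i)) = k (\<lambda>i. z' (j i))" if "j \<in> inj_tuples m n" for j
      by (rule dep_onD[OF kf(2)]) (use eq inj_tuples_mem[OF that] in blast)
    then show "U_stat m c IX IY n z = U_stat m c IX IY n z'" unfolding U by simp
  qed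
qed

text \<open>Dependence on relative order only; strict comparisons are negated weak ones. A monotone
  transformation that creates no ties then preserves the statistic.\<close>

definition order_invariant :: "nat \<Rightarrow> ((nat \<Rightarrow> real) \<Rightarrow> real) \<Rightarrow> bool" where
  "order_invariant m a \<longleftrightarrow> (\<forall>w w'. (\<forall>p\<in>{1..m}. \<forall>q\<in>{1..m}. p \<noteq> q \<longrightarrow> (w p \<le> w q \<longleftrightarrow> w' p \<le> w' q)) \<longrightarrow> a w = a w')"

lemma order_invariant_tau: "order_invariant 4 tau_sum"
  unfolding order_invariant_def
proof (intro allI impI)
  fix w w' :: "nat \<Rightarrow> real"
  assume "\<forall>p\<in>{1..4}. \<forall>q\<in>{1..4}. p \<noteq> q \<longrightarrow> (w p \<le> w q \<longleftrightarrow> w' p \<le> w' q)"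
  then have e: "w p \<le> w q \<longleftrightarrow> w' p \<le> w' q" if "p \<noteq> q" "p \<in> {1..4}" "q \<in> {1..4}" for p q using that by blast
  show "tau_sum w = tau_sum w'" unfolding tau_sum_def tau4_def not_le[symmetric] by (simp add: e)
qed

lemma order_invariant_split:
  assumes l: "5 \<le> l" "l \<le> m"
  shows "order_invariant m (split_sum l)"
  unfolding order_invariant_def
proof (intro allI impI)
  fix w w' :: "nat \<Rightarrow> real"
  assume "\<forall>p\<in>{1..m}. \<forall>q\<in>{1..m}. p \<noteq> q \<longrightarrow> (w p \<le> w q \<longleftrightarrow> w' p \<le> w' q)"
  then have e: "w p \<le> w q \<longleftrightarrow> w' p \<le> w' q" if "p \<noteq> q" "p \<in> {1..m}" "q \<in> {1..m}" for p q using that by blast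
  show "split_sum l w = split_sum l w'" unfolding split_sum_def using l by (simp add: e)
qed

lemma U_stat_order_invariant:
  assumes a: "bounded_measurable U01 (signed_sum m IX)" "dep_on {1..m} (signed_sum m IX)" "order_invariant m (signed_sum m IX)"
    and b: "bounded_measurable U01 (signed_sum m IY)" "dep_on {1..m} (signed_sum m IY)" "order_invariant m (signed_sum m IY)"
    and ord: "\<And>p q. p \<in> {1..n} \<Longrightarrow> q \<in> {1..n} \<Longrightarrow> p \<noteq> q \<Longrightarrow>
      (fst (z p) \<le> fst (z q) \<longleftrightarrow> fst (z' p) \<le> fst (z' q)) \<and> (snd (z p) \<le> snd (z q) \<longleftrightarrow> snd (z' p) \<le> snd (z' q))"
  shows "U_stat m c IX IY n z = U_stat m c IX IY n z'"
proof -
  define k where "k = kernel m c IX IY"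
  note kf = kernel_of_signed_sums[OF a(1,2) b(1,2), of c, folded k_def]
  have "k (\<lambda>i. z (j i)) = k (\<lambda>i. z' (j i))" if j: "j \<in> inj_tuples m n" for j
  proof -
    have jj: "j p \<in> {1..n} \<and> j q \<in> {1..n} \<and> j p \<noteq> j q" if "p \<in> {1..m}" "q \<in> {1..m}" "p \<noteq> q" for p q
      using inj_tuples_mem[OF j that(1)] inj_tuples_mem[OF j that(2)] inj_onD[OF inj_tuples_inj[OF j] _ that(1,2)] that(3) by blast
    have "signed_sum m IX (\<lambda>i. fst (z (j i))) = signed_sum m IX (\<lambda>i. fst (z' (j i)))"
      by (rule a(3)[unfolded order_invariant_def, rule_format]) (use jj ord in blast)
    moreover have "signed_sum m IY (\<lambda>i. snd (z (j i))) = signed_sum m IY (\<lambda>i. snd (z' (j i)))"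
      by (rule b(3)[unfolded order_invariant_def, rule_format]) (use jj ord in blast)
    ultimately show ?thesis by (simp add: kf(1))
  qed
  then show ?thesis
    unfolding U_stat_eq_inj_sum[OF kf(2)[unfolded k_def]] unfolding k_def by simp
qed

lemma sets_U2: "sets U2 = sets (borel :: (real \<times> real) measure)"
proof -
  have "sets U2 = sets (borel \<Otimes>\<^sub>M borel :: (real \<times> real) measure)" by (intro sets_pair_measure_cong) simp_all
  then show ?thesis unfolding borel_prod .
qed

text \<open>Nothing is assumed about \<open>X i\<close> outside \<open>{1..n}\<close>, in particular
  at index 0, so the tuple is first restricted to the coordinates that matter.\<close>

lemma measurable_tuple_stat:
  assumes f: "f \<in> borel_measurable (PiM UNIV (\<lambda>_. U2))" "dep_on {1..n} f"
    and X: "\<And>i. i \<in> {1..n} \<Longrightarrow> X i \<in> M \<rightarrow>\<^sub>M U2"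
  shows "(\<lambda>x. f (\<lambda>i. X i x)) \<in> borel_measurable M"
proof -
  have "(\<lambda>x. \<lambda>i\<in>{1..n}. X i x) \<in> M \<rightarrow>\<^sub>M PiM {1..n} (\<lambda>_. U2)"
    by (rule measurable_restrict) (rule X)
  then have "(\<lambda>x. f (\<lambda>i\<in>{1..n}. X i x)) \<in> borel_measurable M"
    by (rule measurable_compose) (rule measurable_compose[OF U01_pair.pair.measurable_PiM_UNIV f(1)])
  moreover have "f (\<lambda>i\<in>{1..n}. X i x) = f (\<lambda>i. X i x)" for x
    by (rule dep_onD[OF f(2)]) simp
  ultimately show ?thesis by simp
qed

lemma dep_on_pair_sum: "dep_on {1..n} (pair_sum n)"
  unfolding dep_on_def pair_sum_def by simp

text \<open>Clamping to [0,1] makes the diagonal of the product kernel bounded on the whole plane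
  and changes nothing at the sample points.\<close>

definition diag_term :: "real \<times> real \<Rightarrow> real" where
  "diag_term z = cvm (max 0 (min 1 (fst z))) (max 0 (min 1 (fst z))) * cvm (max 0 (min 1 (snd z))) (max 0 (min 1 (snd z)))"

lemma diag_term_bound: "\<bar>diag_term z\<bar> \<le> 1"
proof -
  have "\<bar>diag_term z\<bar> \<le> 1 * 1" unfolding diag_term_def by (intro abs_mult_le cvm_bound) auto
  then show ?thesis by simp
qed

lemma diag_term_measurable [measurable]: "diag_term \<in> borel_measurable U2"
  unfolding diag_term_def cvm_def by measurable

text \<open>Each factor integrates 1/3 - u + u^2 over [0,1], which gives 1/6.\<close>

lemma integral_diag_term: "(\<integral>z. diag_term z \<partial>U2) = 1 / 36"
proof -
  define d where "d u = cvm (max 0 (min 1 u)) (max 0 (min 1 u))" for u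
  have [measurable]: "d \<in> borel_measurable borel" unfolding d_def cvm_def by measurable
  have "\<bar>d u\<bar> \<le> 1" for u unfolding d_def by (rule cvm_bound) auto
  then have i: "integrable U01 d" by (intro integrable_U01_bounded[where B=1]) measurable
  have "AE u in U01. d u = 1 / 3 - u + u\<^sup>2"
    using AE_U01 by eventually_elim (simp add: d_def cvm_def)
  then have "(\<integral>u. d u \<partial>U01) = (\<integral>u. 1 / 3 - u + u\<^sup>2 \<partial>U01)" by (intro integral_cong_AE) auto
  also have "\<dots> = (1 / 3 * 1 - 1\<^sup>2 / 2 + 1 ^ 3 / 3) - (1 / 3 * 0 - 0\<^sup>2 / 2 + 0 ^ 3 / 3)"
    by (rule integral_U01_FTC) (auto intro!: derivative_eq_intros continuous_intros simp: power2_eq_square)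
  finally have "(\<integral>u. d u \<partial>U01) = 1 / 6" by simp
  moreover have "diag_term z = d (fst z) * d (snd z)" for z by (simp add: diag_term_def d_def)
  ultimately have "(\<integral>z. diag_term z \<partial>U2) = 1 / 6 * (1 / 6)"
    by (simp only: U01_pair.integral_mult_pair[OF i i])
  then show ?thesis by simp
qed

text \<open>Pure algebra, stated for real variables so that the large sums in its application stay
  opaque.\<close>

lemma split_error:
  fixes A c e g v d s :: real
  assumes "s = (g + c) * (v - d)"
  shows "A - c * (v - e) = A - s + g * v - g * d - c * (d - e)"
  unfolding assms by (simp add: algebra_simps)

lemma abs_split_error:
  fixes y r a b b' e f :: real
  assumes "y = r + a - b - e" "\<bar>b\<bar> \<le> b'" "\<bar>e\<bar> = f" "0 \<le> a"
  shows "\<bar>y\<bar> \<le> \<bar>r\<bar> + a + b' + f"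
  using assms by linarith

context uniform_seq begin

lemma distr_tuple:
  assumes "n \<ge> 1"
  shows "distr M (PiM {1..n} (\<lambda>_. U2)) (\<lambda>x. \<lambda>i\<in>{1..n}. P i x) = PiM {1..n} (\<lambda>_. U2)"
proof -
  have ind: "indep_vars (\<lambda>_. U2) P {1..n}" by (rule indep_vars_subset[OF indep]) auto
  have "distr M (PiM {1..n} (\<lambda>_. U2)) (\<lambda>x. \<lambda>i\<in>{1..n}. P i x) = PiM {1..n} (\<lambda>i. distr M U2 (P i))"
    by (rule indep_vars_iff_distr_eq_PiM'[THEN iffD1, OF _ _ ind]) (use assms rv in auto)
  also have "\<dots> = PiM {1..n} (\<lambda>_. U2)" by (intro PiM_cong) (auto simp: distr)
  finally show ?thesis .
qed

lemma tuple_measurable: "(\<lambda>x. \<lambda>i\<in>{1..n}. P i x) \<in> M \<rightarrow>\<^sub>M PiM {1..n} (\<lambda>_. U2)"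
  by (rule measurable_restrict) (use rv in auto)

text \<open>Transfers the mean square bounds, proved on the finite product of uniform laws, to the
  probability space of the sample.\<close>

lemma expectation_tuple_stat:
  assumes n: "n \<ge> 1" and f: "f \<in> borel_measurable (PiM UNIV (\<lambda>_. U2))" "dep_on {1..n} f"
  shows "expectation (\<lambda>x. f (\<lambda>i. P i x)) = (\<integral>z. f z \<partial>PiM {1..n} (\<lambda>_. U2) :: real)"
proof -
  have "(\<integral>z. f z \<partial>PiM {1..n} (\<lambda>_. U2)) = (\<integral>z. f z \<partial>distr M (PiM {1..n} (\<lambda>_. U2)) (\<lambda>x. \<lambda>i\<in>{1..n}. P i x))"
    by (simp only: distr_tuple[OF n])
  also have "\<dots> = expectation (\<lambda>x. f (\<lambda>i\<in>{1..n}. P i x))"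
    by (rule integral_distr[OF tuple_measurable]) (rule measurable_compose[OF U01_pair.pair.measurable_PiM_UNIV f(1)])
  also have "\<dots> = expectation (\<lambda>x. f (\<lambda>i. P i x))"
    by (intro Bochner_Integration.integral_cong refl dep_onD[OF f(2)]) simp
  finally show ?thesis by simp
qed

abbreviation "D n x \<equiv> (\<Sum>i\<in>{1..n}. diag_term (P i x)) / real n"

lemma pair_sum_eq: "pair_sum n (\<lambda>i. P i x) = real n * (V n x - D n x)"
proof (cases "n = 0")
  case False
  have d: "cvm (fst (P p x)) (fst (P p x)) * cvm (snd (P p x)) (snd (P p x)) = diag_term (P p x)" for p
    using range[of p x] by (auto simp: diag_term_def mem_Times_iff)
  have "(\<Sum>q\<in>{1..n}. cvm (fst (P p x)) (fst (P q x)) * cvm (snd (P p x)) (snd (P q x))) =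
    diag_term (P p x) + (\<Sum>q\<in>{1..n} - {p}. cvm (fst (P p x)) (fst (P q x)) * cvm (snd (P p x)) (snd (P q x)))"
    if "p \<in> {1..n}" for p
    using that by (subst sum.remove[of _ p]) (simp_all add: d)
  then have "real n * V n x = (\<Sum>p\<in>{1..n}. diag_term (P p x)) + pair_sum n (\<lambda>i. P i x)"
    using False by (simp add: vstat_def pair_sum_def sum.distrib)
  then show ?thesis using False by (simp add: right_diff_distrib)
qed (simp add: pair_sum_def)

lemma D_measurable: "D n \<in> borel_measurable M"
proof (intro borel_measurable_divide borel_measurable_sum borel_measurable_const)
  fix i assume "i \<in> {1..n}"
  then show "(\<lambda>x. diag_term (P i x)) \<in> borel_measurable M"
    by (intro measurable_compose[OF rv diag_term_measurable]) auto
qed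

lemma D_bound: "\<bar>D n x\<bar> \<le> 1"
proof -
  have "\<bar>\<Sum>i\<in>{1..n}. diag_term (P i x)\<bar> \<le> (\<Sum>i\<in>{1..n}. 1)"
    by (intro order_trans[OF sum_abs] sum_mono diag_term_bound)
  then show ?thesis by (cases "n = 0") (simp_all add: divide_le_eq)
qed

text \<open>A law of large numbers with rate: the centred terms are bounded by 2, so the average has
  second moment at most 4/n, and \<open>L1_le_of_L2\<close> with K = 4 gives the numerator
  5.\<close>

lemma D_L1:
  assumes n: "n \<ge> 1"
  shows "expectation (\<lambda>x. \<bar>D n x - 1 / 36\<bar>) \<le> 5 / (2 * sqrt (real n))"
proof -
  define q where "q z = diag_term z - 1 / 36" for z
  have qm [measurable]: "q \<in> borel_measurable U2" unfolding q_def by measurable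
  have qb: "\<bar>q z\<bar> \<le> 2" for z using diag_term_bound[of z] unfolding q_def by linarith
  have "integrable U2 diag_term" by (rule integrable_le_bound[OF prob_space_law diag_term_measurable diag_term_bound])
  then have q0: "(\<integral>z. q z \<partial>U2) = 0"
    using prob_space.prob_space[OF prob_space_law] by (simp add: q_def integral_diag_term)
  have "(\<integral>z. (q z)\<^sup>2 \<partial>U2) \<le> 4"
  proof -
    have "(\<integral>z. (q z)\<^sup>2 \<partial>U2) \<le> (\<integral>z. 4 \<partial>U2)"
    proof (rule integral_mono)
      show "integrable U2 (\<lambda>z. (q z)\<^sup>2)"
        unfolding power2_eq_square by (rule integrable_le_bound[OF prob_space_law _ abs_mult_le[OF qb qb]]) measurable
      show "(q z)\<^sup>2 \<le> 4" for z using abs_mult_le[OF qb qb, of z z] by (simp add: power2_eq_square)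
      show "integrable U2 (\<lambda>z. 4 :: real)" by (rule integrable_le_bound[OF prob_space_law, where C=4]) auto
    qed
    also have "\<dots> = 4" using prob_space.prob_space[OF prob_space_law] by simp
    finally show ?thesis .
  qed
  then have "expectation (\<lambda>x. (\<Sum>i\<in>{1..n}. q (P i x))\<^sup>2) \<le> real n * 4"
    unfolding second_moment_sum[OF qm qb q0] by (intro mult_left_mono) auto
  moreover have e: "D n x - 1 / 36 = (\<Sum>i\<in>{1..n}. q (P i x)) / real n" for x
    using n by (simp add: q_def sum_subtractf diff_divide_distrib)
  ultimately have "expectation (\<lambda>x. (D n x - 1 / 36)\<^sup>2) \<le> 4 / real n"
    unfolding e using n by (simp add: power_divide power2_eq_square field_simps)
  moreover have db: "\<bar>D n x - 1 / 36\<bar> \<le> 2" for x using D_bound[of x n] by linarith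
  moreover note [measurable] = D_measurable[of n]
  have "integrable M (\<lambda>x. (D n x - 1 / 36)\<^sup>2)"
    unfolding power2_eq_square by (rule integrable_le_bound[OF prob_space_axioms _ abs_mult_le[OF db db]]) measurable
  moreover have "integrable M (\<lambda>x. D n x - 1 / 36)"
    by (rule integrable_le_bound[OF prob_space_axioms _ db]) measurable
  ultimately have "expectation (\<lambda>x. \<bar>D n x - 1 / 36\<bar>) \<le> (1 + 4) / (2 * sqrt (real n))"
    by (intro L1_le_of_L2[OF prob_space_axioms _ _ _ n]) auto
  then show ?thesis by simp
qed

text \<open>In L1, n U is close to c n/(n-1) (V - D), because the pair sum is n(V - D). This in turn
  is close to c(V - 1/36), whose characteristic function converges to that of c(W - 1/36).\<close>

lemma weak_conv_of_pair_sum: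
  fixes N :: "'c measure" and U :: "nat \<Rightarrow> (nat \<Rightarrow> real \<times> real) \<Rightarrow> real" and m :: nat and c :: real
  assumes chi: "chi_family N chi"
    and U: "\<And>n. bounded_measurable U2 (U n)" "\<And>n. dep_on {1..n} (U n)"
    and L2: "\<exists>K. \<forall>n\<ge>m. (\<integral>z. (real n * U n z - c / (real n - 1) * pair_sum n z)\<^sup>2 \<partial>PiM {1..n} (\<lambda>_. U2)) \<le> K / real n"
    and c: "c > 0"
  shows "weak_conv_m (\<lambda>n. distr M borel (\<lambda>x. real n * U n (\<lambda>i. P i x)))
    (distr N borel (\<lambda>x. c / pi ^ 4 * chi_series chi x))"
proof -
  interpret C: chi_family N chi by fact
  define A where "A n x = real n * U n (\<lambda>i. P i x)" for n x
  define B where "B n x = c * (V n x - 1 / 36)" for n x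
  define R where "R n x = A n x - c / (real n - 1) * pair_sum n (\<lambda>i. P i x)" for n x
  have Um: "U n \<in> borel_measurable (PiM UNIV (\<lambda>_. U2))" for n using U(1) by (simp add: bounded_measurable_def)
  have Am [measurable]: "A n \<in> borel_measurable M" for n
    unfolding A_def by (intro borel_measurable_times borel_measurable_const measurable_tuple_stat[OF Um U(2)] rv) auto
  note [measurable] = V_measurable D_measurable
  have Bm [measurable]: "B n \<in> borel_measurable M" for n unfolding B_def by measurable
  have Rm [measurable]: "R n \<in> borel_measurable M" for n unfolding R_def pair_sum_eq by measurable
  have "\<exists>b. \<forall>x. \<bar>A n x\<bar> \<le> b" for n
  proof -
    obtain b where "\<And>z. \<bar>U n z\<bar> \<le> b" using U(1)[of n] by (auto simp: bounded_measurable_def)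
    then have "\<bar>A n x\<bar> \<le> real n * b" for x unfolding A_def abs_mult by (intro mult_mono) auto
    then show ?thesis by blast
  qed
  then obtain bA where bA: "\<And>n x. \<bar>A n x\<bar> \<le> bA n" by metis
  have vb: "\<bar>V n x - D n x\<bar> \<le> real n + 1" for n x
    using V_nonneg[of n x] V_bound[of n x] D_bound[of x n] by linarith
  have bR: "\<bar>R n x\<bar> \<le> bA n + \<bar>c / (real n - 1) * real n\<bar> * (real n + 1)" for n x
  proof -
    have "\<bar>R n x\<bar> \<le> \<bar>A n x\<bar> + \<bar>c / (real n - 1) * real n * (V n x - D n x)\<bar>"
      unfolding R_def pair_sum_eq mult.assoc[symmetric] by (rule abs_triangle_ineq4)
    also have "\<dots> \<le> bA n + \<bar>c / (real n - 1) * real n\<bar> * (real n + 1)"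
      unfolding abs_mult[of _ "V n x - D n x"] by (intro add_mono bA mult_left_mono vb) auto
    finally show ?thesis .
  qed
  have iA: "integrable M (A n)" for n by (rule integrable_le_bound[OF prob_space_axioms Am bA])
  have iR: "integrable M (R n)" for n by (rule integrable_le_bound[OF prob_space_axioms Rm bR])
  have iR2: "integrable M (\<lambda>x. (R n x)\<^sup>2)" for n
    unfolding power2_eq_square by (rule integrable_le_bound[OF prob_space_axioms _ abs_mult_le[OF bR bR]]) measurable
  have iD: "integrable M (D n)" for n by (rule integrable_le_bound[OF prob_space_axioms D_measurable D_bound])
  have iB: "integrable M (B n)" for n unfolding B_def using V_integrable by simp
  obtain K where K: "\<And>n. n \<ge> m \<Longrightarrow> (\<integral>z. (real n * U n z - c / (real n - 1) * pair_sum n z)\<^sup>2 \<partial>PiM {1..n} (\<lambda>_. U2)) \<le> K / real n"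
    using L2 by blast
  have RL1: "expectation (\<lambda>x. \<bar>R n x\<bar>) \<le> (1 + K) / (2 * sqrt (real n))" if n: "n \<ge> m" "n \<ge> 1" for n
  proof -
    have "expectation (\<lambda>x. (R n x)\<^sup>2) = (\<integral>z. (real n * U n z - c / (real n - 1) * pair_sum n z)\<^sup>2 \<partial>PiM {1..n} (\<lambda>_. U2))"
      unfolding R_def A_def
    proof (rule expectation_tuple_stat[OF n(2)])
      note [measurable] = Um pair_sum_measurable
      show "(\<lambda>z. (real n * U n z - c / (real n - 1) * pair_sum n z)\<^sup>2) \<in> borel_measurable (PiM UNIV (\<lambda>_. U2))" by measurable
      show "dep_on {1..n} (\<lambda>z. (real n * U n z - c / (real n - 1) * pair_sum n z)\<^sup>2)"
        using U(2)[of n] dep_on_pair_sum[of n] unfolding dep_on_def by metis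
    qed
    then show ?thesis using K[OF n(1)] iR iR2 by (intro L1_le_of_L2[OF prob_space_axioms _ _ _ n(2)]) auto
  qed
  have bound: "expectation (\<lambda>x. \<bar>A n x - B n x\<bar>) \<le>
     (1 + K) / (2 * sqrt (real n)) + c / (real n - 1) * (1 / 36) + c / (real n - 1) * 1 + c * (5 / (2 * sqrt (real n)))"
    if n: "n \<ge> m" "n \<ge> 2" for n
  proof -
    have pt: "\<bar>A n x - B n x\<bar> \<le> \<bar>R n x\<bar> + c / (real n - 1) * V n x + c / (real n - 1) * 1 + c * \<bar>D n x - 1 / 36\<bar>" for x
    proof -
      \<comment> \<open>Writing c n/(n-1) as c plus c/(n-1) isolates a correction that vanishes,
        since V has mean 1/36 for every n \<ge> 1 and D is bounded.\<close>
      have "c / (real n - 1) * real n = c / (real n - 1) + c" using n by (simp add: field_simps)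
      then have "c / (real n - 1) * pair_sum n (\<lambda>i. P i x) = (c / (real n - 1) + c) * (V n x - D n x)"
        by (simp only: pair_sum_eq mult.assoc[symmetric])
      then have "A n x - B n x = R n x + c / (real n - 1) * V n x - c / (real n - 1) * D n x - c * (D n x - 1 / 36)"
        unfolding R_def B_def by (rule split_error)
      moreover have "\<bar>c / (real n - 1) * D n x\<bar> \<le> c / (real n - 1) * 1"
        unfolding abs_mult using c n D_bound[of x n] by (intro mult_mono) auto
      moreover have "\<bar>c * (D n x - 1 / 36)\<bar> = c * \<bar>D n x - 1 / 36\<bar>" using c by (simp add: abs_mult)
      moreover have "0 \<le> c / (real n - 1) * V n x" using c n V_nonneg[of n x] by simp
      ultimately show ?thesis by (rule abs_split_error)
    qed
    have "expectation (\<lambda>x. \<bar>A n x - B n x\<bar>) \<le>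
      expectation (\<lambda>x. \<bar>R n x\<bar> + c / (real n - 1) * V n x + c / (real n - 1) * 1 + c * \<bar>D n x - 1 / 36\<bar>)"
      using iA iB iR iD V_integrable by (intro integral_mono pt) auto
    also have "\<dots> = expectation (\<lambda>x. \<bar>R n x\<bar>) + c / (real n - 1) * expectation (V n) + c / (real n - 1) * 1
      + c * expectation (\<lambda>x. \<bar>D n x - 1 / 36\<bar>)"
      using iR iD V_integrable by (simp add: prob_space)
    also have "\<dots> \<le> (1 + K) / (2 * sqrt (real n)) + c / (real n - 1) * (1 / 36) + c / (real n - 1) * 1 + c * (5 / (2 * sqrt (real n)))"
      using n c by (intro add_mono RL1 mult_left_mono D_L1) (auto simp: expectation_V)
    finally show ?thesis .
  qed
  have close: "(\<lambda>n. expectation (\<lambda>x. \<bar>A n x - B n x\<bar>)) \<longlonglongrightarrow> 0"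
  proof (rule Lim_null_comparison)
    show "\<forall>\<^sub>F n in sequentially. norm (expectation (\<lambda>x. \<bar>A n x - B n x\<bar>)) \<le>
      (1 + K) / (2 * sqrt (real n)) + c / (real n - 1) * (1 / 36) + c / (real n - 1) * 1 + c * (5 / (2 * sqrt (real n)))"
      using eventually_ge_at_top[of "max m 2"] by eventually_elim (simp add: bound[simplified])
    show "(\<lambda>n. (1 + K) / (2 * sqrt (real n)) + c / (real n - 1) * (1 / 36) + c / (real n - 1) * 1 + c * (5 / (2 * sqrt (real n)))) \<longlonglongrightarrow> 0"
      by real_asymp
  qed
  have We: "c / pi ^ 4 * chi_series chi x = c * (C.W x - 1 / 36)" for x by (simp add: C.W_def)
  have "weak_conv_m (\<lambda>n. distr M borel (A n)) (distr N borel (\<lambda>x. c * (C.W x - 1 / 36)))"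
  proof (rule weak_conv_of_L1_close[OF prob_space_axioms C.prob_space_axioms Am _ Bm close])
    note [measurable] = C.W_measurable
    show "(\<lambda>x. c * (C.W x - 1 / 36)) \<in> borel_measurable N" by measurable
    show "integrable M (\<lambda>x. A n x - B n x)" for n using iA iB by simp
    show "(\<lambda>n. char (distr M borel (B n)) t) \<longlonglongrightarrow> char (distr N borel (\<lambda>x. c * (C.W x - 1 / 36))) t" for t
      unfolding B_def char_affine[OF V_measurable] char_affine[OF C.W_measurable]
      by (intro tendsto_mult_left C.char_V_tendsto uniform_seq_axioms)
  qed
  then show ?thesis by (simp only: We A_def[abs_def])
qed

end

section \<open>The probability integral transform\<close>

lemma cdf_U01: "cdf U01 u = max 0 (min 1 u)"
proof -
  have "measure U01 {..u} = measure lborel ({0..1} \<inter> {..u})"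
    unfolding U01_def by (subst measure_uniform_measure) auto
  also have "\<dots> = max 0 (min 1 u)"
  proof (cases "u < 0")
    case True
    then have "{0..1} \<inter> {..u} = {}" by auto
    then show ?thesis using True by simp
  next
    case False
    then have "{0..1} \<inter> {..u} = {0..min 1 u}" by auto
    then show ?thesis using False by simp
  qed
  finally show ?thesis by (simp add: cdf_def)
qed

text \<open>A continuous distribution function may have flat pieces and no inverse. The intermediate
  value theorem still supplies a point for every height in (0,1), and these points bracket the sets
  where the function is at most u.\<close>

lemma (in real_distribution) distr_cdf_eq_U01:
  assumes cont: "\<And>x. isCont (cdf M) x"
  shows "distr M borel (cdf M) = U01"
proof (rule cdf_unique)
  have cm: "continuous_on UNIV (cdf M)" using cont by (simp add: continuous_on_eq_continuous_at)
  then have [measurable]: "cdf M \<in> borel_measurable borel" by (rule borel_measurable_continuous_onI)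
  show "real_distribution (distr M borel (cdf M))" by (rule real_distribution_distr) measurable
  show "real_distribution U01" using U01.prob_space_axioms by (auto simp: real_distribution_def real_distribution_axioms_def)
  have hit: "\<exists>x. cdf M x = v" if v: "0 < v" "v < 1" for v
  proof -
    obtain a where a: "cdf M a < v"
      using order_tendstoD(2)[OF cdf_lim_at_bot v(1)] by (auto simp: eventually_at_bot_linorder)
    obtain b where b: "v < cdf M b"
      using order_tendstoD(1)[OF cdf_lim_at_top_prob v(2)] by (auto simp: eventually_at_top_linorder)
    have "a \<le> b" using a b cdf_nondecreasing[of b a] by linarith
    then show ?thesis using IVT[of "cdf M" a v b] a b cont by auto
  qed
  show "cdf (distr M borel (cdf M)) = cdf U01"
  proof
    fix u
    have e: "cdf (distr M borel (cdf M)) u = prob {x. cdf M x \<le> u}"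
      unfolding cdf_def[of "distr M borel (cdf M)"] by (subst measure_distr) (auto simp: vimage_def)
    have ev: "{x. cdf M x \<le> u} \<in> events" by measurable
    consider "u < 0" | "1 \<le> u" | "0 \<le> u" "u < 1" by linarith
    then show "cdf (distr M borel (cdf M)) u = cdf U01 u"
    proof cases
      case 1
      then have "{x. cdf M x \<le> u} = {}" using cdf_nonneg by (auto simp: not_le intro: less_le_trans)
      then show ?thesis using 1 unfolding e cdf_U01 by simp
    next
      case 2
      then have "{x. cdf M x \<le> u} = UNIV" using cdf_bounded_prob by (auto intro: order_trans)
      then show ?thesis using 2 prob_space unfolding e cdf_U01 by simp
    next
      case 3
      \<comment> \<open>At height u there may be a flat piece, so the set is bounded by half-lines
        ending at points of height v > u, and v is let down to u.\<close>
      have "prob {x. cdf M x \<le> u} \<le> u"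
      proof (rule dense_ge_bounded[OF 3(2)])
        fix v assume v: "u < v" "v < 1"
        then obtain x1 where x1: "cdf M x1 = v" using hit[of v] 3 by auto
        have "{x. cdf M x \<le> u} \<subseteq> {..x1}"
        proof
          fix x assume "x \<in> {x. cdf M x \<le> u}"
          then have "cdf M x < cdf M x1" using v x1 by simp
          then show "x \<in> {..x1}" using cdf_nondecreasing[of x1 x] by (cases "x \<le> x1") auto
        qed
        then have "prob {x. cdf M x \<le> u} \<le> prob {..x1}" by (intro finite_measure_mono) auto
        then show "prob {x. cdf M x \<le> u} \<le> v" using x1 by (simp add: cdf_def)
      qed
      moreover have "u \<le> prob {x. cdf M x \<le> u}"
      proof (cases "u = 0")
        case False
        then obtain x0 where x0: "cdf M x0 = u" using hit[of u] 3 by auto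
        have "{..x0} \<subseteq> {x. cdf M x \<le> u}" using cdf_nondecreasing x0 by auto
        then have "prob {..x0} \<le> prob {x. cdf M x \<le> u}" using ev by (intro finite_measure_mono) auto
        then show ?thesis using x0 by (simp add: cdf_def)
      qed simp
      ultimately show ?thesis using 3 unfolding e cdf_U01 by simp
    qed
  qed
qed

text \<open>Under independence the joint distribution function is a product. Freezing one argument
  where its marginal is positive and dividing by that value leaves the other marginal.\<close>

lemma isCont_marginal_cdf:
  assumes M0: "prob_space M0" and XY: "prob_space.indep_var M0 borel X borel Y"
    and cont: "continuous_on UNIV (joint_cdf M0 X Y)"
  shows "isCont (cdf (distr M0 borel X)) x" "isCont (cdf (distr M0 borel Y)) x"
proof -
  interpret prob_space M0 by fact
  have [measurable]: "X \<in> borel_measurable M0" "Y \<in> borel_measurable M0"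
    using XY by (auto dest: indep_var_rv1 indep_var_rv2)
  interpret DX: real_distribution "distr M0 borel X" by (rule real_distribution_distr) measurable
  interpret DY: real_distribution "distr M0 borel Y" by (rule real_distribution_distr) measurable
  have J: "joint_cdf M0 X Y (x, y) = cdf (distr M0 borel X) x * cdf (distr M0 borel Y) y" for x y
  proof -
    have "{\<omega> \<in> space M0. X \<omega> \<le> x \<and> Y \<omega> \<le> y} = (\<lambda>\<omega>. (X \<omega>, Y \<omega>)) -` ({..x} \<times> {..y}) \<inter> space M0" by auto
    then have "joint_cdf M0 X Y (x, y) = measure (distr M0 (borel \<Otimes>\<^sub>M borel) (\<lambda>\<omega>. (X \<omega>, Y \<omega>))) ({..x} \<times> {..y})"
      by (simp add: joint_cdf_def measure_distr)
    also have "\<dots> = measure (distr M0 borel X \<Otimes>\<^sub>M distr M0 borel Y) ({..x} \<times> {..y})"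
      using XY by (simp add: indep_var_distribution_eq)
    also have "\<dots> = cdf (distr M0 borel X) x * cdf (distr M0 borel Y) y"
      by (simp add: cdf_def measure_def DY.emeasure_pair_measure_Times enn2real_mult)
    finally show ?thesis .
  qed
  have "\<exists>y. cdf (distr M0 borel Y) y > 0"
    using order_tendstoD(1)[OF DY.cdf_lim_at_top_prob, of 0] by (auto simp: eventually_at_top_linorder)
  then obtain y where y: "cdf (distr M0 borel Y) y > 0" by blast
  have "\<exists>x. cdf (distr M0 borel X) x > 0"
    using order_tendstoD(1)[OF DX.cdf_lim_at_top_prob, of 0] by (auto simp: eventually_at_top_linorder)
  then obtain x0 where x0: "cdf (distr M0 borel X) x0 > 0" by blast
  have "continuous_on UNIV (\<lambda>x. joint_cdf M0 X Y (x, y) / cdf (distr M0 borel Y) y)"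
    using y by (intro continuous_on_divide continuous_on_compose2[OF cont] continuous_intros) auto
  then show "isCont (cdf (distr M0 borel X)) x"
    using y by (simp add: J continuous_on_eq_continuous_at)
  have "continuous_on UNIV (\<lambda>y. joint_cdf M0 X Y (x0, y) / cdf (distr M0 borel X) x0)"
    using x0 by (intro continuous_on_divide continuous_on_compose2[OF cont] continuous_intros) auto
  then show "isCont (cdf (distr M0 borel Y)) x"
    using x0 by (simp add: J continuous_on_eq_continuous_at)
qed

lemma (in prob_space) distr_cdf_transform:
  assumes X [measurable]: "X \<in> borel_measurable M" and cont: "\<And>x. isCont (cdf (distr M borel X)) x"
  shows "distr M U01 (\<lambda>\<omega>. cdf (distr M borel X) (X \<omega>)) = U01"
proof -
  interpret D: real_distribution "distr M borel X" by (rule real_distribution_distr) measurable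
  have [measurable]: "cdf (distr M borel X) \<in> borel_measurable borel"
    using cont by (auto intro!: borel_measurable_continuous_onI simp: continuous_on_eq_continuous_at)
  have "distr M U01 (\<lambda>\<omega>. cdf (distr M borel X) (X \<omega>)) = distr M borel (cdf (distr M borel X) \<circ> X)"
    by (rule distr_cong) auto
  also have "\<dots> = distr (distr M borel X) borel (cdf (distr M borel X))" by (rule distr_distr[symmetric]) measurable
  also have "\<dots> = U01" using cont by (rule D.distr_cdf_eq_U01)
  finally show ?thesis .
qed

text \<open>A monotone map can destroy an order relation only by identifying the two points; for the
  transformed sample such ties have probability zero.\<close>

lemma mono_le_iff:
  fixes F :: "real \<Rightarrow> real"
  assumes "mono F" "F x \<noteq> F y"
  shows "x \<le> y \<longleftrightarrow> F x \<le> F y"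
  using assms by (metis antisym linorder_le_cases monoD)

text \<open>The marginal distribution functions map the sample to points uniform on the unit square.
  Almost surely no ties arise, so relative orders are preserved and each U-statistic takes the same
  value on both samples. The uniform case then applies with the coefficients 36, 1 and 1.\<close>

theorem proposition5p9:
  fixes M0 :: "'a measure" and X Y :: "'a \<Rightarrow> real"
    and M :: "'b measure" and Z :: "nat \<Rightarrow> 'b \<Rightarrow> real \<times> real"
    and N :: "'c measure" and chi :: "nat \<Rightarrow> nat \<Rightarrow> 'c \<Rightarrow> real"
  assumes "prob_space M0" and "prob_space M" and "prob_space N"
    and XY_indep: "prob_space.indep_var M0 borel X borel Y"
    and XY_cont: "continuous_on UNIV (joint_cdf M0 X Y)"
    and Z_indep: "prob_space.indep_vars M (\<lambda>_. borel) Z {1..}"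
    and Z_copies: "\<And>i. i \<ge> 1 \<Longrightarrow> distr M borel (Z i) = distr M0 borel (\<lambda>\<omega>. (X \<omega>, Y \<omega>))"
    and chi_indep: "prob_space.indep_vars N (\<lambda>_. borel) (\<lambda>(i, j). chi i j) ({1..} \<times> {1..})"
    and chi_law: "\<And>i j. i \<ge> 1 \<Longrightarrow> j \<ge> 1 \<Longrightarrow> distr N borel (chi i j) = chi_square_1"
  shows "converges_in_distribution M (\<lambda>n \<omega>. real n * U_tau n (\<lambda>i. Z i \<omega>))
           N (\<lambda>\<omega>. 36 / pi ^ 4 * chi_series chi \<omega>)
      \<and> converges_in_distribution M (\<lambda>n \<omega>. real n * U_D n (\<lambda>i. Z i \<omega>))
           N (\<lambda>\<omega>. 1 / pi ^ 4 * chi_series chi \<omega>)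
      \<and> converges_in_distribution M (\<lambda>n \<omega>. real n * U_R n (\<lambda>i. Z i \<omega>))
           N (\<lambda>\<omega>. 1 / pi ^ 4 * chi_series chi \<omega>)"
proof -
  interpret M0: prob_space M0 by fact
  interpret M: prob_space M by fact
  interpret N: prob_space N by fact
  have Xm [measurable]: "X \<in> borel_measurable M0" and Ym [measurable]: "Y \<in> borel_measurable M0"
    using XY_indep by (auto dest: M0.indep_var_rv1 M0.indep_var_rv2)
  interpret DX: real_distribution "distr M0 borel X" by (rule M0.real_distribution_distr) measurable
  interpret DY: real_distribution "distr M0 borel Y" by (rule M0.real_distribution_distr) measurable
  define F where "F = cdf (distr M0 borel X)"
  define G where "G = cdf (distr M0 borel Y)"
  have contF: "isCont F x" and contG: "isCont G x" for x
    unfolding F_def G_def by (rule isCont_marginal_cdf[OF assms(1) XY_indep XY_cont])+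
  have [measurable]: "F \<in> borel_measurable borel" "G \<in> borel_measurable borel"
    using contF contG by (auto intro!: borel_measurable_continuous_onI simp: continuous_on_eq_continuous_at)
  have monoF: "mono F" and monoG: "mono G"
    unfolding F_def G_def by (auto intro!: monoI DX.cdf_nondecreasing DY.cdf_nondecreasing)
  have rangeF: "F x \<in> {0..1}" and rangeG: "G x \<in> {0..1}" for x
    unfolding F_def G_def using DX.cdf_nonneg DX.cdf_bounded_prob DY.cdf_nonneg DY.cdf_bounded_prob by auto
  have lawF: "distr M0 U01 (\<lambda>\<omega>. F (X \<omega>)) = U01" and lawG: "distr M0 U01 (\<lambda>\<omega>. G (Y \<omega>)) = U01"
    using contF contG unfolding F_def G_def by (auto intro!: M0.distr_cdf_transform)
  define h where "h z = (F (fst z), G (snd z))" for z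
  have hm [measurable]: "h \<in> borel \<rightarrow>\<^sub>M U2"
  proof -
    have "h \<in> borel \<Otimes>\<^sub>M borel \<rightarrow>\<^sub>M U2" unfolding h_def
      by (intro measurable_Pair) (auto simp: measurable_cong_sets[OF refl sets_U01])
    then show ?thesis by (simp add: borel_prod)
  qed
  define P where "P i \<omega> = h (Z i \<omega>)" for i \<omega>
  have Zm: "Z i \<in> M \<rightarrow>\<^sub>M borel" if "i \<ge> 1" for i using Z_indep that by (auto simp: M.indep_vars_def)
  have uniform: "uniform_seq M P"
  proof unfold_locales
    show "M.indep_vars (\<lambda>_. U2) P {1..}"
      unfolding P_def by (rule M.indep_vars_compose2[OF Z_indep]) (rule hm)
    show "P i x \<in> {0..1} \<times> {0..1}" for i x using rangeF rangeG by (auto simp: P_def h_def)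
    fix i :: nat assume i: "i \<ge> 1"
    have "distr M U2 (P i) = distr (distr M borel (Z i)) U2 h"
      unfolding P_def by (subst distr_distr[OF hm Zm[OF i]]) (simp add: comp_def)
    also have "\<dots> = distr (distr M0 borel (\<lambda>\<omega>. (X \<omega>, Y \<omega>))) U2 h" by (simp only: Z_copies[OF i])
    also have "\<dots> = distr M0 U2 (\<lambda>\<omega>. (F (X \<omega>), G (Y \<omega>)))"
      by (subst distr_distr[OF hm]) (auto simp: h_def comp_def)
    also have "\<dots> = distr M0 U01 (\<lambda>\<omega>. F (X \<omega>)) \<Otimes>\<^sub>M distr M0 U01 (\<lambda>\<omega>. G (Y \<omega>))"
    proof -
      have "M0.indep_var U01 (F \<circ> X) U01 (G \<circ> Y)"
        by (rule M0.indep_var_compose[OF XY_indep]) measurable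
      then show ?thesis by (simp add: M0.indep_var_distribution_eq comp_def)
    qed
    also have "\<dots> = U2" by (simp only: lawF lawG)
    finally show "distr M U2 (P i) = U2" .
  qed
  then interpret U: uniform_seq M P .
  have chi: "chi_family N chi" using chi_indep chi_law by unfold_locales
  have same_order: "AE \<omega> in M. \<forall>p\<in>{1..n}. \<forall>q\<in>{1..n} - {p}.
      (fst (Z p \<omega>) \<le> fst (Z q \<omega>) \<longleftrightarrow> fst (P p \<omega>) \<le> fst (P q \<omega>)) \<and>
      (snd (Z p \<omega>) \<le> snd (Z q \<omega>) \<longleftrightarrow> snd (P p \<omega>) \<le> snd (P q \<omega>))" if n: "n \<ge> 1" for n
  proof -
    have "AE z in distr M (PiM {1..n} (\<lambda>_. U2)) (\<lambda>x. \<lambda>i\<in>{1..n}. P i x).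
      \<forall>p\<in>{1..n}. \<forall>q\<in>{1..n} - {p}. fst (z p) \<noteq> fst (z q) \<and> snd (z p) \<noteq> snd (z q)"
      unfolding U.distr_tuple[OF n] using AE_U2_generic[of n] by eventually_elim blast
    from AE_distrD[OF U.tuple_measurable this] show ?thesis
    proof eventually_elim
      case (elim \<omega>)
      show ?case
      proof (intro ballI)
        fix p q assume pq: "p \<in> {1..n}" "q \<in> {1..n} - {p}"
        with elim have "fst (P p \<omega>) \<noteq> fst (P q \<omega>)" "snd (P p \<omega>) \<noteq> snd (P q \<omega>)" by force+
        then show "(fst (Z p \<omega>) \<le> fst (Z q \<omega>) \<longleftrightarrow> fst (P p \<omega>) \<le> fst (P q \<omega>)) \<and>
          (snd (Z p \<omega>) \<le> snd (Z q \<omega>) \<longleftrightarrow> snd (P p \<omega>) \<le> snd (P q \<omega>))"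
          using mono_le_iff[OF monoF] mono_le_iff[OF monoG] by (simp add: P_def h_def)
      qed
    qed
  qed
  have main: "converges_in_distribution M (\<lambda>n \<omega>. real n * U_stat m c0 IX IY n (\<lambda>i. Z i \<omega>)) N (\<lambda>\<omega>. c / pi ^ 4 * chi_series chi \<omega>)"
    if a: "bounded_measurable U01 (signed_sum m IX)" "dep_on {1..m} (signed_sum m IX)" "order_invariant m (signed_sum m IX)"
      and b: "bounded_measurable U01 (signed_sum m IY)" "dep_on {1..m} (signed_sum m IY)" "order_invariant m (signed_sum m IY)"
      and L2: "\<exists>K. \<forall>n\<ge>m. (\<integral>z. (real n * U_stat m c0 IX IY n z - c / (real n - 1) * pair_sum n z)\<^sup>2 \<partial>PiM {1..n} (\<lambda>_. U2)) \<le> K / real n"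
      and c: "c > 0" for m c0 IX IY and c :: real
  proof -
    note reg = U_stat_regular[OF a(1,2) b(1,2)]
    have Um: "U_stat m c0 IX IY n \<in> borel_measurable (PiM UNIV (\<lambda>_. U2))" for n
      using reg(1) by (simp add: bounded_measurable_def)
    \<comment> \<open>The product \<open>U2\<close> and the Borel structure of the plane have the
      same measurable sets.\<close>
    have ZU: "Z i \<in> M \<rightarrow>\<^sub>M U2" if "i \<ge> 1" for i
      using Zm[OF that] by (simp add: measurable_cong_sets[OF refl sets_U2])
    have "distr M borel (\<lambda>\<omega>. real n * U_stat m c0 IX IY n (\<lambda>i. Z i \<omega>)) =
      distr M borel (\<lambda>\<omega>. real n * U_stat m c0 IX IY n (\<lambda>i. P i \<omega>))" for n
    proof (rule distr_cong_AE)
      show "(\<lambda>\<omega>. real n * U_stat m c0 IX IY n (\<lambda>i. Z i \<omega>)) \<in> borel_measurable M"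
        by (intro borel_measurable_times borel_measurable_const measurable_tuple_stat[OF Um reg(2)] ZU) auto
      show "(\<lambda>\<omega>. real n * U_stat m c0 IX IY n (\<lambda>i. P i \<omega>)) \<in> borel_measurable M"
        by (intro borel_measurable_times borel_measurable_const measurable_tuple_stat[OF Um reg(2)] U.rv) auto
      show "AE \<omega> in M. real n * U_stat m c0 IX IY n (\<lambda>i. Z i \<omega>) = real n * U_stat m c0 IX IY n (\<lambda>i. P i \<omega>)"
      \<comment> \<open>For n = 0 both sides vanish through the factor
        \<open>real n\<close>.\<close>
      proof (cases "n \<ge> 1")
        case True
        from same_order[OF True] show ?thesis
        proof eventually_elim
          case (elim \<omega>)
          then show ?case by (intro arg_cong2[where f="(*)"] refl U_stat_order_invariant[OF a b]) blast
        qed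
      qed simp
    qed simp_all
    then show ?thesis unfolding converges_in_distribution_def
      using U.weak_conv_of_pair_sum[OF chi reg L2 c] by (simp only:)
  qed
  have t: "bounded_measurable U01 (signed_sum 4 I_tau)" "dep_on {1..4} (signed_sum 4 I_tau)" "order_invariant 4 (signed_sum 4 I_tau)"
    unfolding signed_sum_tau by (rule bounded_measurable_tau dep_on_tau order_invariant_tau)+
  have s: "bounded_measurable U01 (signed_sum m (I_split l))" "dep_on {1..m} (signed_sum m (I_split l))"
    "order_invariant m (signed_sum m (I_split l))" if "5 \<le> l" "l \<le> m" for l m
    using that signed_sum_split[of l m] bounded_measurable_split dep_on_split[of l m] order_invariant_split[of l m] by auto
  have "converges_in_distribution M (\<lambda>n \<omega>. real n * U_tau n (\<lambda>i. Z i \<omega>)) N (\<lambda>\<omega>. 36 / pi ^ 4 * chi_series chi \<omega>)"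
    unfolding U_tau_def by (rule main[OF t t U_tau_pair_sum[unfolded U_tau_def]]) simp
  moreover have "converges_in_distribution M (\<lambda>n \<omega>. real n * U_D n (\<lambda>i. Z i \<omega>)) N (\<lambda>\<omega>. 1 / pi ^ 4 * chi_series chi \<omega>)"
    unfolding U_D_def by (rule main[OF s s U_D_pair_sum[unfolded U_D_def]]) simp_all
  moreover have "converges_in_distribution M (\<lambda>n \<omega>. real n * U_R n (\<lambda>i. Z i \<omega>)) N (\<lambda>\<omega>. 1 / pi ^ 4 * chi_series chi \<omega>)"
    unfolding U_R_def by (rule main[OF s s U_R_pair_sum[unfolded U_R_def]]) simp_all
  ultimately show ?thesis by blast
qed

end
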